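(* Let $q$ be a prime power, $\mathbb{F}_q$ the field with $q$ elements, $V=\mathbb{F}_q^n$, and let $1<k<n-1$. (1) If $q\ge 3$ or $k\ge 3$, then every isomorphism of $\Gamma(n,k)_q$ onto a subgraph of $\Gamma_k(V)$ can be uniquely extended to an automorphism of $\Gamma_k(V)$; that is, for every injective map $f:\mathcal{C}(n,k)_q\to\mathcal{G}_k(V)$ which is an isomorphism of $\Gamma(n,k)_q$ onto some (not necessarily induced) subgraph of $\Gamma_k(V)$, there is a unique automorphism $g$ of $\Gamma_k(V)$ whose restriction to $\mathcal{C}(n,k)_q$ equals $f$. (2) If $q=k=2$, then there exist subgraphs of $\Gamma_k(V)$ isomorphic to $\Gamma(n,k)_q$ such that isomorphisms between these subgraphs and $\Gamma(n,k)_q$ cannot be extended to automorphisms of $\Gamma_k(V)$.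
   Context: For a vector space $V$ of dimension $n$ over $\mathbb{F}_q$, $\mathcal{G}_k(V)$ denotes the set of $k$-dimensional subspaces of $V$. Two $k$-dimensional subspaces are adjacent if their intersection is $(k-1)$-dimensional. The Grassmann graph $\Gamma_k(V)$ has vertex set $\mathcal{G}_k(V)$, with edges joining adjacent subspaces. For $V=\mathbb{F}_q^n$ with standard basis $e_1,\dots,e_n$, let $C_i$ be the coordinate hyperplane $\{x: x_i=0\}$. A $k$-dimensional subspace $C$ (a linear $[n,k]_q$ code) is non-degenerate if it is contained in no $C_i$; $\mathcal{C}(n,k)_q=\mathcal{G}_k(V)\setminus\bigcup_{i=1}^n\mathcal{G}_k(C_i)$ is the set of non-degenerate codes, and $\Gamma(n,k)_q$ is the induced subgraph of $\Gamma_k(V)$ on $\mathcal{C}(n,k)_q$. Subgraphs of $\Gamma_k(V)$ are not assumed to be induced. *)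

theory Defs
  imports "HOL-Analysis.Cartesian_Space" "HOL-Library.FuncSet"
begin

record 'v ugraph =
  verts :: "'v set"
  edges :: "'v set set"

definition wf_ugraph :: "'v ugraph \<Rightarrow> bool" where
  "wf_ugraph G \<longleftrightarrow> edges G \<subseteq> {{x, y} | x y. x \<in> verts G \<and> y \<in> verts G \<and> x \<noteq> y}"

text \<open>Subgraphs are not required to be induced.\<close>

definition is_subgraph :: "'v ugraph \<Rightarrow> 'v ugraph \<Rightarrow> bool" where
  "is_subgraph H G \<longleftrightarrow> wf_ugraph H \<and> verts H \<subseteq> verts G \<and> edges H \<subseteq> edges G"

definition induced_subgraph :: "'v ugraph \<Rightarrow> 'v set \<Rightarrow> 'v ugraph" where
  "induced_subgraph G W = \<lparr>verts = verts G \<inter> W, edges = {e \<in> edges G. e \<subseteq> W}\<rparr>"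

definition graph_iso :: "('v \<Rightarrow> 'w) \<Rightarrow> 'v ugraph \<Rightarrow> 'w ugraph \<Rightarrow> bool" where
  "graph_iso f G H \<longleftrightarrow> bij_betw f (verts G) (verts H) \<and>
     (\<forall>x\<in>verts G. \<forall>y\<in>verts G. {x, y} \<in> edges G \<longleftrightarrow> {f x, f y} \<in> edges H)"

definition graph_aut :: "('v \<Rightarrow> 'v) \<Rightarrow> 'v ugraph \<Rightarrow> bool" where
  "graph_aut g G \<longleftrightarrow> graph_iso g G G"

definition Grassmannian :: "nat \<Rightarrow> ('a::field ^ 'n::finite) set \<Rightarrow> ('a ^ 'n) set set" where
  "Grassmannian k W = {S. vec.subspace S \<and> S \<subseteq> W \<and> vec.dim S = k}"

text \<open>The dimension condition is written without subtraction, so that for \<open>k = 0\<close> nothing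
  is adjacent to itself.\<close>

definition grassmann_graph :: "nat \<Rightarrow> ('a::field ^ 'n::finite) set ugraph" where
  "grassmann_graph k = \<lparr>verts = Grassmannian k UNIV,
     edges = {{S, T} | S T. S \<in> Grassmannian k UNIV \<and> T \<in> Grassmannian k UNIV \<and>
                            vec.dim (S \<inter> T) + 1 = k}\<rparr>"

definition coord_hyperplane :: "'n \<Rightarrow> ('a::field ^ 'n::finite) set" where
  "coord_hyperplane i = {x. x $ i = 0}"

definition nondegenerate_codes :: "nat \<Rightarrow> ('a::field ^ 'n::finite) set set" where
  "nondegenerate_codes k = Grassmannian k UNIV - (\<Union>i. Grassmannian k (coord_hyperplane i))"

definition code_graph :: "nat \<Rightarrow> ('a::field ^ 'n::finite) set ugraph" where
  "code_graph k = induced_subgraph (grassmann_graph k) (nondegenerate_codes k)"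

end

theory Submission imports Defs begin

text \<open>
  An isomorphism onto a subgraph is the same as an injective adjacency preserving map \<open>f\<close> on the
  nondegenerate codes. Cliques of the Grassmann graph lie in stars (all \<open>k\<close>-subspaces containing a
  fixed \<open>(k - 1)\<close>-subspace) or in tops (all \<open>k\<close>-subspaces of a fixed \<open>(k + 1)\<close>-subspace). A star
  whose centre is nondegenerate consists of nondegenerate codes only, and counting shows that \<open>f\<close>
  maps these stars onto stars, or, if \<open>n = 2k\<close>, possibly all of them onto tops; in the latter case
  one composes with the orthogonal complement.

  If stars go to stars, the intersections \<open>\<Inter> {f Y | X \<subseteq> Y}\<close> define injective maps on the nondegenerate
  subspaces \<open>X\<close> of every dimension at most \<open>k\<close>, which preserve inclusion and send stars onto stars.
  For \<open>q \<ge> 3\<close> the same intersection is a point for every point \<open>X\<close>, since the points with no zero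
  coordinate are spread out too much to be sent into a \<open>(k + 1)\<close>-subspace; the resulting map of points
  is a collineation which induces \<open>f\<close>. For \<open>q = 2\<close> the all-one vector \<open>1\<close> is the only
  point of this kind, and the image of a point \<open>x\<close> is found by intersecting the image of the line
  through \<open>x\<close> and \<open>1\<close> with the images of the other nondegenerate lines through \<open>x\<close>. The map so obtained
  is additive because, for \<open>k \<ge> 3\<close>, it separates \<open>x\<close> from \<open>x + 1\<close>. This last point fails for \<open>k = 2\<close>:
  projecting the lines that avoid \<open>1\<close> from \<open>1\<close> to a coordinate hyperplane is injective on
  nondegenerate lines and preserves adjacency, but it creates new adjacencies.
\<close>

section \<open>Subspaces over a finite field\<close>

text \<open>Sizes decide between stars and tops: a star has 1 + q + ... + q^(n-k) members, a top 1 +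
  q + ... + q^k. For n > 2k a star does not fit into a top. For n < 2k it does, but the
  nondegenerate parts of two tops through one star centre do not fit together into a single top. For
  n = 2k both sizes agree, and mixed types are excluded by comparing adjacent centres.

  The obstacle is that \<open>f\<close> says nothing about degenerate codes: a degenerate point has
  no image a priori, and for k = 2 there is no induced map on 3-dimensional subspaces. Vectors
  without zero coordinates, above all \<open>1\<close>, repair this, since every subspace containing
  one is nondegenerate.

  What induces \<open>f\<close> is an injective homogeneous map of vectors that sends x + y into the
  span of the images of x and y. This already carries subspaces to subspaces of the same dimension,
  hence adjacent codes to adjacent codes.

  Uniqueness is a separate matter: a degenerate code is recovered from the set of its nondegenerate
  neighbours.\<close>

abbreviation Gr :: "nat \<Rightarrow> ('a::field ^ 'n::finite) set set" where
  "Gr k \<equiv> Grassmannian k UNIV"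

abbreviation join :: "('a::field ^ 'n::finite) set \<Rightarrow> ('a ^ 'n) set \<Rightarrow> ('a ^ 'n) set" where
  "join X Y \<equiv> vec.span (X \<union> Y)"

abbreviation adjoin :: "'a::field ^ 'n::finite \<Rightarrow> ('a ^ 'n) set \<Rightarrow> ('a ^ 'n) set" where
  "adjoin x X \<equiv> vec.span (insert x X)"

abbreviation pt :: "'a::field ^ 'n::finite \<Rightarrow> ('a ^ 'n) set" where
  "pt x \<equiv> vec.span {x}"

lemma mem_Gr: "X \<in> Gr k \<longleftrightarrow> vec.subspace X \<and> vec.dim X = k"
  by (simp add: Grassmannian_def)

lemma subspace_Gr: "X \<in> Gr k \<Longrightarrow> vec.subspace X"
  and dim_Gr: "X \<in> Gr k \<Longrightarrow> vec.dim X = k"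
  by (simp_all add: mem_Gr)

lemma join_least: "vec.subspace Z \<Longrightarrow> X \<subseteq> Z \<Longrightarrow> Y \<subseteq> Z \<Longrightarrow> join X Y \<subseteq> Z"
  by (simp add: vec.span_minimal)

lemma join_upper1: "X \<subseteq> join X Y" and join_upper2: "Y \<subseteq> join X Y"
  using vec.span_superset by fastforce+

lemma Gr_eqI: "X \<in> Gr k \<Longrightarrow> Y \<in> Gr k \<Longrightarrow> X \<subseteq> Y \<Longrightarrow> X = Y"
  by (rule vec.subspace_dim_equal) (auto simp: mem_Gr)

lemma span_subspace: "vec.subspace X \<Longrightarrow> vec.span X = X"
  by (simp only: vec.span_eq_iff)

lemma dim_span_insert:
  "vec.subspace X \<Longrightarrow> x \<notin> X \<Longrightarrow> vec.dim (adjoin x X) = vec.dim X + 1"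
  by (simp add: vec.dim_insert span_subspace)

lemma span_insert_iff:
  assumes "vec.subspace X"
  shows "y \<in> adjoin x X \<longleftrightarrow> (\<exists>c. \<exists>z\<in>X. y = c *s x + z)"
proof -
  have "y - c *s x \<in> X \<longleftrightarrow> (\<exists>z\<in>X. y = c *s x + z)" for c
    by (metis add.commute add_diff_cancel_left' diff_add_cancel)
  then show ?thesis by (simp add: vec.span_insert span_subspace[OF assms])
qed

lemma span_insert_least:
  "vec.subspace Z \<Longrightarrow> x \<in> Z \<Longrightarrow> X \<subseteq> Z \<Longrightarrow> adjoin x X \<subseteq> Z"
  by (simp add: vec.span_minimal)

lemma span_insert_eq:
  assumes "S \<in> Gr j" "Y \<in> Gr (Suc j)" "S \<subseteq> Y" "x \<in> Y" "x \<notin> S"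
  shows "adjoin x S = Y"
proof (rule Gr_eqI)
  show "adjoin x S \<in> Gr (Suc j)"
    using dim_span_insert[of S x] assms by (simp add: mem_Gr)
  show "adjoin x S \<subseteq> Y"
    using assms by (intro span_insert_least) (auto simp: mem_Gr)
qed (rule assms(2))

lemma dim_le_CARD: "vec.dim (X :: ('a::field ^ 'n::finite) set) \<le> CARD('n)"
  by (metis vec.dim_subset subset_UNIV vec_dim_card)

lemma card_field_ge2: "CARD('a::{field,finite}) \<ge> 2"
proof -
  have "card {0::'a, 1} \<le> CARD('a)" by (rule card_mono) auto
  then show ?thesis by simp
qed

lemma card_span_insert:
  fixes X :: "('a::{field,finite} ^ 'n::finite) set"
  assumes X: "vec.subspace X" and x: "x \<notin> X"
  shows "card (adjoin x X) = CARD('a) * card X"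
proof -
  let ?h = "\<lambda>(c, z). c *s x + z"
  have "adjoin x X = ?h ` (UNIV \<times> X)"
    by (force simp: span_insert_iff[OF X] image_iff)
  moreover have "inj_on ?h (UNIV \<times> X)"
  proof (rule inj_onI, clarsimp)
    fix c z d y assume zy: "z \<in> X" "y \<in> X" and eq: "c *s x + z = d *s x + y"
    have "(c - d) *s x = y - z" using eq by (simp add: algebra_simps)
    then have cd: "(c - d) *s x \<in> X" using zy X vec.subspace_diff by metis
    have "c = d"
    proof (rule ccontr)
      assume "c \<noteq> d"
      then have "inverse (c - d) *s ((c - d) *s x) = x" by simp
      then show False using cd x X vec.subspace_scale by metis
    qed
    then show "c = d \<and> z = y" using eq by simp
  qed
  ultimately show ?thesis by (simp add: card_image card_cartesian_product)
qed

lemma exists_intermediate_subspace: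
  fixes S Y :: "('a::field ^ 'n::finite) set"
  assumes "vec.subspace S" "vec.subspace Y" "S \<subseteq> Y" "vec.dim S \<le> j" "j \<le> vec.dim Y"
  shows "\<exists>R. R \<in> Gr j \<and> S \<subseteq> R \<and> R \<subseteq> Y"
  using assms(4,5)
proof (induction j)
  case 0
  then show ?case using assms by (intro exI[of _ S]) (auto simp: mem_Gr)
next
  case (Suc j)
  show ?case
  proof (cases "vec.dim S \<le> j")
    case False
    then show ?thesis using assms Suc by (intro exI[of _ S]) (auto simp: mem_Gr)
  next
    case True
    then obtain R where R: "R \<in> Gr j" "S \<subseteq> R" "R \<subseteq> Y" using Suc by auto
    then have "\<not> Y \<subseteq> R" using Suc.prems by (metis dim_Gr vec.dim_subset not_less_eq_eq)
    then obtain y where y: "y \<in> Y" "y \<notin> R" by blast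
    have "adjoin y R \<in> Gr (Suc j)"
      using dim_span_insert[OF _ y(2)] R by (simp add: mem_Gr)
    moreover have "adjoin y R \<subseteq> Y" using y R assms by (intro span_insert_least) auto
    moreover have "S \<subseteq> adjoin y R" using R vec.span_superset by fastforce
    ultimately show ?thesis by blast
  qed
qed

lemma card_subspace:
  fixes X :: "('a::{field,finite} ^ 'n::finite) set"
  assumes "vec.subspace X"
  shows "card X = CARD('a) ^ vec.dim X"
  using assms
proof (induction "vec.dim X" arbitrary: X)
  case 0
  then have "X = {0}" using vec.subspace_0 by (metis vec.dim_eq_0 subset_singletonD empty_iff)
  then show ?case by (simp)
next
  case (Suc d)
  obtain R where R: "R \<in> Gr d" "R \<subseteq> X"
    using exists_intermediate_subspace[of "{0}" X d] Suc by (auto simp: vec.subspace_0)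
  then have "\<not> X \<subseteq> R" using Suc.hyps(2) by (metis dim_Gr vec.dim_subset not_less_eq_eq order_refl)
  then obtain x where x: "x \<in> X" "x \<notin> R" by blast
  have "adjoin x R = X"
    using x R Suc dim_span_insert[OF subspace_Gr[OF R(1)] x(2)]
    by (intro vec.subspace_dim_equal span_insert_least) (auto simp: mem_Gr)
  then show ?case using card_span_insert[OF subspace_Gr[OF R(1)] x(2)] Suc.hyps(1)[of R] R Suc.hyps(2)
    by (simp add: mem_Gr Suc.hyps(2)[symmetric])
qed

lemma dim_le_iff_card:
  fixes X Y :: "('a::{field,finite} ^ 'n::finite) set"
  assumes "vec.subspace X" "vec.subspace Y"
  shows "vec.dim X \<le> vec.dim Y \<longleftrightarrow> card X \<le> card Y"
  using assms card_field_ge2[where 'a='a] by (simp add: card_subspace)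

text \<open>Addition maps the pairs in \<open>X\<close> and \<open>Y\<close> onto the join, and each
  fibre is a copy of the intersection. Comparing cardinalities, all powers of q, gives the dimension
  formula.\<close>

lemma dim_join:
  fixes X Y :: "('a::{field,finite} ^ 'n::finite) set"
  assumes X: "vec.subspace X" and Y: "vec.subspace Y"
  shows "vec.dim (join X Y) + vec.dim (X \<inter> Y) = vec.dim X + vec.dim Y"
proof -
  have spX: "vec.span X = X" "vec.span Y = Y" using X Y by (simp_all only: span_subspace)
  let ?h = "\<lambda>(x, y). x + y"
  have im: "?h ` (X \<times> Y) = join X Y"
    by (auto simp: vec.span_Un spX image_iff)
  have fib: "card {p \<in> X \<times> Y. ?h p = s} = card (X \<inter> Y)" if "s \<in> join X Y" for s
  proof -
    obtain x0 y0 where s: "x0 \<in> X" "y0 \<in> Y" "s = x0 + y0" using \<open>s \<in> join X Y\<close>[folded im] by auto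
    have "{p \<in> X \<times> Y. ?h p = s} = (\<lambda>t. (x0 + t, y0 - t)) ` (X \<inter> Y)"
    proof (intro equalityI subsetI)
      fix p assume p: "p \<in> {p \<in> X \<times> Y. ?h p = s}"
      then obtain x y where xy: "p = (x, y)" "x \<in> X" "y \<in> Y" "x + y = x0 + y0" using s by auto
      then have "x - x0 = y0 - y" by (simp add: algebra_simps)
      then have "x - x0 \<in> X \<inter> Y" using xy s X Y vec.subspace_diff by (metis IntI)
      moreover have "p = (\<lambda>t. (x0 + t, y0 - t)) (x - x0)" using xy by (simp add: algebra_simps)
      ultimately show "p \<in> (\<lambda>t. (x0 + t, y0 - t)) ` (X \<inter> Y)" by blast
    next
      fix p assume "p \<in> (\<lambda>t. (x0 + t, y0 - t)) ` (X \<inter> Y)"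
      then show "p \<in> {p \<in> X \<times> Y. ?h p = s}"
        using s X Y vec.subspace_add vec.subspace_diff by auto
    qed
    then show ?thesis by (simp add: card_image inj_on_def)
  qed
  have "card X * card Y = (\<Sum>p\<in>X \<times> Y. 1)" by (simp add: card_cartesian_product)
  also have "\<dots> = (\<Sum>s\<in>join X Y. \<Sum>p\<in>{p \<in> X \<times> Y. ?h p = s}. 1)"
    unfolding im[symmetric] by (rule sum.image_gen) simp
  also have "\<dots> = card (join X Y) * card (X \<inter> Y)" using fib by simp
  finally have "CARD('a) ^ (vec.dim (join X Y) + vec.dim (X \<inter> Y)) = CARD('a) ^ (vec.dim X + vec.dim Y)"
    using X Y by (simp add: card_subspace vec.subspace_inter power_add)
  then show ?thesis using card_field_ge2[where 'a='a] by (simp add: power_inject_exp)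
qed

text \<open>The sets \<open>Y - S\<close> partition \<open>U - S\<close> into blocks of equal size.
  The factor q - 1 stays on the left to avoid division, as in all later counts.\<close>

lemma card_Gr_between:
  fixes S U :: "('a::{field,finite} ^ 'n::finite) set"
  assumes S: "S \<in> Gr j" and U: "U \<in> Gr m" and SU: "S \<subseteq> U"
  shows "card {Y \<in> Gr (Suc j). S \<subseteq> Y \<and> Y \<subseteq> U} * (CARD('a) - 1) = CARD('a) ^ (m - j) - 1"
proof -
  let ?q = "CARD('a)" and ?K = "{Y \<in> Gr (Suc j). S \<subseteq> Y \<and> Y \<subseteq> U}"
  have jm: "j \<le> m" using vec.dim_subset[OF SU] S U by (simp add: mem_Gr)
  have "U - S = (\<Union>Y\<in>?K. Y - S)"
  proof (intro equalityI subsetI)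
    fix x assume x: "x \<in> U - S"
    have "adjoin x S \<in> ?K"
      using x S U SU dim_span_insert[of S x] span_insert_least[of U x S] vec.span_superset[of "insert x S"]
      by (auto simp: mem_Gr)
    moreover have "x \<in> adjoin x S" by (simp add: vec.span_base)
    ultimately show "x \<in> (\<Union>Y\<in>?K. Y - S)" using x by blast
  qed auto
  moreover have "card (\<Union>Y\<in>?K. Y - S) = (\<Sum>Y\<in>?K. card (Y - S))"
  proof (rule card_UN_disjoint)
    show "\<forall>Y\<in>?K. \<forall>Z\<in>?K. Y \<noteq> Z \<longrightarrow> (Y - S) \<inter> (Z - S) = {}"
    proof (intro ballI impI, rule ccontr)
      fix Y Z assume YZ: "Y \<in> ?K" "Z \<in> ?K" "Y \<noteq> Z" "(Y - S) \<inter> (Z - S) \<noteq> {}"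
      then obtain x where x: "x \<in> Y" "x \<in> Z" "x \<notin> S" by blast
      have "adjoin x S = Y" using YZ(1) x by (intro span_insert_eq[OF S]) auto
      moreover have "adjoin x S = Z" using YZ(2) x by (intro span_insert_eq[OF S]) auto
      ultimately show False using YZ by blast
    qed
  qed auto
  moreover have "card (Y - S) = ?q ^ j * (?q - 1)" if "Y \<in> ?K" for Y
    using that S card_subspace[of Y] card_subspace[of S]
    by (simp add: mem_Gr card_Diff_subset algebra_simps)
  ultimately have "card (U - S) = card ?K * (?q ^ j * (?q - 1))" by simp
  moreover have "card (U - S) = ?q ^ j * (?q ^ (m - j) - 1)"
    using S U SU jm card_subspace[of U] card_subspace[of S]
    by (simp add: mem_Gr card_Diff_subset algebra_simps power_add[symmetric])
  ultimately have "?q ^ j * (card ?K * (?q - 1)) = ?q ^ j * (?q ^ (m - j) - 1)" by (simp add: ac_simps)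
  then show ?thesis by simp
qed

section \<open>Orthogonal complements for the standard bilinear form\<close>

definition dot :: "'a::field ^ 'n::finite \<Rightarrow> 'a ^ 'n \<Rightarrow> 'a" where
  "dot x y = (\<Sum>i\<in>UNIV. x $ i * y $ i)"

definition perp :: "('a::field ^ 'n::finite) set \<Rightarrow> ('a ^ 'n) set" where
  "perp X = {y. \<forall>x\<in>X. dot x y = 0}"

lemma dot_add: "dot x (y + z) = dot x y + dot x z" "dot (x + y) z = dot x z + dot y z"
  by (simp_all add: dot_def algebra_simps sum.distrib)

lemma dot_scale: "dot x (c *s y) = c * dot x y" "dot (c *s x) y = c * dot x y"
  by (simp_all add: dot_def sum_distrib_left algebra_simps)

lemma dot_commute: "dot x y = dot y x"
  by (simp add: dot_def mult.commute)

lemma perp_singleton_iff: "x \<in> perp {y} \<longleftrightarrow> dot x y = 0"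
  using dot_commute[of x y] by (simp add: perp_def)

lemma subspace_perp: "vec.subspace (perp X)"
  by (auto simp: vec.subspace_def perp_def dot_add dot_scale) (simp add: dot_def)

lemma perp_antimono: "X \<subseteq> Y \<Longrightarrow> perp Y \<subseteq> perp X"
  by (auto simp: perp_def)

lemma subset_perp_perp: "X \<subseteq> perp (perp X)"
  by (auto simp: perp_def dot_commute)

lemma perp_UNIV: "perp UNIV = {0}"
proof (intro equalityI subsetI)
  fix y :: "'a^'n" assume "y \<in> perp UNIV"
  then have "dot (axis i 1) y = 0" for i by (simp add: perp_def)
  moreover have "dot (axis i 1) y = y $ i" for i
    by (simp add: dot_def axis_def if_distrib[of "\<lambda>x. x * _"] cong: if_cong)
  ultimately show "y \<in> {0}" by (simp add: vec_eq_iff)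
qed (simp add: perp_def dot_def)

text \<open>Orthogonality to one more vector is one more linear equation.\<close>

lemma dim_perp_insert:
  fixes X :: "('a::{field,finite} ^ 'n::finite) set"
  shows "vec.dim (perp X) \<le> vec.dim (perp (adjoin x X)) + 1"
proof (cases "\<forall>y\<in>perp X. dot x y = 0")
  case True
  have "perp X \<subseteq> perp (adjoin x X)"
  proof
    fix y assume y: "y \<in> perp X"
    have "adjoin x X \<subseteq> perp {y}"
      using y True by (intro vec.span_minimal subspace_perp) (auto simp: perp_singleton_iff, auto simp: perp_def)
    then show "y \<in> perp (adjoin x X)" using perp_singleton_iff unfolding perp_def by blast
  qed
  then show ?thesis using vec.dim_subset by (metis trans_le_add1)
next
  case False
  then obtain z where z: "z \<in> perp X" "dot x z \<noteq> 0" by blast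
  let ?P = "perp (adjoin x X)"
  have "perp X \<subseteq> adjoin z ?P"
  proof
    fix y assume y: "y \<in> perp X"
    let ?c = "dot x y / dot x z"
    have d: "dot x (y - ?c *s z) = 0" 
      using z dot_add(1)[of x "y - ?c *s z" "?c *s z"] by (simp add: dot_scale)
    have yX: "y - ?c *s z \<in> perp X" using y z subspace_perp by (metis vec.subspace_diff vec.subspace_scale)
    have "adjoin x X \<subseteq> perp {y - ?c *s z}"
      using yX d by (intro vec.span_minimal subspace_perp) (auto simp: perp_singleton_iff, auto simp: perp_def)
    then have "y - ?c *s z \<in> ?P" using perp_singleton_iff unfolding perp_def by blast
    then show "y \<in> adjoin z ?P" using span_insert_iff[OF subspace_perp, of y z]
      by (metis add.commute diff_add_cancel)
  qed
  then have "vec.dim (perp X) \<le> vec.dim (adjoin z ?P)" by (rule vec.dim_subset)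
  also have "\<dots> \<le> vec.dim ?P + 1"
    by (simp add: vec.dim_insert)
  finally show ?thesis .
qed

text \<open>By the preceding bound the sum of the two dimensions cannot drop when a vector is
  adjoined. At \<open>{0}\<close> and at the whole space the sum is n, so it is constant; this
  yields \<open>dim_perp\<close> even though \<open>X\<close> and \<open>perp X\<close> may
  intersect.\<close>

lemma dim_perp_le_add:
  fixes X Y :: "('a::{field,finite} ^ 'n::finite) set"
  assumes "vec.subspace X" "vec.subspace Y" "X \<subseteq> Y"
  shows "vec.dim (perp X) + vec.dim X \<le> vec.dim (perp Y) + vec.dim Y"
  using assms
proof (induction "vec.dim Y - vec.dim X" arbitrary: X)
  case 0
  then have "X = Y" by (intro vec.subspace_dim_equal) auto
  then show ?case by simp
next
  case (Suc d)
  then obtain y where y: "y \<in> Y" "y \<notin> X" by (metis diff_self_eq_0 nat.distinct(1) subsetI subset_antisym)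
  let ?X = "adjoin y X"
  have d: "vec.dim ?X = vec.dim X + 1" using y Suc by (intro dim_span_insert)
  have "vec.dim (perp ?X) + vec.dim ?X \<le> vec.dim (perp Y) + vec.dim Y"
    using Suc d y span_insert_least[of Y y X] by (intro Suc.hyps) auto
  then show ?case using d dim_perp_insert[of X y] by linarith
qed

lemma dim_perp:
  fixes X :: "('a::{field,finite} ^ 'n::finite) set"
  assumes X: "vec.subspace X"
  shows "vec.dim (perp X) + vec.dim X = CARD('n)"
proof (rule antisym)
  show "vec.dim (perp X) + vec.dim X \<le> CARD('n)"
    using dim_perp_le_add[OF X vec.subspace_UNIV] by (simp only: perp_UNIV vec_dim_card) simp
  have "perp {0} = (UNIV :: ('a^'n) set)" by (auto simp: perp_def dot_def)
  then show "CARD('n) \<le> vec.dim (perp X) + vec.dim X"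
    using dim_perp_le_add[of "{0}" X] X vec.subspace_0[OF X] by (simp only: vec_dim_card) simp
qed

lemma perp_perp:
  fixes X :: "('a::{field,finite} ^ 'n::finite) set"
  assumes X: "vec.subspace X"
  shows "perp (perp X) = X"
  using vec.subspace_dim_equal[OF X subspace_perp[of "perp X"] subset_perp_perp]
    dim_perp[OF X] dim_perp[OF subspace_perp[of X]] by simp

lemma perp_eq_iff:
  fixes X Y :: "('a::{field,finite} ^ 'n::finite) set"
  assumes "vec.subspace X" "vec.subspace Y"
  shows "perp X = perp Y \<longleftrightarrow> X = Y"
  using assms perp_perp by metis

lemma perp_Int_perp: "perp X \<inter> perp Y = perp (join X Y)"
proof
  show "perp X \<inter> perp Y \<subseteq> perp (join X Y)"
  proof
    fix y assume "y \<in> perp X \<inter> perp Y"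
    then have "X \<union> Y \<subseteq> perp {y}" by (auto simp: perp_singleton_iff) (auto simp: perp_def)
    then have "join X Y \<subseteq> perp {y}" by (intro vec.span_minimal subspace_perp)
    then show "y \<in> perp (join X Y)" using perp_singleton_iff unfolding perp_def by blast
  qed
qed (simp add: perp_antimono join_upper1 join_upper2)

lemma dim_perp_Int_perp:
  fixes X Y :: "('a::{field,finite} ^ 'n::finite) set"
  assumes "vec.subspace X" "vec.subspace Y"
  shows "vec.dim (perp X \<inter> perp Y) + vec.dim X + vec.dim Y = CARD('n) + vec.dim (X \<inter> Y)"
  using dim_join[OF assms] dim_perp[OF vec.subspace_span[of "X \<union> Y"]] unfolding perp_Int_perp
  by linarith

lemma perp_Gr: 
  fixes X :: "('a::{field,finite} ^ 'n::finite) set"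
  assumes "X \<in> Gr k" shows "perp X \<in> Gr (CARD('n) - k)"
  using dim_perp[of X] assms by (simp add: mem_Gr subspace_perp)

text \<open>Complements turn the hyperplanes of \<open>U\<close> into the subspaces one dimension
  above \<open>perp U\<close>, which \<open>card_Gr_between\<close> counts.\<close>

lemma card_hyperplanes:
  fixes U :: "('a::{field,finite} ^ 'n::finite) set"
  assumes U: "U \<in> Gr (Suc k)"
  shows "card {Y \<in> Gr k. Y \<subseteq> U} * (CARD('a) - 1) = CARD('a) ^ Suc k - 1"
proof -
  have sk: "Suc k \<le> CARD('n)" using dim_le_CARD U dim_Gr by metis
  let ?S = "perp U" and ?j = "CARD('n) - Suc k"
  have S: "?S \<in> Gr ?j" using perp_Gr[OF U] .
  have V: "(UNIV :: ('a^'n) set) \<in> Gr CARD('n)" by (simp add: mem_Gr vec_dim_card del: vec.dim_UNIV)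
  have sj: "Suc ?j = CARD('n) - k" using sk by linarith
  have "bij_betw perp {Y \<in> Gr k. Y \<subseteq> U} {Y \<in> Gr (Suc ?j). ?S \<subseteq> Y \<and> Y \<subseteq> UNIV}"
  proof (rule bij_betw_byWitness[where f' = perp])
    show "\<forall>a\<in>{Y \<in> Gr k. Y \<subseteq> U}. perp (perp a) = a" by (simp add: perp_perp mem_Gr)
    show "\<forall>a\<in>{Y \<in> Gr (Suc ?j). ?S \<subseteq> Y \<and> Y \<subseteq> UNIV}. perp (perp a) = a" by (simp add: perp_perp mem_Gr)
    show "perp ` {Y \<in> Gr k. Y \<subseteq> U} \<subseteq> {Y \<in> Gr (Suc ?j). ?S \<subseteq> Y \<and> Y \<subseteq> UNIV}"
    proof clarify
      fix Y :: "('a^'n) set" assume Y: "Y \<in> Gr k" "Y \<subseteq> U"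
      show "perp Y \<in> Gr (Suc ?j) \<and> perp U \<subseteq> perp Y \<and> perp Y \<subseteq> UNIV"
        using perp_Gr[OF Y(1)] perp_antimono[OF Y(2)] sj by simp
    qed
    show "perp ` {Y \<in> Gr (Suc ?j). ?S \<subseteq> Y \<and> Y \<subseteq> UNIV} \<subseteq> {Y \<in> Gr k. Y \<subseteq> U}"
    proof clarify
      fix Y :: "('a^'n) set" assume Y: "Y \<in> Gr (Suc ?j)" "perp U \<subseteq> Y"
      have "perp Y \<in> Gr k" using perp_Gr[OF Y(1)] sj sk by simp
      moreover have "perp Y \<subseteq> U" using perp_antimono[OF Y(2)] perp_perp U by (metis subspace_Gr)
      ultimately show "perp Y \<in> Gr k \<and> perp Y \<subseteq> U" ..
    qed
  qed
  then have "card {Y \<in> Gr k. Y \<subseteq> U} = card {Y \<in> Gr (Suc ?j). ?S \<subseteq> Y \<and> Y \<subseteq> UNIV}"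
    by (rule bij_betw_same_card)
  moreover have "CARD('n) - ?j = Suc k" using sk by linarith
  ultimately show ?thesis using card_Gr_between[OF S V] by simp
qed

section \<open>Cliques of the Grassmann graph\<close>

definition adjacent :: "nat \<Rightarrow> ('a::field ^ 'n::finite) set \<Rightarrow> ('a ^ 'n) set \<Rightarrow> bool" where
  "adjacent k X Y \<longleftrightarrow> X \<in> Gr k \<and> Y \<in> Gr k \<and> vec.dim (X \<inter> Y) + 1 = k"

lemma adjacent_commute: "adjacent k X Y \<longleftrightarrow> adjacent k Y X"
  by (auto simp: adjacent_def Int_commute)

lemma adjacent_neq: "adjacent k X Y \<Longrightarrow> X \<noteq> Y"
  by (auto simp: adjacent_def mem_Gr)

lemma Int_Gr_adjacent: "adjacent (Suc k) X Y \<Longrightarrow> X \<inter> Y \<in> Gr k"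
  by (auto simp: adjacent_def mem_Gr vec.subspace_inter)

lemma join_Gr_adjacent:
  fixes X Y :: "('a::{field,finite} ^ 'n::finite) set"
  shows "adjacent k X Y \<Longrightarrow> join X Y \<in> Gr (Suc k)"
  using dim_join[of X Y] by (auto simp: adjacent_def mem_Gr)

lemma adjacentI_inf:
  assumes "X \<in> Gr (Suc k)" "Y \<in> Gr (Suc k)" "X \<noteq> Y" "S \<in> Gr k" "S \<subseteq> X" "S \<subseteq> Y"
  shows "adjacent (Suc k) X Y" "X \<inter> Y = S"
proof -
  have sub: "vec.subspace (X \<inter> Y)" using assms by (auto simp: mem_Gr vec.subspace_inter)
  have "vec.dim (X \<inter> Y) \<noteq> Suc k"
  proof
    assume d: "vec.dim (X \<inter> Y) = Suc k"
    then have "X \<inter> Y \<in> Gr (Suc k)" using sub by (simp add: mem_Gr)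
    then have "X \<inter> Y = X" "X \<inter> Y = Y" using assms by (meson Gr_eqI Int_lower1 Int_lower2)+
    then show False using assms by blast
  qed
  moreover have "vec.dim (X \<inter> Y) \<le> Suc k" using vec.dim_subset[of "X \<inter> Y" X] assms by (simp add: mem_Gr)
  moreover have "k \<le> vec.dim (X \<inter> Y)" using vec.dim_subset[of S "X \<inter> Y"] assms by (simp add: mem_Gr)
  ultimately have d: "vec.dim (X \<inter> Y) = k" by linarith
  then show "adjacent (Suc k) X Y" using assms by (simp add: adjacent_def)
  show "X \<inter> Y = S" using Gr_eqI[OF assms(4), of "X \<inter> Y"] assms d sub by (simp add: mem_Gr)
qed

lemma adjacentI_sup:
  fixes X Y :: "('a::{field,finite} ^ 'n::finite) set"
  assumes "X \<in> Gr k" "Y \<in> Gr k" "X \<noteq> Y" "U \<in> Gr (Suc k)" "X \<subseteq> U" "Y \<subseteq> U"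
  shows "adjacent k X Y" "join X Y = U"
proof -
  have JU: "join X Y \<subseteq> U" using assms by (intro join_least) (auto simp: mem_Gr)
  have "vec.dim (join X Y) \<noteq> k"
  proof
    assume "vec.dim (join X Y) = k"
    then have "join X Y \<in> Gr k" by (simp add: mem_Gr)
    then have "X = join X Y" "Y = join X Y" using assms join_upper1 join_upper2 by (metis Gr_eqI)+
    then show False using assms by blast
  qed
  moreover have "k \<le> vec.dim (join X Y)" using vec.dim_subset[OF join_upper1] assms by (metis dim_Gr)
  moreover have "vec.dim (join X Y) \<le> Suc k" using vec.dim_subset[OF JU] assms by (metis dim_Gr)
  ultimately have d: "vec.dim (join X Y) = Suc k" by linarith
  then show "adjacent k X Y" using dim_join[of X Y] assms by (auto simp: adjacent_def mem_Gr)
  show "join X Y = U" using d assms JU by (intro Gr_eqI[of _ "Suc k"]) (auto simp: mem_Gr)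
qed

lemma meet_in_hyperplane:
  fixes A B :: "('a::{field,finite} ^ 'n::finite) set"
  assumes "vec.subspace A" "vec.subspace B" "A \<subseteq> U" "B \<subseteq> U" "vec.subspace U"
  shows "vec.dim A + vec.dim B \<le> vec.dim U + vec.dim (A \<inter> B)"
  using dim_join[of A B] vec.dim_subset[OF join_least, of U A B] assms by linarith

lemma exists_nonzero: "0 < vec.dim X \<Longrightarrow> \<exists>x\<in>X. x \<noteq> (0 :: 'a::field ^ 'n::finite)"
  using vec.dim_eq_0[of X] by (metis less_irrefl singletonI subsetI)

text \<open>As soon as one member \<open>C\<close> fails to contain \<open>A \<inter> B\<close>,
  every member is forced into \<open>join A B\<close>.\<close>

lemma clique_star_or_top:
  fixes K :: "('a::{field,finite} ^ 'n::finite) set set"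
  assumes K: "K \<subseteq> Gr (Suc k)" and clique: "\<And>X Y. X \<in> K \<Longrightarrow> Y \<in> K \<Longrightarrow> X \<noteq> Y \<Longrightarrow> adjacent (Suc k) X Y"
    and two: "A \<in> K" "B \<in> K" "A \<noteq> B"
  shows "(\<exists>T\<in>Gr k. \<forall>X\<in>K. T \<subseteq> X) \<or> (\<exists>W\<in>Gr (Suc (Suc k)). \<forall>X\<in>K. X \<subseteq> W)"
proof (cases "\<forall>X\<in>K. A \<inter> B \<subseteq> X")
  case True
  moreover have "A \<inter> B \<in> Gr k" by (intro Int_Gr_adjacent clique two)
  ultimately show ?thesis by (intro disjI1 bexI[of _ "A \<inter> B"])
next
  case False
  \<comment> \<open>Such an \<open>X\<close> meets \<open>Y\<close> and \<open>Z\<close> in two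
    different hyperplanes of \<open>X\<close>, and these span \<open>X\<close>.\<close>
  have third: "X \<subseteq> join Y Z" if "X \<in> K" "Y \<in> K" "Z \<in> K" "Y \<noteq> Z" "\<not> Y \<inter> Z \<subseteq> X" for X Y Z
  proof -
    have XYZ: "X \<noteq> Y" "X \<noteq> Z" using that by auto
    have ne: "X \<inter> Y \<noteq> X \<inter> Z"
    proof
      assume eq: "X \<inter> Y = X \<inter> Z"
      have "X \<inter> Y \<subseteq> Y \<inter> Z" using eq by blast
      then have "X \<inter> Y = Y \<inter> Z" using Gr_eqI Int_Gr_adjacent clique that XYZ by metis
      then show False using that by blast
    qed
    have X: "X \<in> Gr (Suc k)" using K that by blast
    have "join (X \<inter> Y) (X \<inter> Z) = X"
      using ne X that XYZ by (intro adjacentI_sup(2)[of _ k]) (auto intro: Int_Gr_adjacent clique)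
    moreover have "join (X \<inter> Y) (X \<inter> Z) \<subseteq> join Y Z" by (intro vec.span_mono) blast
    ultimately show ?thesis by simp
  qed
  from False obtain C where C: "C \<in> K" "\<not> A \<inter> B \<subseteq> C" by blast
  let ?W = "join A B"
  have W: "?W \<in> Gr (Suc (Suc k))" using two clique by (intro join_Gr_adjacent)
  have CW: "C \<subseteq> ?W" using third C two by blast
  have "X \<subseteq> ?W" if X: "X \<in> K" for X
  \<comment> \<open>A member outside \<open>?W\<close> would contain both
    \<open>A \<inter> B\<close> and \<open>A \<inter> C\<close>, which together span
    \<open>A\<close>.\<close>
  proof (rule ccontr)
    assume nX: "\<not> X \<subseteq> ?W"
    then have AB: "A \<inter> B \<subseteq> X" using third X two by blast
    have AC: "A \<noteq> C" using C by blast
    have "join A C \<subseteq> ?W" using CW join_upper1 by (intro join_least) auto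
    then have "A \<inter> C \<subseteq> X" using third[OF X two(1) C(1) AC] nX by blast
    have "A \<inter> B \<noteq> A \<inter> C" using C by blast
    then have "join (A \<inter> B) (A \<inter> C) = A"
      using two C AC K by (intro adjacentI_sup(2)[of _ k]) (auto intro: Int_Gr_adjacent clique)
    moreover have "join (A \<inter> B) (A \<inter> C) \<subseteq> X"
      using AB \<open>A \<inter> C \<subseteq> X\<close> X K by (intro join_least) (auto simp: mem_Gr)
    ultimately have "A = X" using Gr_eqI K two X by (metis subsetD)
    then show False using nX join_upper1 by blast
  qed
  then show ?thesis using W by blast
qed

section \<open>Nondegenerate subspaces, stars and tops\<close>

abbreviation NC :: "nat \<Rightarrow> ('a::field ^ 'n::finite) set set" where
  "NC k \<equiv> nondegenerate_codes k"

lemma mem_NC: "X \<in> NC k \<longleftrightarrow> X \<in> Gr k \<and> (\<forall>i. \<exists>x\<in>X. x $ i \<noteq> 0)"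
  by (auto simp: nondegenerate_codes_def Grassmannian_def coord_hyperplane_def)

lemma NC_Gr: "X \<in> NC k \<Longrightarrow> X \<in> Gr k"
  by (simp add: mem_NC)

lemma NC_mono: "S \<in> NC j \<Longrightarrow> S \<subseteq> Y \<Longrightarrow> Y \<in> Gr k \<Longrightarrow> Y \<in> NC k"
  by (simp add: mem_NC) blast

definition full :: "'a::field ^ 'n::finite \<Rightarrow> bool" where
  "full p \<longleftrightarrow> (\<forall>i. p $ i \<noteq> 0)"

lemma full_1 [simp]: "full 1" by (simp add: full_def)

lemma NC_full: "full p \<Longrightarrow> p \<in> Y \<Longrightarrow> Y \<in> Gr k \<Longrightarrow> Y \<in> NC k"
  unfolding full_def mem_NC by blast

definition star :: "nat \<Rightarrow> ('a::field ^ 'n::finite) set \<Rightarrow> ('a ^ 'n) set set" where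
  "star k S = {Y \<in> Gr k. S \<subseteq> Y}"

definition top_of :: "nat \<Rightarrow> ('a::field ^ 'n::finite) set \<Rightarrow> ('a ^ 'n) set set" where
  "top_of k U = {Y \<in> Gr k. Y \<subseteq> U}"

lemma card_star:
  fixes S :: "('a::{field,finite} ^ 'n::finite) set"
  assumes "S \<in> Gr j"
  shows "card (star (Suc j) S) * (CARD('a) - 1) = CARD('a) ^ (CARD('n) - j) - 1"
  using card_Gr_between[OF assms, of UNIV "CARD('n)"] 
  by (simp add: mem_Gr vec_dim_card star_def del: vec.dim_UNIV)

lemma card_top_of:
  fixes U :: "('a::{field,finite} ^ 'n::finite) set"
  assumes "U \<in> Gr (Suc k)"
  shows "card (top_of k U) * (CARD('a) - 1) = CARD('a) ^ Suc k - 1"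
  using card_hyperplanes[OF assms] by (simp add: top_of_def)

lemma star_NC: "S \<in> NC j \<Longrightarrow> star k S \<subseteq> NC k"
  using NC_mono by (auto simp: star_def)

lemma star_two:
  fixes S U :: "('a::{field,finite} ^ 'n::finite) set"
  assumes S: "S \<in> Gr j" and U: "U \<in> Gr m" and SU: "S \<subseteq> U" and Y: "Y \<in> Gr (Suc j)" and jm: "Suc (Suc j) \<le> m"
  shows "\<exists>X. X \<in> star (Suc j) S \<and> X \<subseteq> U \<and> X \<noteq> Y"
proof -
  have "\<not> U \<subseteq> Y"  using vec.dim_subset[of U Y] Y U jm by (auto simp: mem_Gr)
  then obtain x where x: "x \<in> U" "x \<notin> Y" by blast
  then show ?thesis
  proof (cases "S \<subseteq> Y")
    case True
    then have "x \<notin> S" using x by blast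
    then have "adjoin x S \<in> Gr (Suc j)" using dim_span_insert[of S x] S by (simp add: mem_Gr)
    moreover have "S \<subseteq> adjoin x S" "x \<in> adjoin x S" using vec.span_superset[of "insert x S"] by auto
    moreover have "adjoin x S \<subseteq> U" using SU x U by (intro span_insert_least) (auto simp: mem_Gr)
    ultimately show ?thesis using x by (intro exI[of _ "adjoin x S"]) (auto simp: star_def)
  next
    case False
    obtain X where "X \<in> Gr (Suc j)" "S \<subseteq> X" "X \<subseteq> U"
      using exists_intermediate_subspace[of S U "Suc j"] S U SU jm by (auto simp: mem_Gr)
    then show ?thesis using False by (auto simp: star_def)
  qed
qed

text \<open>Two members of a star meet exactly in its centre; \<open>Suc j < CARD('n)\<close>
  guarantees that two exist.\<close>

lemma star_inj:
  fixes S :: "('a::{field,finite} ^ 'n::finite) set"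
  assumes S: "S \<in> Gr j" and S': "S' \<in> Gr j" and jn: "Suc j < CARD('n)" and eq: "star (Suc j) S \<subseteq> star (Suc j) S'"
  shows "S = S'"
proof -
  have V: "(UNIV :: ('a^'n) set) \<in> Gr CARD('n)" by (simp add: mem_Gr vec_dim_card del: vec.dim_UNIV)
  obtain X where X: "X \<in> star (Suc j) S" using exists_intermediate_subspace[of S UNIV "Suc j"] S jn
    by (auto simp: mem_Gr vec_dim_card star_def simp del: vec.dim_UNIV)
  obtain Y where Y: "Y \<in> star (Suc j) S" "Y \<noteq> X" using star_two[OF S V, of X] X jn by (auto simp: star_def)
  have "X \<inter> Y = S" using X Y by (intro adjacentI_inf(2)[of X j Y] S) (auto simp: star_def)
  moreover have "X \<in> star (Suc j) S'" "Y \<in> star (Suc j) S'" using X Y eq by blast+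
  then have "X \<inter> Y = S'" using Y by (intro adjacentI_inf(2)[of X j Y] S') (auto simp: star_def)
  ultimately show ?thesis by simp
qed

section \<open>Stars are sent to stars, or all of them to tops\<close>

lemma geometric_count:
  fixes q a :: nat
  assumes "q \<ge> 2" "a * (q - 1) = q ^ m - 1"
  shows "a = (\<Sum>i<m. q ^ i)"
proof -
  have "(\<Sum>i<m. q ^ i) * (q - 1) = q ^ m - 1"
  proof (induction m)
    case (Suc m)
    have "q ^ m \<ge> 1" using assms by simp
    then show ?case using Suc assms(1) by (simp add: algebra_simps)
  qed simp
  then have "a * (q - 1) = (\<Sum>i<m. q ^ i) * (q - 1)" using assms by simp
  then show ?thesis using assms(1) by simp
qed

lemma sum_power_strict_mono:
  fixes q :: nat
  assumes "q \<ge> 2" "m < l"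
  shows "(\<Sum>i<m. q ^ i) < (\<Sum>i<l. q ^ i)"
  using assms by (intro sum_strict_mono2[of "{..<l}" "{..<m}" m]) auto

text \<open>Here \<open>a\<close> is the size of a top and \<open>b\<close> that of a star. A top
  over a nondegenerate subspace has at least a - n nondegenerate members, so by the first inequality
  these do not fit into a star. The second amounts to 2(a - n) - 1 > a: two such families sharing at
  most one member do not fit into one top.\<close>

lemma count_arith:
  fixes q a b n k :: nat
  assumes q: "q \<ge> 2" and a: "a * (q - 1) = q ^ Suc k - 1" and b: "b * (q - 1) = q ^ (n - (k - 1)) - 1"
    and n: "k + 2 \<le> n" "n < 2 * k"
  shows "b + n < a" "2 * n + 1 < a"
proof -
  have a': "a = (\<Sum>i<Suc k. q ^ i)" using geometric_count[OF q a] .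
  have b': "b = (\<Sum>i<n - (k - 1). q ^ i)" using geometric_count[OF q b] .
  have k3: "k \<ge> 3" using n by linarith
  have pk: "2 ^ k > 2 * k" using k3
  proof (induction k rule: dec_induct)
    case (step m)
    then show ?case by simp
  qed simp
  have qk: "2 ^ k \<le> q ^ k" using q by (simp add: power_mono)
  have "b \<le> (\<Sum>i<k. q ^ i)" unfolding b' using n by (intro sum_mono2) auto
  moreover have "a = (\<Sum>i<k. q ^ i) + q ^ k" using a' by simp
  ultimately show "b + n < a" using qk pk n by linarith
  have "(\<Sum>i<Suc k. (2::nat) ^ i) \<le> a" unfolding a' using q by (intro sum_mono power_mono) auto
  moreover have "(\<Sum>i<Suc k. (2::nat) ^ i) = 2 ^ Suc k - 1"
    using geometric_count[of 2 "2 ^ Suc k - 1" "Suc k"] by simp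
  ultimately have "2 ^ Suc k \<le> a + 1" by linarith
  moreover have "2 ^ Suc k > 4 * k" using pk by simp
  ultimately show "2 * n + 1 < a" using n by linarith
qed

text \<open>Adjacency is preserved in one direction only, because the target subgraph need not be
  induced; the map \<open>project\<close> of the last section violates the converse.\<close>

locale code_embedding =
  fixes f :: "('a::{field,finite} ^ 'n::finite) set \<Rightarrow> ('a ^ 'n) set" and k :: nat
  assumes k2: "2 \<le> k" and kn: "k + 2 \<le> CARD('n)"
    and f_Gr: "\<And>Y. Y \<in> NC k \<Longrightarrow> f Y \<in> Gr k"
    and f_inj: "inj_on f (NC k)"
    and f_adj: "\<And>Y Z. Y \<in> NC k \<Longrightarrow> Z \<in> NC k \<Longrightarrow> adjacent k Y Z \<Longrightarrow> adjacent k (f Y) (f Z)"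
begin

lemma Suc_k1: "Suc (k - 1) = k" using k2 by simp

definition star_type :: "('a ^ 'n) set \<Rightarrow> bool" where
  "star_type S \<longleftrightarrow> (\<exists>T\<in>Gr (k - 1). f ` star k S \<subseteq> star k T)"

definition top_type :: "('a ^ 'n) set \<Rightarrow> bool" where
  "top_type S \<longleftrightarrow> (\<exists>W\<in>Gr (Suc k). f ` star k S \<subseteq> top_of k W)"

lemma clique_image:
  assumes C: "C \<subseteq> NC k" and adj: "\<And>X Y. X \<in> C \<Longrightarrow> Y \<in> C \<Longrightarrow> X \<noteq> Y \<Longrightarrow> adjacent k X Y"
    and two: "A \<in> C" "B \<in> C" "A \<noteq> B"
  shows "(\<exists>T\<in>Gr (k - 1). f ` C \<subseteq> star k T) \<or> (\<exists>W\<in>Gr (Suc k). f ` C \<subseteq> top_of k W)"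
proof -
  have fC: "f ` C \<subseteq> Gr (Suc (k - 1))" using C f_Gr Suc_k1 by auto
  have fadj: "adjacent (Suc (k - 1)) X Y" if XY: "X \<in> f ` C" "Y \<in> f ` C" "X \<noteq> Y" for X Y
  proof -
    obtain X' Y' where "X' \<in> C" "Y' \<in> C" "X = f X'" "Y = f Y'" using XY by blast
    then show ?thesis using adj C XY(3) Suc_k1 by (metis f_adj subsetD)
  qed
  have ne: "f A \<noteq> f B" using two C f_inj by (meson inj_onD subsetD)
  have "(\<exists>T\<in>Gr (k - 1). \<forall>X\<in>f ` C. T \<subseteq> X) \<or> (\<exists>W\<in>Gr (Suc (Suc (k - 1))). \<forall>X\<in>f ` C. X \<subseteq> W)"
    using fadj by (rule clique_star_or_top[OF fC _ imageI[OF two(1)] imageI[OF two(2)] ne])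
  then show ?thesis
  proof
    assume "\<exists>T\<in>Gr (k - 1). \<forall>X\<in>f ` C. T \<subseteq> X"
    then obtain T where "T \<in> Gr (k - 1)" "\<forall>X\<in>f ` C. T \<subseteq> X" by blast
    then show ?thesis using fC unfolding star_def Suc_k1 by (intro disjI1 bexI[of _ T]) auto
  next
    assume "\<exists>W\<in>Gr (Suc (Suc (k - 1))). \<forall>X\<in>f ` C. X \<subseteq> W"
    then obtain W where "W \<in> Gr (Suc k)" "\<forall>X\<in>f ` C. X \<subseteq> W" unfolding Suc_k1 by blast
    then show ?thesis using fC unfolding top_of_def Suc_k1 by (intro disjI2 bexI[of _ W]) auto
  qed
qed

lemma star_nonempty:
  fixes S U :: "('a ^ 'n) set"
  assumes S: "S \<in> Gr (k - 1)" and U: "U \<in> Gr m" "S \<subseteq> U" "Suc k \<le> m"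
  obtains A B where "A \<in> star k S" "B \<in> star k S" "A \<noteq> B" "A \<subseteq> U" "B \<subseteq> U"
proof -
  obtain A where A: "A \<in> Gr k" "S \<subseteq> A" "A \<subseteq> U"
    using exists_intermediate_subspace[of S U k] S U k2 by (auto simp: mem_Gr)
  then obtain B where "B \<in> star k S" "B \<subseteq> U" "B \<noteq> A" using star_two[OF S U(1,2), of A] U Suc_k1 by auto
  then show ?thesis using A that[of A B] by (auto simp: star_def)
qed

lemma UNIV_Gr: "(UNIV :: ('a^'n) set) \<in> Gr CARD('n)"
  by (simp add: mem_Gr vec_dim_card del: vec.dim_UNIV)

lemma star_adjacent:
  fixes S X Y :: "('a ^ 'n) set"
  assumes "S \<in> Gr (k - 1)" "X \<in> star k S" "Y \<in> star k S" "X \<noteq> Y"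
  shows "adjacent k X Y" "X \<inter> Y = S"
  using adjacentI_inf[of X "k - 1" Y S] assms Suc_k1 by (auto simp: star_def)

lemma star_or_top_type:
  assumes S: "S \<in> NC (k - 1)"
  shows "star_type S \<or> top_type S"
proof -
  have SG: "S \<in> Gr (k - 1)" using S NC_Gr by blast
  obtain A B where AB: "A \<in> star k S" "B \<in> star k S" "A \<noteq> B"
    using star_nonempty[OF SG UNIV_Gr] kn by auto
  show ?thesis unfolding star_type_def top_type_def
    using star_adjacent(1)[OF SG] by (rule clique_image[OF star_NC[OF S] _ AB])
qed

lemma card_star_k: "(S :: ('a ^ 'n) set) \<in> Gr (k - 1) \<Longrightarrow> card (star k S) * (CARD('a) - 1) = CARD('a) ^ (CARD('n) - (k - 1)) - 1"
  using card_star[of S "k - 1"] Suc_k1 by simp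

lemma card_image_star: "S \<in> NC (k - 1) \<Longrightarrow> card (f ` star k S) = card (star k S)"
  using star_NC[of S "k - 1" k] f_inj by (metis card_image inj_on_subset)

lemma star_type_onto:
  assumes S: "S \<in> NC (k - 1)" and T: "T \<in> Gr (k - 1)" "f ` star k S \<subseteq> star k T"
  shows "f ` star k S = star k T"
proof (rule card_subset_eq)
  have "card (star k S) = (\<Sum>i<CARD('n) - (k - 1). CARD('a) ^ i)" "card (star k T) = (\<Sum>i<CARD('n) - (k - 1). CARD('a) ^ i)"
    using geometric_count[OF card_field_ge2 card_star_k] T NC_Gr[OF S] by auto
  then show "card (f ` star k S) = card (star k T)" using card_image_star[OF S] by simp
qed (use T in auto)

text \<open>A star inside a top needs n - k <= k by the sizes, and equality makes the inclusion an
  equality of sets.\<close>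

lemma top_type_le:
  assumes S: "S \<in> NC (k - 1)" and W: "W \<in> Gr (Suc k)" "f ` star k S \<subseteq> top_of k W"
  shows "CARD('n) \<le> 2 * k" "CARD('n) = 2 * k \<Longrightarrow> f ` star k S = top_of k W"
proof -
  have s: "card (star k S) = (\<Sum>i<CARD('n) - (k - 1). CARD('a) ^ i)"
    using geometric_count[OF card_field_ge2 card_star_k] NC_Gr[OF S] by auto
  have t: "card (top_of k W) = (\<Sum>i<Suc k. CARD('a) ^ i)"
    using geometric_count[OF card_field_ge2 card_top_of[OF W(1)]] .
  have le: "card (star k S) \<le> card (top_of k W)"
    using card_mono[OF _ W(2)] card_image_star[OF S] by simp
  have "\<not> Suc k < CARD('n) - (k - 1)"
    using sum_power_strict_mono[OF card_field_ge2[where 'a='a], of "Suc k" "CARD('n) - (k - 1)"] le s t by linarith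
  then show "CARD('n) \<le> 2 * k" using k2 by linarith
  assume "CARD('n) = 2 * k"
  then have "CARD('n) - (k - 1) = Suc k" using k2 by linarith
  then show "f ` star k S = top_of k W" using s t card_image_star[OF S] W by (intro card_subset_eq) auto
qed

text \<open>A degenerate hyperplane of \<open>U\<close> must be the trace on \<open>U\<close> of a
  coordinate hyperplane, so at most n of them are lost.\<close>

lemma card_nondegenerate_hyperplanes:
  fixes U :: "('a ^ 'n) set"
  assumes U: "U \<in> NC (Suc k)"
  shows "card (top_of k U) \<le> card (top_of k U \<inter> NC k) + CARD('n)"
proof -
  have "top_of k U - NC k \<subseteq> (\<lambda>i. U \<inter> coord_hyperplane i) ` UNIV"
  proof
    fix Y assume Y: "Y \<in> top_of k U - NC k"
    then obtain i where i: "\<forall>x\<in>Y. x $ i = 0" by (auto simp: mem_NC top_of_def)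
    let ?C = "U \<inter> coord_hyperplane i"
    have sub: "vec.subspace ?C" using U
      by (intro vec.subspace_inter) (auto simp: mem_NC mem_Gr coord_hyperplane_def vec.subspace_def)
    have YC: "Y \<subseteq> ?C" using Y i by (auto simp: top_of_def coord_hyperplane_def)
    have "?C \<noteq> U" using U unfolding mem_NC coord_hyperplane_def by blast
    then have "vec.dim ?C < Suc k" using sub U
      by (metis Int_lower1 NC_Gr dim_Gr not_less subspace_Gr vec.subspace_dim_equal)
    then have "Y = ?C" using Y YC sub by (intro vec.subspace_dim_equal) (auto simp: top_of_def mem_Gr)
    then show "Y \<in> (\<lambda>i. U \<inter> coord_hyperplane i) ` UNIV" by blast
  qed
  then have "card (top_of k U - NC k) \<le> card ((\<lambda>i. U \<inter> coord_hyperplane i) ` (UNIV :: 'n set))"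
    by (intro card_mono) auto
  also have "\<dots> \<le> CARD('n)" by (rule card_image_le) simp
  finally have "card (top_of k U - NC k) \<le> CARD('n)" .
  moreover have "card (top_of k U) = card (top_of k U \<inter> NC k) + card (top_of k U - NC k)"
    by (metis card_Int_Diff finite)
  ultimately show ?thesis by linarith
qed

lemma top_adjacent:
  fixes U X Y :: "('a ^ 'n) set"
  assumes "U \<in> Gr (Suc k)" "X \<in> top_of k U" "Y \<in> top_of k U" "X \<noteq> Y"
  shows "adjacent k X Y" "join X Y = U"
  using adjacentI_sup[of X k Y U] assms by (auto simp: top_of_def)

text \<open>The nondegenerate \<open>S\<close> below \<open>U\<close> supplies two nondegenerate
  members, which the clique dichotomy requires.\<close>

lemma top_image:
  assumes S: "S \<in> NC (k - 1)" and U: "U \<in> Gr (Suc k)" "S \<subseteq> U"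
  shows "(\<exists>T\<in>Gr (k - 1). f ` (top_of k U \<inter> NC k) \<subseteq> star k T) \<or>
    (\<exists>W\<in>Gr (Suc k). f ` (top_of k U \<inter> NC k) \<subseteq> top_of k W)"
proof -
  have SG: "S \<in> Gr (k - 1)" using S NC_Gr by blast
  obtain A B where AB: "A \<in> star k S" "B \<in> star k S" "A \<noteq> B" "A \<subseteq> U" "B \<subseteq> U"
    using star_nonempty[OF SG U(1,2)] by auto
  then have "A \<in> top_of k U \<inter> NC k" "B \<in> top_of k U \<inter> NC k"
    using star_NC[OF S, of k] by (auto simp: top_of_def star_def)
  then show ?thesis using top_adjacent(1)[OF U(1)] by (intro clique_image[of _ A B]) (use AB in auto)
qed

text \<open>For every \<open>U\<close> above \<open>S\<close> the nondegenerate
  \<open>k\<close>-subspaces of \<open>U\<close> are too many for a star, so they go into a top; two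
  members of the star of \<open>S\<close> inside \<open>U\<close> identify it as the top of
  \<open>W\<close>. Two different \<open>U\<close> then overfill \<open>W\<close>.\<close>

lemma not_top_type:
  assumes n: "CARD('n) < 2 * k" and S: "S \<in> NC (k - 1)"
  shows "\<not> top_type S"
proof
  assume "top_type S"
  then obtain W where W: "W \<in> Gr (Suc k)" "f ` star k S \<subseteq> top_of k W" by (auto simp: top_type_def)
  have SG: "S \<in> Gr (k - 1)" using S NC_Gr by blast
  note arith = count_arith[OF card_field_ge2 card_top_of card_star_k kn n]
  have into: "f ` (top_of k U \<inter> NC k) \<subseteq> top_of k W" if U: "U \<in> Gr (Suc k)" "S \<subseteq> U" for U
  proof -
    obtain A B where AB: "A \<in> star k S" "B \<in> star k S" "A \<noteq> B" "A \<subseteq> U" "B \<subseteq> U"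
      using star_nonempty[OF SG U(1,2)] by auto
    have ABN: "A \<in> top_of k U \<inter> NC k" "B \<in> top_of k U \<inter> NC k"
      using star_NC[OF S, of k] AB by (auto simp: top_of_def star_def)
    have fAB: "f A \<noteq> f B" using ABN AB f_inj by (auto dest: inj_onD)
    from top_image[OF S U] show ?thesis
    proof
      assume "\<exists>T\<in>Gr (k - 1). f ` (top_of k U \<inter> NC k) \<subseteq> star k T"
      then obtain T where T: "T \<in> Gr (k - 1)" "f ` (top_of k U \<inter> NC k) \<subseteq> star k T" by blast
      have "card (f ` (top_of k U \<inter> NC k)) = card (top_of k U \<inter> NC k)"
        by (intro card_image inj_on_subset[OF f_inj]) auto
      then have "card (top_of k U \<inter> NC k) \<le> card (star k T)" using card_mono[OF _ T(2)] by simp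
      then show ?thesis using arith(1)[OF U(1) T(1)] card_nondegenerate_hyperplanes[OF NC_mono[OF S U(2,1)]] by linarith
    next
      assume "\<exists>W\<in>Gr (Suc k). f ` (top_of k U \<inter> NC k) \<subseteq> top_of k W"
      then obtain W' where W': "W' \<in> Gr (Suc k)" "f ` (top_of k U \<inter> NC k) \<subseteq> top_of k W'" by blast
      have "join (f A) (f B) = W" using W AB fAB by (intro top_adjacent(2)) auto
      moreover have "join (f A) (f B) = W'" using W' ABN fAB by (intro top_adjacent(2)) auto
      ultimately show ?thesis using W' by simp
    qed
  qed
  obtain Y where Y: "Y \<in> Gr k" "S \<subseteq> Y"
    using exists_intermediate_subspace[of S UNIV k] UNIV_Gr SG kn by (auto simp: mem_Gr)
  obtain U where U: "U \<in> Gr (Suc k)" "Y \<subseteq> U"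
    using exists_intermediate_subspace[of Y UNIV "Suc k"] UNIV_Gr Y kn by (auto simp: mem_Gr)
  obtain U' where U': "U' \<in> Gr (Suc k)" "Y \<subseteq> U'" "U' \<noteq> U"
    using star_two[OF Y(1) UNIV_Gr _ U(1)] kn by (auto simp: star_def)
  let ?K = "top_of k U \<inter> NC k" and ?K' = "top_of k U' \<inter> NC k"
  have "?K \<inter> ?K' \<subseteq> {Y}"
  proof
    fix X assume "X \<in> ?K \<inter> ?K'"
    moreover have "U \<inter> U' = Y" using U U' Y by (intro adjacentI_inf(2)[of _ k]) auto
    ultimately have "X \<in> Gr k" "X \<subseteq> Y" by (auto simp: top_of_def)
    then show "X \<in> {Y}" using Gr_eqI Y by blast
  qed
  then have int: "card (?K \<inter> ?K') \<le> 1" by (metis card_mono finite.emptyI finite.insertI is_singletonI is_singleton_altdef)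
  have fK: "card (f ` (?K \<union> ?K')) = card (?K \<union> ?K')"
    by (intro card_image inj_on_subset[OF f_inj]) auto
  have "card ?K + card ?K' = card (?K \<union> ?K') + card (?K \<inter> ?K')" by (rule card_Un_Int) auto
  moreover have "f ` (?K \<union> ?K') \<subseteq> top_of k W" using into[of U] into[of U'] U U' Y by (simp add: image_Un)
  then have "card (?K \<union> ?K') \<le> card (top_of k W)" using card_mono fK by (metis finite)
  moreover have "card (top_of k U) \<le> card ?K + CARD('n)" "card (top_of k U') \<le> card ?K' + CARD('n)"
    using card_nondegenerate_hyperplanes NC_mono[OF S] U U' Y by (meson order_trans)+
  moreover have "card (top_of k U) = card (top_of k W)" "card (top_of k U') = card (top_of k W)"
    using geometric_count[OF card_field_ge2 card_top_of] U U' W by metis+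
  ultimately show False using int arith(2)[OF U(1) SG] by linarith
qed

text \<open>If the types differed, \<open>f\<close> would send one star onto a full top and the
  other onto a full star. For \<open>U\<close> above both centres, the nondegenerate
  \<open>k\<close>-subspaces of \<open>U\<close> go into a star or a top, which two common images
  identify with one of these. By injectivity all of them then contain the corresponding centre, but
  of those through the other centre only \<open>join S S'\<close> does.\<close>

lemma adjacent_same_type:
  assumes n: "CARD('n) = 2 * k" and S: "S \<in> NC (k - 1)" "S' \<in> NC (k - 1)" "adjacent (k - 1) S S'"
    and st: "star_type S'"
  shows "star_type S"
proof (rule ccontr)
  assume "\<not> star_type S"
  then obtain W where W: "W \<in> Gr (Suc k)" "f ` star k S \<subseteq> top_of k W"
    using star_or_top_type[OF S(1)] by (auto simp: top_type_def)
  have onto: "f ` star k S = top_of k W" using top_type_le(2)[OF S(1) W n] .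
  obtain T where T: "T \<in> Gr (k - 1)" "f ` star k S' \<subseteq> star k T" using st by (auto simp: star_type_def)
  have onto': "f ` star k S' = star k T" using star_type_onto[OF S(2) T] .
  have Y: "join S S' \<in> Gr k" using join_Gr_adjacent[OF S(3)] Suc_k1 by simp
  obtain U where U: "U \<in> Gr (Suc k)" "join S S' \<subseteq> U"
    using exists_intermediate_subspace[of "join S S'" UNIV "Suc k"] UNIV_Gr Y kn by (auto simp: mem_Gr)
  have SU: "S \<subseteq> U" "S' \<subseteq> U" using U join_upper1 join_upper2 by blast+
  have SG: "S \<in> Gr (k - 1)" "S' \<in> Gr (k - 1)" using S NC_Gr by blast+
  obtain A B where AB: "A \<in> star k S" "B \<in> star k S" "A \<noteq> B" "A \<subseteq> U" "B \<subseteq> U"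
    using star_nonempty[OF SG(1) U(1) SU(1)] by auto
  obtain A' B' where AB': "A' \<in> star k S'" "B' \<in> star k S'" "A' \<noteq> B'" "A' \<subseteq> U" "B' \<subseteq> U"
    using star_nonempty[OF SG(2) U(1) SU(2)] by auto
  let ?K = "top_of k U \<inter> NC k"
  have K: "A \<in> ?K" "B \<in> ?K" "A' \<in> ?K" "B' \<in> ?K"
    using star_NC[OF S(1), of k] star_NC[OF S(2), of k] AB AB' by (auto simp: top_of_def star_def)
  have fAB: "f A \<noteq> f B" "f A' \<noteq> f B'" using K AB AB' f_inj by (auto dest: inj_onD)
  have both: "X = join S S'" if "X \<in> star k S" "X \<in> star k S'" for X
  proof (rule Gr_eqI[OF Y, symmetric])
    show X: "X \<in> Gr k" using that by (simp add: star_def)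
    show "join S S' \<subseteq> X" using that by (intro join_least subspace_Gr[OF X]) (auto simp: star_def)
  qed
  have sub: "?K \<subseteq> star k R" if R: "f ` ?K \<subseteq> f ` star k R" "R \<in> NC (k - 1)" for R
  proof
    fix X assume X: "X \<in> ?K"
    then obtain Z where "Z \<in> star k R" "f X = f Z" using R(1) by blast
    then show "X \<in> star k R" using X f_inj star_NC[OF R(2), of k] by (metis Int_iff inj_onD subsetD)
  qed
  from top_image[OF S(1) U(1) SU(1)] show False
  proof
    assume "\<exists>T\<in>Gr (k - 1). f ` ?K \<subseteq> star k T"
    then obtain T' where T': "T' \<in> Gr (k - 1)" "f ` ?K \<subseteq> star k T'" by blast
    have "f A' \<inter> f B' = T'" using T' K fAB by (intro star_adjacent(2)) auto
    moreover have "f A' \<inter> f B' = T" using T AB' fAB by (intro star_adjacent(2)) auto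
    ultimately have "?K \<subseteq> star k S'" using T' onto' S sub by simp
    then show False using both AB K by (metis subsetD)
  next
    assume "\<exists>W\<in>Gr (Suc k). f ` ?K \<subseteq> top_of k W"
    then obtain W' where W': "W' \<in> Gr (Suc k)" "f ` ?K \<subseteq> top_of k W'" by blast
    have "join (f A) (f B) = W'" using W' K fAB by (intro top_adjacent(2)) auto
    moreover have "join (f A) (f B) = W" using W AB fAB by (intro top_adjacent(2)) auto
    ultimately have "?K \<subseteq> star k S" using W' onto S sub by simp
    then show False using both AB' K by (metis subsetD)
  qed
qed

text \<open>Connectedness: every nondegenerate subspace is equal or adjacent to one through the
  all-one vector, and everything through that vector is nondegenerate.\<close>

lemma star_type_through_1:
  assumes n: "CARD('n) = 2 * k" and S: "S \<in> Gr (k - 1)" "1 \<in> S" and S': "S' \<in> Gr (k - 1)" "1 \<in> S'"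
    and st: "star_type S'"
  shows "star_type S"
  using S
proof (induction "k - 1 - vec.dim (S \<inter> S')" arbitrary: S rule: less_induct)
  case less
  show ?case
  proof (cases "S = S'")
    case False
    then obtain s where s: "s \<in> S'" "s \<notin> S" using Gr_eqI S' less.prems by (metis subsetI)
    have sub: "vec.subspace (S \<inter> S')" using S' less.prems by (auto simp: mem_Gr vec.subspace_inter)
    have k1: "k - 1 = Suc (k - 2)" using k2 by simp
    have "vec.dim (S \<inter> S') < k - 1"
    proof (rule ccontr)
      assume "\<not> ?thesis"
      then have "S \<inter> S' = S" using sub less.prems by (intro vec.subspace_dim_equal) (auto simp: mem_Gr)
      then show False using False Gr_eqI S' less.prems by blast
    qed
    then obtain R where R: "R \<in> Gr (k - 2)" "S \<inter> S' \<subseteq> R" "R \<subseteq> S"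
      using exists_intermediate_subspace[OF sub _ Int_lower1, of "k - 2"] less.prems k1 by (auto simp: mem_Gr)
    let ?Z = "adjoin s R"
    have sR: "s \<notin> R" using s R by blast
    have Z: "?Z \<in> Gr (k - 1)" using dim_span_insert[OF _ sR] R k1 by (simp add: mem_Gr)
    have RZ: "R \<subseteq> ?Z" "s \<in> ?Z" using vec.span_superset[of "insert s R"] by auto
    have Z1: "1 \<in> ?Z" using R RZ less.prems S' by blast
    have "insert s (S \<inter> S') \<subseteq> ?Z \<inter> S'" using s R RZ by blast
    then have "adjoin s (S \<inter> S') \<subseteq> ?Z \<inter> S'" using Z S' by (intro vec.span_minimal vec.subspace_inter) (auto simp: mem_Gr)
    then have "vec.dim (S \<inter> S') + 1 \<le> vec.dim (?Z \<inter> S')"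
      using vec.dim_subset[of "adjoin s (S \<inter> S')" "?Z \<inter> S'"] dim_span_insert[OF sub, of s] s by simp
    then have "star_type ?Z" using \<open>vec.dim (S \<inter> S') < k - 1\<close> Z Z1 by (intro less.hyps) auto
    moreover have "adjacent (k - 1) S ?Z"
      using adjacentI_inf(1)[of S "k - 2" ?Z R] less.prems Z R RZ s k1 by auto
    ultimately show ?thesis
      using adjacent_same_type[OF n, of S ?Z] less.prems Z Z1 NC_full[OF full_1] by blast
  qed (use st in simp)
qed

lemma exists_through_1:
  fixes S :: "('a ^ 'n) set"
  assumes S: "S \<in> NC (k - 1)"
  shows "\<exists>S'\<in>Gr (k - 1). 1 \<in> S' \<and> (S = S' \<or> adjacent (k - 1) S S')"
proof (cases "1 \<in> S")
  case False
  have k1: "k - 1 = Suc (k - 2)" using k2 by simp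
  have SG: "S \<in> Gr (k - 1)" using S NC_Gr by blast
  obtain R where R: "R \<in> Gr (k - 2)" "R \<subseteq> S"
    using exists_intermediate_subspace[of "{0}" S "k - 2"] SG vec.subspace_0[of S] k1 by (auto simp: mem_Gr)
  let ?Z = "adjoin 1 R"
  have "1 \<notin> R" using R False by blast
  then have Z: "?Z \<in> Gr (k - 1)" using dim_span_insert[of R 1] R k1 by (simp add: mem_Gr)
  moreover have RZ: "R \<subseteq> ?Z" "1 \<in> ?Z" using vec.span_superset[of "insert 1 R"] by auto
  moreover have "adjacent (k - 1) S ?Z"
    using adjacentI_inf(1)[of S "k - 2" ?Z R] SG Z R RZ False k1 by auto
  ultimately show ?thesis by blast
qed (use S NC_Gr in blast)

theorem star_or_dual:
  "(\<forall>S\<in>NC (k - 1). star_type S) \<or> (CARD('n) = 2 * k \<and> (\<forall>S\<in>NC (k - 1). top_type S))"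
proof (cases "CARD('n) = 2 * k")
  case False
  have "\<not> top_type S" if S: "S \<in> NC (k - 1)" for S
  proof (cases "CARD('n) < 2 * k")
    case True
    then show ?thesis using not_top_type S by blast
  next
    case *: False
    show ?thesis
    proof
      assume "top_type S"
      then show False using top_type_le(1)[OF S] * False by (auto simp: top_type_def)
    qed
  qed
  then show ?thesis using star_or_top_type by blast
next
  case n: True
  show ?thesis
  proof (cases "\<exists>S\<in>NC (k - 1). star_type S")
    case False
    then show ?thesis using n star_or_top_type by blast
  next
    case True
    then obtain S where S: "S \<in> NC (k - 1)" "star_type S" by blast
    obtain S1 where S1: "S1 \<in> Gr (k - 1)" "1 \<in> S1" "S = S1 \<or> adjacent (k - 1) S S1"
      using exists_through_1[OF S(1)] by blast
    have t1: "star_type S1" using S S1 adjacent_same_type[OF n, of S1 S] NC_full[OF full_1] adjacent_commute by metis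
    have "star_type R" if R: "R \<in> NC (k - 1)" for R
    proof -
      obtain R1 where R1: "R1 \<in> Gr (k - 1)" "1 \<in> R1" "R = R1 \<or> adjacent (k - 1) R R1"
        using exists_through_1[OF R] by blast
      have "star_type R1" by (rule star_type_through_1[OF n R1(1,2) S1(1,2) t1])
      then show ?thesis using R R1 adjacent_same_type[OF n, of R R1] NC_full[OF full_1] by metis
    qed
    then show ?thesis by blast
  qed
qed

end

section \<open>Induced maps on smaller nondegenerate subspaces\<close>

locale star_embedding = code_embedding f k
  for f :: "('a::{field,finite} ^ 'n::finite) set \<Rightarrow> ('a ^ 'n) set" and k :: nat +
  assumes stars: "\<And>S. S \<in> NC (k - 1) \<Longrightarrow> star_type S"
begin

text \<open>The intersection also makes sense for degenerate \<open>X\<close>; for q >= 3 it is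
  evaluated at degenerate points.\<close>

definition lower :: "('a ^ 'n) set \<Rightarrow> ('a ^ 'n) set" where
  "lower X = \<Inter> {f Y | Y. Y \<in> NC k \<and> X \<subseteq> Y}"

lemma lower_mono: "X \<subseteq> X' \<Longrightarrow> lower X \<subseteq> lower X'"
  unfolding lower_def by blast

lemma lower_le: "Y \<in> NC k \<Longrightarrow> X \<subseteq> Y \<Longrightarrow> lower X \<subseteq> f Y"
  unfolding lower_def by blast

lemma lower_k: "Y \<in> NC k \<Longrightarrow> lower Y = f Y"
  using Gr_eqI NC_Gr unfolding lower_def by (intro equalityI) blast+

lemma lower_greatest: "(\<And>Y. Y \<in> NC k \<Longrightarrow> X \<subseteq> Y \<Longrightarrow> Z \<subseteq> f Y) \<Longrightarrow> Z \<subseteq> lower X"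
  unfolding lower_def by blast

lemma subspace_lower: "vec.subspace (lower X)"
  unfolding lower_def by (rule vec.subspace_Inter) (auto dest: f_Gr simp: mem_Gr)

definition good_level :: "nat \<Rightarrow> bool" where
  "good_level j \<longleftrightarrow> (\<forall>S\<in>NC j. lower S \<in> Gr j) \<and> inj_on lower (NC j)"

text \<open>The images of the star of \<open>R\<close> lie in the star of \<open>T\<close>, and
  equal sizes make them fill it. Two of them meet in \<open>T\<close>, which bounds
  \<open>lower R\<close> from above; conversely every code over \<open>R\<close> contains a member
  of the star.\<close>

lemma level_step:
  assumes j: "j < k" and good: "good_level (Suc j)"
    and R: "R \<in> NC j" and T: "T \<in> Gr j" "\<And>S. S \<in> star (Suc j) R \<Longrightarrow> T \<subseteq> lower S"
  shows "lower R = T" "lower ` star (Suc j) R = star (Suc j) T"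
proof -
  let ?I = "star (Suc j) R"
  have RG: "R \<in> Gr j" using NC_Gr[OF R] .
  have IN: "?I \<subseteq> NC (Suc j)" using star_NC[OF R] .
  have sub: "lower ` ?I \<subseteq> star (Suc j) T" using T(2) IN good by (auto simp: star_def good_level_def)
  have injI: "inj_on lower ?I" using good inj_on_subset[OF _ IN] by (auto simp: good_level_def)
  have "card ?I = card (star (Suc j) T)"
    using geometric_count[OF card_field_ge2 card_star] RG T(1) by metis
  then show onto: "lower ` ?I = star (Suc j) T"
    using sub card_image[OF injI] by (intro card_subset_eq) auto
  have "T \<subseteq> lower R"
  proof (rule lower_greatest)
    fix Y assume Y: "Y \<in> NC k" "R \<subseteq> Y"
    then obtain S where S: "S \<in> Gr (Suc j)" "R \<subseteq> S" "S \<subseteq> Y"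
      using exists_intermediate_subspace[of R Y "Suc j"] RG NC_Gr[OF Y(1)] j by (auto simp: mem_Gr)
    then have "T \<subseteq> lower S" using T(2) by (auto simp: star_def)
    also have "\<dots> \<subseteq> f Y" using lower_le Y S by blast
    finally show "T \<subseteq> f Y" .
  qed
  moreover have "lower R \<subseteq> T"
  proof -
    obtain A where A: "A \<in> Gr (Suc j)" "R \<subseteq> A"
      using exists_intermediate_subspace[of R UNIV "Suc j"] UNIV_Gr RG kn j by (auto simp: mem_Gr)
    obtain B where B: "B \<in> ?I" "B \<noteq> A" using star_two[OF RG UNIV_Gr _ A(1)] kn j by auto
    have AI: "A \<in> ?I" using A by (simp add: star_def)
    have ne: "lower A \<noteq> lower B" using injI AI B by (auto dest: inj_onD)
    have mem: "lower A \<in> star (Suc j) T" "lower B \<in> star (Suc j) T" using sub AI B by blast+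
    have "lower A \<inter> lower B = T"
      using mem ne T by (intro adjacentI_inf(2)[of _ j]) (auto simp: star_def)
    moreover have "lower R \<subseteq> lower A" "lower R \<subseteq> lower B" using AI B by (auto simp: star_def intro!: lower_mono)
    ultimately show ?thesis by blast
  qed
  ultimately show "lower R = T" by blast
qed

lemma lower_clique:
  assumes good: "good_level (Suc j)" "good_level (Suc (Suc j))"
    and AB: "A \<in> NC (Suc j)" "B \<in> NC (Suc j)" "adjacent (Suc j) A B"
  shows "adjacent (Suc j) (lower A) (lower B)" "join (lower A) (lower B) = lower (join A B)"
proof -
  have U: "join A B \<in> NC (Suc (Suc j))"
    using join_Gr_adjacent[OF AB(3)] NC_mono[OF AB(1) join_upper1] by blast
  have "A \<noteq> B" using adjacent_neq[OF AB(3)] .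
  then have ne: "lower A \<noteq> lower B" using AB good by (auto simp: good_level_def dest: inj_onD)
  have G: "lower A \<in> Gr (Suc j)" "lower B \<in> Gr (Suc j)" "lower (join A B) \<in> Gr (Suc (Suc j))"
    using AB U good by (auto simp: good_level_def)
  note * = adjacentI_sup[OF G(1,2) ne G(3) lower_mono[OF join_upper1] lower_mono[OF join_upper2]]
  show "adjacent (Suc j) (lower A) (lower B)" using *(1) .
  show "join (lower A) (lower B) = lower (join A B)" using *(2) .
qed

lemma level_star_type:
  assumes j: "Suc j < k" and good: "good_level (Suc j)" "good_level (Suc (Suc j))" and R: "R \<in> NC j"
  shows "\<exists>T\<in>Gr j. \<forall>S\<in>star (Suc j) R. T \<subseteq> lower S"
proof -
  let ?I = "star (Suc j) R"
  have RG: "R \<in> Gr j" using NC_Gr[OF R] .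
  have IN: "?I \<subseteq> NC (Suc j)" using star_NC[OF R] .
  have adjI: "adjacent (Suc j) A B" if "A \<in> ?I" "B \<in> ?I" "A \<noteq> B" for A B
    using that RG by (intro adjacentI_inf(1)[of _ j _ R]) (auto simp: star_def)
  obtain A where A: "A \<in> ?I"
    using exists_intermediate_subspace[of R UNIV "Suc j"] UNIV_Gr RG kn j by (auto simp: mem_Gr star_def)
  then obtain B where B: "B \<in> ?I" "B \<noteq> A" using star_two[OF RG UNIV_Gr, of A] kn j by (auto simp: star_def)
  have AB: "adjacent (Suc j) A B" using adjI A B by blast
  have ne: "lower A \<noteq> lower B" using lower_clique(1)[OF good _ _ AB] A B IN adjacent_neq by blast
  have "(\<exists>T\<in>Gr j. \<forall>X\<in>lower ` ?I. T \<subseteq> X) \<or> (\<exists>W\<in>Gr (Suc (Suc j)). \<forall>X\<in>lower ` ?I. X \<subseteq> W)"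
  proof (rule clique_star_or_top[OF _ _ imageI[OF A] imageI[OF B(1)] ne])
    show "lower ` ?I \<subseteq> Gr (Suc j)" using IN good by (auto simp: good_level_def)
    show "adjacent (Suc j) X Y" if "X \<in> lower ` ?I" "Y \<in> lower ` ?I" "X \<noteq> Y" for X Y
      using that lower_clique(1)[OF good] adjI IN by blast
  qed
  moreover have False if W: "W \<in> Gr (Suc (Suc j))" "\<forall>X\<in>lower ` ?I. X \<subseteq> W" for W
  proof -
    have eqW: "lower (join A C) = W" if C: "C \<in> ?I" "C \<noteq> A" for C
    proof -
      have adj: "adjacent (Suc j) A C" using adjI A C by blast
      then have l: "adjacent (Suc j) (lower A) (lower C)" "join (lower A) (lower C) = lower (join A C)"
        using lower_clique[OF good, of A C] A C IN by blast+
      moreover have "join (lower A) (lower C) = W"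
      proof (rule adjacentI_sup(2)[OF _ _ adjacent_neq[OF l(1)] W(1)])
        show "lower A \<in> Gr (Suc j)" "lower C \<in> Gr (Suc j)" using l(1) by (simp_all add: adjacent_def)
        show "lower A \<subseteq> W" "lower C \<subseteq> W" using W(2) A C by simp_all
      qed
      ultimately show ?thesis by simp
    qed
    have U: "join A B \<in> Gr (Suc (Suc j))" by (rule join_Gr_adjacent[OF AB])
    have "join A B \<noteq> UNIV"
    proof
      assume "join A B = UNIV"
      then have "Suc (Suc j) = CARD('n)" using U UNIV_Gr by (simp only: mem_Gr)
      then show False using j kn by linarith
    qed
    then obtain x where x: "x \<notin> join A B" by blast
    then have xR: "x \<notin> R" using A join_upper1[of A B] by (auto simp: star_def)
    let ?C = "adjoin x R"
    have C: "?C \<in> ?I" using dim_span_insert[OF _ xR] RG vec.span_superset[of "insert x R"]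
      by (auto simp: star_def mem_Gr)
    have xC: "x \<in> ?C" by (simp add: vec.span_base)
    have CA: "?C \<noteq> A" using x xC join_upper1[of A B] by blast
    have "lower (join A B) = lower (join A ?C)" using eqW B C CA by simp
    moreover have "join A B \<in> NC (Suc (Suc j))" "join A ?C \<in> NC (Suc (Suc j))"
      using U join_Gr_adjacent[OF adjI[OF A C]] CA A IN NC_mono[OF _ join_upper1] by blast+
    ultimately have "join A B = join A ?C" using good by (auto simp: good_level_def dest: inj_onD)
    then show False using x xC join_upper2[of ?C A] by blast
  qed
  ultimately have "\<exists>T\<in>Gr j. \<forall>X\<in>lower ` ?I. T \<subseteq> X" by metis
  then show ?thesis by (simp add: ball_simps)
qed

lemma star_type_k:
  assumes R: "R \<in> NC (k - 1)"
  shows "\<exists>T\<in>Gr (k - 1). \<forall>S\<in>star k R. T \<subseteq> lower S"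
proof -
  obtain T where T: "T \<in> Gr (k - 1)" "f ` star k R \<subseteq> star k T" using stars[OF R] by (auto simp: star_type_def)
  have "T \<subseteq> lower S" if S: "S \<in> star k R" for S
  proof -
    have "lower S = f S" using lower_k S star_NC[OF R, of k] by blast
    moreover have "f S \<in> star k T" using T(2) S by blast
    ultimately show ?thesis by (simp add: star_def)
  qed
  then show ?thesis using T(1) by blast
qed

lemma level_clique_type:
  assumes j: "j < k" and good: "\<And>i. Suc j \<le> i \<Longrightarrow> i \<le> k \<Longrightarrow> good_level i" and R: "R \<in> NC j"
  obtains T where "T \<in> Gr j" "\<And>S. S \<in> star (Suc j) R \<Longrightarrow> T \<subseteq> lower S"
proof (cases "Suc j = k")
  case True
  then have "j = k - 1" by simp
  then obtain T where "T \<in> Gr j" "\<forall>S\<in>star k R. T \<subseteq> lower S" using star_type_k R by blast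
  then show ?thesis using that[of T] True by simp
next
  case False
  then have sj: "Suc j < k" using j by simp
  have "good_level (Suc j)" "good_level (Suc (Suc j))" using good sj by auto
  then obtain T where "T \<in> Gr j" "\<forall>S\<in>star (Suc j) R. T \<subseteq> lower S"
    using level_star_type[OF sj _ _ R] by blast
  then show ?thesis using that[of T] by simp
qed

text \<open>Descending induction from \<open>k\<close>. The step to \<open>j\<close> draws on levels
  \<open>j + 1\<close> and \<open>j + 2\<close>, hence the strengthening to all levels from
  \<open>j\<close> to \<open>k\<close>.\<close>

lemma good_levels: "j \<le> k \<Longrightarrow> good_level j"
proof -
  have "\<forall>i. j \<le> i \<and> i \<le> k \<longrightarrow> good_level i" if "j \<le> k" for j
    using that
  proof (induction j rule: inc_induct)
    case base
    have "good_level k" unfolding good_level_def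
      using f_Gr f_inj lower_k by (simp cong: inj_on_cong)
    then show ?case using le_antisym by blast
  next
    case (step j)
    have good: "good_level i" if "Suc j \<le> i" "i \<le> k" for i using step that by blast
    have gs: "good_level (Suc j)" using good step by simp
    have "good_level j" unfolding good_level_def
    proof (intro conjI ballI inj_onI)
      fix S :: "('a ^ 'n) set" assume S: "S \<in> NC j"
      obtain T where T: "T \<in> Gr j" "\<And>Z. Z \<in> star (Suc j) S \<Longrightarrow> T \<subseteq> lower Z"
        using level_clique_type[OF step(2) good S] by blast
      then show "lower S \<in> Gr j" using level_step(1)[OF step(2) gs S T] by simp
    next
      fix S S' :: "('a ^ 'n) set" assume S: "S \<in> NC j" "S' \<in> NC j" "lower S = lower S'"
      obtain T where T: "T \<in> Gr j" "\<And>Z. Z \<in> star (Suc j) S \<Longrightarrow> T \<subseteq> lower Z"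
        using level_clique_type[OF step(2) good S(1)] by blast
      obtain T' where T': "T' \<in> Gr j" "\<And>Z. Z \<in> star (Suc j) S' \<Longrightarrow> T' \<subseteq> lower Z"
        using level_clique_type[OF step(2) good S(2)] by blast
      have "lower ` star (Suc j) S = lower ` star (Suc j) S'"
        using level_step[OF step(2) gs S(1) T] level_step[OF step(2) gs S(2) T'] S(3) by simp
      then have "star (Suc j) S = star (Suc j) S'"
        using gs inj_on_image_eq_iff[OF _ star_NC[OF S(1), of "Suc j"] star_NC[OF S(2), of "Suc j"], of lower]
        unfolding good_level_def by blast
      moreover have "Suc j < CARD('n)" using step(2) kn by linarith
      ultimately show "S = S'" using star_inj[OF NC_Gr[OF S(1)] NC_Gr[OF S(2)]] by simp
    qed
    then show ?case using good by (metis le_neq_implies_less Suc_leI)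
  qed
  then show "j \<le> k \<Longrightarrow> good_level j" by blast
qed

lemma lower_Gr: "j \<le> k \<Longrightarrow> S \<in> NC j \<Longrightarrow> lower S \<in> Gr j"
  using good_levels by (simp add: good_level_def)

lemma lower_eq_iff: "j \<le> k \<Longrightarrow> S \<in> NC j \<Longrightarrow> S' \<in> NC j \<Longrightarrow> lower S = lower S' \<longleftrightarrow> S = S'"
  using good_levels[of j] by (auto simp: good_level_def dest: inj_onD)

lemma lower_star:
  assumes "j < k" "R \<in> NC j"
  shows "lower ` star (Suc j) R = star (Suc j) (lower R)"
proof -
  obtain T where T: "T \<in> Gr j" "\<And>Z. Z \<in> star (Suc j) R \<Longrightarrow> T \<subseteq> lower Z"
    using level_clique_type[OF assms(1) good_levels assms(2)] by blast
  then show ?thesis using level_step[OF assms(1) good_levels assms(2) T] assms by simp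
qed

lemma lower_adjacent:
  assumes "j \<le> k" "A \<in> NC j" "B \<in> NC j" "adjacent j A B"
  shows "adjacent j (lower A) (lower B)"
proof (cases "j = k")
  case True
  then show ?thesis using assms f_adj lower_k by simp
next
  case False
  obtain i where i: "j = Suc i" using assms(4) by (auto simp: adjacent_def)
  show ?thesis using lower_clique(1)[of i A B] good_levels assms False i by simp
qed

text \<open>Stars go onto stars, so \<open>X'\<close> is reached by climbing one dimension at a time
  from \<open>R\<close>.\<close>

lemma lower_onto:
  assumes "i \<le> j" "j \<le> k" "R \<in> NC i" "X' \<in> Gr j" "lower R \<subseteq> X'"
  shows "\<exists>X\<in>Gr j. R \<subseteq> X \<and> lower X = X'"
  using assms
proof (induction j arbitrary: X' rule: dec_induct)
  case base
  then have "lower R = X'" using lower_Gr[of i R] Gr_eqI by simp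
  then show ?case using NC_Gr base by blast
next
  case (step m)
  have lR: "lower R \<in> Gr i" using lower_Gr step by simp
  obtain X2 where X2: "X2 \<in> Gr m" "lower R \<subseteq> X2" "X2 \<subseteq> X'"
    using exists_intermediate_subspace[of "lower R" X' m] lR step by (auto simp: mem_Gr)
  obtain X1 where X1: "X1 \<in> Gr m" "R \<subseteq> X1" "lower X1 = X2"
    using step.IH[of X2] step.prems X2 by (auto simp: Suc_leD)
  have "X1 \<in> NC m" using NC_mono step X1 by blast
  moreover have "X' \<in> star (Suc m) (lower X1)" using X2 X1 step by (simp add: star_def)
  ultimately have "X' \<in> lower ` star (Suc m) X1" using lower_star[of m X1] step by simp
  then show ?case using X1 by (auto simp: star_def)
qed

lemma lower_reflects:
  assumes "i \<le> j" "j \<le> k" "R \<in> NC i" "Y \<in> NC j" "lower R \<subseteq> lower Y"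
  shows "R \<subseteq> Y"
proof -
  obtain X where X: "X \<in> Gr j" "R \<subseteq> X" "lower X = lower Y"
    using lower_onto[OF assms(1-3) lower_Gr[OF assms(2,4)] assms(5)] by blast
  then have "X \<in> NC j" using NC_mono[OF assms(3)] by simp
  then have "X = Y" using lower_eq_iff[OF assms(2) _ assms(4)] X by simp
  then show ?thesis using X by simp
qed

end

section \<open>Fields with at least three elements\<close>

lemma point_Gr: "v \<noteq> 0 \<Longrightarrow> pt v \<in> Gr 1"
  by (simp add: mem_Gr)

lemma span_insert_Gr: "X \<in> Gr j \<Longrightarrow> x \<notin> X \<Longrightarrow> adjoin x X \<in> Gr (Suc j)"
  using dim_span_insert[of X x] by (simp add: mem_Gr)

lemma line_Gr: "v \<noteq> 0 \<Longrightarrow> x \<notin> pt v \<Longrightarrow> adjoin x (pt v) \<in> Gr 2"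
  using span_insert_Gr[OF point_Gr, of v x] by (simp add: numeral_2_eq_2)

lemma plane_Gr: "X \<in> Gr 2 \<Longrightarrow> x \<notin> X \<Longrightarrow> adjoin x X \<in> Gr 3"
  using span_insert_Gr[of X 2 x] by simp

lemma lines_meet:
  assumes "X \<in> Gr 2" "Y \<in> Gr 2" "X \<noteq> Y" "P \<in> Gr 1" "P \<subseteq> X" "P \<subseteq> Y"
  shows "adjacent 2 X Y" "X \<inter> Y = P"
  using adjacentI_inf[of X 1 Y P] assms by (simp_all add: numeral_2_eq_2)

lemma points_join:
  fixes X Y :: "('a::{field,finite} ^ 'n::finite) set"
  assumes "X \<in> Gr 1" "Y \<in> Gr 1" "X \<noteq> Y" "L \<in> Gr 2" "X \<subseteq> L" "Y \<subseteq> L"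
  shows "join X Y = L"
  using adjacentI_sup(2)[of X 1 Y L] assms by (simp add: numeral_2_eq_2)

lemma Gr1_span: "P \<in> Gr 1 \<Longrightarrow> v \<in> P \<Longrightarrow> v \<noteq> 0 \<Longrightarrow> pt v = P"
  by (intro Gr_eqI[OF point_Gr] vec.span_minimal) (auto simp: mem_Gr)

lemma Gr1_obtain:
  assumes "P \<in> Gr 1" obtains v where "v \<noteq> 0" "P = pt v"
  using exists_nonzero[of P] Gr1_span[OF assms] dim_Gr[OF assms] by force

lemma mem_span_singleton: "x \<in> pt v \<longleftrightarrow> (\<exists>c. x = c *s v)"
  by (auto simp: vec.span_singleton)

lemma mem_span_insert1: "x \<in> adjoin x X"
  by (simp add: vec.span_base)

lemma subset_span_insert: "X \<subseteq> adjoin x X"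
  using vec.span_superset[of "insert x X"] by blast

lemma exists_avoiding2: "3 \<le> CARD('a::finite) \<Longrightarrow> \<exists>c::'a. c \<noteq> x \<and> c \<noteq> y"
proof (rule ccontr)
  assume "3 \<le> CARD('a)" "\<nexists>c::'a. c \<noteq> x \<and> c \<noteq> y"
  then have "UNIV \<subseteq> {x, y}" by blast
  then have "CARD('a) \<le> card {x, y}" by (intro card_mono) auto
  then show False using \<open>3 \<le> CARD('a)\<close> card_insert_le_m1[of 2 "{y}" x] by simp
qed

section \<open>Subspaces spanned by full points, and how far the images of full points
  spread\<close>

definition const_off :: "'n set \<Rightarrow> ('a::field ^ 'n::finite) set" where
  "const_off J = {x. \<exists>c. \<forall>i. i \<notin> J \<longrightarrow> x $ i = c}"

lemma subspace_const_off: "vec.subspace (const_off J :: ('a::field ^ 'n::finite) set)"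
  unfolding vec.subspace_def
proof (intro conjI ballI allI)
  show "0 \<in> const_off J" by (auto simp: const_off_def)
  fix x y :: "'a^'n" and c :: 'a assume x: "x \<in> const_off J"
  then obtain a where a: "\<forall>i. i \<notin> J \<longrightarrow> x $ i = a" by (auto simp: const_off_def)
  then show "c *s x \<in> const_off J" by (auto simp: const_off_def)
  assume "y \<in> const_off J"
  then obtain b where "\<forall>i. i \<notin> J \<longrightarrow> y $ i = b" by (auto simp: const_off_def)
  then show "x + y \<in> const_off J" using a by (auto simp: const_off_def)
qed

lemma one_const_off: "1 \<in> const_off J"
  by (auto simp: const_off_def)

lemma not_const_off: "i \<notin> J \<Longrightarrow> j \<notin> J \<Longrightarrow> x $ i \<noteq> x $ j \<Longrightarrow> x \<notin> const_off J"
  by (auto simp: const_off_def)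

text \<open>The vector \<open>x\<close> may be \<open>axis j 1\<close>, which gives the dimension,
  or a full vector \<open>1 + axis j t\<close>, which shows that for q >= 3 these subspaces are
  spanned by full vectors.\<close>

lemma const_off_insert:
  fixes x :: "'a::field ^ 'n::finite"
  assumes x: "x $ j \<noteq> x $ d" "\<And>i. i \<noteq> j \<Longrightarrow> x $ i = x $ d"
  shows "const_off (insert j J) = adjoin x (const_off J)"
proof (intro equalityI span_insert_least subspace_const_off)
  show "x \<in> const_off (insert j J)" using x by (auto simp: const_off_def)
  show "const_off J \<subseteq> const_off (insert j J)" by (auto simp: const_off_def)
  show "const_off (insert j J) \<subseteq> adjoin x (const_off J)"
  proof
    fix y :: "'a^'n" assume "y \<in> const_off (insert j J)"
    then obtain c where c: "\<forall>i. i \<notin> insert j J \<longrightarrow> y $ i = c" by (auto simp: const_off_def)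
    define t where "t = (y $ j - c) / (x $ j - x $ d)"
    have tj: "t * (x $ j - x $ d) = y $ j - c" using x(1) by (simp add: t_def)
    have "y $ i - t * x $ i = c - t * x $ d" if "i \<notin> J" for i
    proof (cases "i = j")
      case True
      then show ?thesis using tj by (simp add: algebra_simps)
    next
      case False
      then show ?thesis using c x(2)[of i] that by simp
    qed
    then have "y - t *s x \<in> const_off J" by (auto simp: const_off_def)
    moreover have "y = t *s x + (y - t *s x)" by simp
    ultimately show "y \<in> adjoin x (const_off J)"
      unfolding span_insert_iff[OF subspace_const_off] by blast
  qed
qed

lemma const_off_empty: "const_off {} = pt 1"
  by (auto simp: const_off_def mem_span_singleton vec_eq_iff)

lemma const_off_Gr:
  fixes J :: "'n::finite set"
  assumes "J \<noteq> UNIV"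
  shows "(const_off J :: ('a::field ^ 'n) set) \<in> Gr (Suc (card J))"
  using finite[of J] assms
proof (induction J rule: finite_induct)
  case empty
  have "(1 :: 'a^'n) \<noteq> 0" by (simp add: vec_eq_iff)
  then show ?case using point_Gr[of "1 :: 'a^'n"] by (simp add: const_off_empty)
next
  case (insert j J)
  obtain d where d: "d \<notin> insert j J" using insert by blast
  let ?x = "axis j 1 :: 'a^'n"
  have x: "?x $ j \<noteq> ?x $ d" "\<And>i. i \<noteq> j \<Longrightarrow> ?x $ i = ?x $ d" using d by (auto simp: axis_def)
  have "?x \<notin> const_off J" using not_const_off[of j J d ?x] insert d x by blast
  then show ?case using const_off_insert[OF x, where J=J] span_insert_Gr[of "const_off J"] insert by auto
qed

locale star_embedding_large = star_embedding f k
  for f :: "('a::{field,finite} ^ 'n::finite) set \<Rightarrow> ('a ^ 'n) set" and k :: nat +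
  assumes q3: "3 \<le> CARD('a)"
begin

lemma full_nonzero: "full (p :: 'a^'n) \<Longrightarrow> p \<noteq> 0"
  by (auto simp: full_def)

lemma full_point_NC: "full (p :: 'a^'n) \<Longrightarrow> pt p \<in> NC 1"
  using NC_full point_Gr full_nonzero vec.span_base by (metis singletonI)

text \<open>Since \<open>lower\<close> reflects inclusion, the image of the point is not inside
  \<open>lower S\<close>; by dimension the two images span
  \<open>lower (adjoin p S)\<close>.\<close>

lemma lower_add_point:
  assumes S: "S \<in> NC j" "j < k" and p: "full p" "p \<notin> S" and W: "vec.subspace W" "lower S \<subseteq> W" "lower (pt p) \<subseteq> W"
  shows "lower (adjoin p S) \<subseteq> W"
proof -
  have Z: "adjoin p S \<in> NC (Suc j)"
    using NC_full[OF p(1) mem_span_insert1] span_insert_Gr[OF NC_Gr[OF S(1)] p(2)] by blast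
  have "\<not> pt p \<subseteq> S" using p(2) vec.span_base by blast
  moreover have "j \<ge> 1"
  proof (rule ccontr)
    assume "\<not> 1 \<le> j"
    then have "S \<subseteq> {0}" using S vec.dim_eq_0[of S] by (auto simp: mem_NC mem_Gr)
    then show False using S(1) unfolding mem_NC by force
  qed
  ultimately have "\<not> lower (pt p) \<subseteq> lower S"
    using lower_reflects[of 1 j] full_point_NC[OF p(1)] S by auto
  then obtain v where v: "v \<in> lower (pt p)" "v \<notin> lower S" by blast
  have "lower (pt p) \<subseteq> lower (adjoin p S)"
    by (intro lower_mono vec.span_mono) auto
  then have "adjoin v (lower S) = lower (adjoin p S)"
    using v S Z lower_Gr[of j S] lower_Gr[of "Suc j"] lower_mono[OF subset_span_insert]
    by (intro span_insert_eq[of _ j]) auto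
  moreover have "adjoin v (lower S) \<subseteq> W" using v W by (intro span_insert_least) auto
  ultimately show ?thesis by simp
qed

lemma exists_four_indices:
  obtains J :: "'n set" and a b c d where "card J = k - 2" "a \<notin> J" "b \<notin> J" "c \<notin> J" "d \<notin> J" "distinct [a, b, c, d]"
proof -
  have "k - 2 \<le> CARD('n)" using kn by linarith
  then obtain J :: "'n set" where J: "card J = k - 2" by (rule obtain_subset_with_card_n)
  have "card (- J) \<ge> 4" using J kn k2 by (simp add: Compl_eq_Diff_UNIV card_Diff_subset)
  then obtain A where A: "A \<subseteq> - J" "card A = 4" by (rule obtain_subset_with_card_n)
  then obtain xs where xs: "set xs = A" "length xs = 4" "distinct xs" using finite_distinct_list[of A] distinct_card by fastforce
  then obtain a b c d where "xs = [a, b, c, d]" by (auto simp: length_Suc_conv numeral_eq_Suc)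
  then show ?thesis using that[of J a b c d] J xs A by auto
qed

text \<open>Otherwise the subspaces spanned by \<open>const_off J\<close> and a full point would all be sent into one
  pencil of \<open>q + 1\<close> subspaces, but there are more than \<open>q + 1\<close> of them.\<close>

lemma full_points_spread_aux:
  assumes W: "W \<in> Gr (Suc k)" and all: "\<And>p. full p \<Longrightarrow> lower (pt p) \<subseteq> W"
  shows False
proof -
  \<comment> \<open>With this \<open>t\<close> the vector \<open>1 + axis j t\<close> is full and
    not a multiple of \<open>1\<close>; here q >= 3 enters.\<close>
  obtain t :: 'a where t: "t \<noteq> 0" "t \<noteq> -1" using exists_avoiding2[OF q3] by metis
  have t1: "1 + t \<noteq> 0" using t by (metis add.commute add_eq_0_iff)
  have Ws: "vec.subspace W" using subspace_Gr[OF W] .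
  have SJ: "lower (const_off J) \<subseteq> W" if "card J \<le> k - 2" for J :: "'n set"
    using finite[of J] that
  proof (induction J rule: finite_induct)
    case empty
    then show ?case using all[OF full_1] by (simp add: const_off_empty)
  next
    case (insert j J)
    have "card (insert j J) < CARD('n)" using insert.prems kn by linarith
    then obtain d where d: "d \<notin> insert j J" by (metis UNIV_I less_irrefl subsetI subset_antisym)
    let ?p = "1 + axis j t :: 'a^'n"
    have x: "?p $ j \<noteq> ?p $ d" "\<And>i. i \<noteq> j \<Longrightarrow> ?p $ i = ?p $ d" using d t by (auto simp: axis_def)
    have fp: "full ?p" using t1 by (auto simp: full_def axis_def)
    have pJ: "?p \<notin> const_off J" using not_const_off[of j J d ?p] insert d x by blast
    have cj: "Suc (card J) < k" using insert k2 by simp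
    have "const_off J \<in> NC (Suc (card J))"
      using NC_full[OF full_1 one_const_off] const_off_Gr[of J] d by blast
    moreover have "lower (const_off J) \<subseteq> W" using insert by simp
    ultimately have "lower (adjoin ?p (const_off J)) \<subseteq> W"
      by (rule lower_add_point[OF _ cj fp pJ Ws _ all[OF fp]])
    then show ?case using const_off_insert[OF x, where J=J] by simp
  qed
  obtain J and a b c d :: 'n where J: "card J = k - 2" and abcd: "a \<notin> J" "b \<notin> J" "c \<notin> J" "d \<notin> J"
    and dist: "distinct [a, b, c, d]" by (rule exists_four_indices)
  let ?S = "const_off J :: ('a^'n) set"
  have "Suc (card J) = k - 1" using J k2 by simp
  then have S: "?S \<in> NC (k - 1)"
    using NC_full[OF full_1 one_const_off[of J]] const_off_Gr[of J] abcd by force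
  have SW: "lower ?S \<subseteq> W" using SJ[of J] J by simp
  \<comment> \<open>Three of the four spare coordinates carry the entries; the fourth,
    \<open>d\<close>, stays zero and fixes the scaling modulo \<open>const_off J\<close>.\<close>
  define vv where "vv \<alpha> \<beta> \<gamma> = (axis a \<alpha> + axis b \<beta> + axis c \<gamma> :: 'a^'n)" for \<alpha> \<beta> \<gamma>
  have vv: "vv \<alpha> \<beta> \<gamma> $ a = \<alpha>" "vv \<alpha> \<beta> \<gamma> $ b = \<beta>" "vv \<alpha> \<beta> \<gamma> $ c = \<gamma>" "vv \<alpha> \<beta> \<gamma> $ d = 0"
    "i \<notin> {a, b, c} \<Longrightarrow> vv \<alpha> \<beta> \<gamma> $ i = 0" for \<alpha> \<beta> \<gamma> i
    using dist by (auto simp: vv_def axis_def)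
  \<comment> \<open>Avoiding the entry -1 makes \<open>1 + x\<close> full. The product gives (q-1)^2
    vectors, which for q = 3 is only q + 1; the extra vector \<open>vv 0 t 0\<close> pushes the
    count beyond the pencil.\<close>
  define B :: "'a set" where "B = UNIV - {-1}"
  define X where "X = insert (vv 0 t 0) ((\<lambda>(y, z). vv t y z) ` (B \<times> B))"
  have cardB: "card B = CARD('a) - 1" by (simp add: B_def card_Diff_subset)
  have inj: "inj_on (\<lambda>(y, z). vv t y z) (B \<times> B)" using vv by (intro inj_onI) (auto, metis+)
  have "vv 0 t 0 \<notin> (\<lambda>(y, z). vv t y z) ` (B \<times> B)" using t(1) vv(1) by (auto, metis)
  then have cardX: "card X = (CARD('a) - 1) * (CARD('a) - 1) + 1"
    using card_image[OF inj] cardB by (simp add: X_def card_cartesian_product)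
  define Z where "Z x = adjoin (1 + x) ?S" for x
  have Xfull: "full (1 + x)" "1 + x \<notin> ?S" if "x \<in> X" for x
  proof -
    have "\<exists>\<alpha> \<beta> \<gamma>. x = vv \<alpha> \<beta> \<gamma> \<and> \<alpha> \<noteq> -1 \<and> \<beta> \<noteq> -1 \<and> \<gamma> \<noteq> -1 \<and> (\<alpha> = t \<or> \<beta> = t)"
    proof (cases "x = vv 0 t 0")
      case True
      then show ?thesis using t by (intro exI[of _ 0] exI[of _ t]) simp
    next
      case False
      then show ?thesis using that t by (auto simp: X_def B_def)
    qed
    then obtain \<alpha> \<beta> \<gamma> where x: "x = vv \<alpha> \<beta> \<gamma>" "\<alpha> \<noteq> -1" "\<beta> \<noteq> -1" "\<gamma> \<noteq> -1" "\<alpha> = t \<or> \<beta> = t" by blast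
    have "(1 + x) $ i \<noteq> 0" for i
    proof (cases "i \<in> {a, b, c}")
      case True
      then have "x $ i \<noteq> - 1" using x vv(1-3) by auto
      then show ?thesis by (simp add: add_eq_0_iff)
    next
      case False
      then show ?thesis using vv(5)[of i] x by simp
    qed
    then show "full (1 + x)" by (simp add: full_def)
    have "(1 + x) $ a \<noteq> (1 + x) $ d \<or> (1 + x) $ b \<noteq> (1 + x) $ d" using x vv t by auto
    then show "1 + x \<notin> ?S" using not_const_off[of _ J d] abcd by blast
  qed
  have ZN: "Z x \<in> NC k" if "x \<in> X" for x unfolding Z_def
    using NC_full[OF Xfull(1)[OF that] mem_span_insert1] span_insert_Gr[OF NC_Gr[OF S] Xfull(2)[OF that]] Suc_k1 by simp
  let ?P = "{Y \<in> Gr (Suc (k - 1)). lower ?S \<subseteq> Y \<and> Y \<subseteq> W}"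
  have "(\<lambda>x. lower (Z x)) ` X \<subseteq> ?P"
  proof (rule image_subsetI)
    fix x assume x: "x \<in> X"
    have "k - 1 < k" using k2 by simp
    then have "lower (Z x) \<subseteq> W" unfolding Z_def
      by (rule lower_add_point[OF S _ Xfull[OF x] Ws SW all[OF Xfull(1)[OF x]]])
    moreover have "lower ?S \<subseteq> lower (Z x)" unfolding Z_def by (intro lower_mono subset_span_insert)
    ultimately show "lower (Z x) \<in> ?P" using lower_Gr[OF order_refl ZN[OF x]] Suc_k1 by simp
  qed
  moreover have "inj_on (\<lambda>x. lower (Z x)) X"
  proof (rule inj_onI)
    fix x x' assume xx: "x \<in> X" "x' \<in> X" "lower (Z x) = lower (Z x')"
    then have "Z x = Z x'" using lower_eq_iff[OF order_refl ZN ZN] by simp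
    then have "1 + x' \<in> Z x" using mem_span_insert1[of "1 + x'" ?S] by (simp add: Z_def)
    then obtain r s where s: "s \<in> ?S" "1 + x' = r *s (1 + x) + s"
      unfolding Z_def span_insert_iff[OF subspace_const_off] by blast
    then obtain g where g: "\<forall>i. i \<notin> J \<longrightarrow> s $ i = g" by (auto simp: const_off_def)
    have *: "1 + x' $ i = r * (1 + x $ i) + g" if "i \<notin> J" for i
      using arg_cong[OF s(2), of "\<lambda>v. v $ i"] g that by simp
    have "x' $ d = 0" "x $ d = 0" using xx vv by (auto simp: X_def)
    then have "r + g = 1" using *[OF abcd(4)] by simp
    then have g1: "g = 1 - r" by (simp add: eq_diff_eq add.commute)
    have eq: "x' $ i = r * x $ i" if "i \<notin> J" for i
      using *[OF that] by (simp add: g1 algebra_simps)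
    have e: "x' $ a = r * x $ a" "x' $ b = r * x $ b" "x' $ c = r * x $ c" using eq abcd by auto
    consider "x = vv 0 t 0" "x' = vv 0 t 0" | y z where "x = vv 0 t 0" "x' = vv t y z"
      | y z where "x = vv t y z" "x' = vv 0 t 0" | y z y' z' where "x = vv t y z" "x' = vv t y' z'"
      using xx by (auto simp: X_def)
    then show "x = x'"
    proof cases
      case 4
      then have "r = 1" using e(1) vv t by simp
      then show ?thesis using e vv 4 by simp
    qed (use e vv t in auto)
  qed
  ultimately have le: "card X \<le> card ?P" using card_inj_on_le[of _ X ?P] by simp
  have "card ?P * (CARD('a) - 1) = CARD('a) ^ (Suc k - (k - 1)) - 1"
    using card_Gr_between[OF lower_Gr[OF _ S] W SW] by simp
  also have "Suc k - (k - 1) = 2" using k2 by simp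
  finally have "card ?P = (\<Sum>i<2. CARD('a) ^ i)" using geometric_count[OF card_field_ge2] by blast
  then have "card ?P = CARD('a) + 1" by (simp add: numeral_2_eq_2)
  then have "(CARD('a) - 1) * (CARD('a) - 1) \<le> CARD('a)" using le cardX by simp
  moreover have "2 * (CARD('a) - 1) \<le> (CARD('a) - 1) * (CARD('a) - 1)" using q3 by (intro mult_right_mono) auto
  ultimately show False using q3 by linarith
qed

lemma full_points_spread:
  assumes W: "vec.subspace W" "vec.dim W \<le> Suc k"
  shows "\<exists>p. full p \<and> \<not> lower (pt p) \<subseteq> W"
proof -
  obtain W' where W': "W' \<in> Gr (Suc k)" "W \<subseteq> W'"
    using exists_intermediate_subspace[of W UNIV "Suc k"] W UNIV_Gr kn by (auto simp: mem_Gr)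
  then show ?thesis using full_points_spread_aux[OF W'(1)] by blast
qed

end

section \<open>Exchanging a vector, and the images of degenerate points for q >= 3\<close>

lemma exists_hyperplane_through:
  assumes Y: "Y \<in> Gr k" and k: "2 \<le> k" and v: "v \<in> Y"
  shows "\<exists>R\<in>Gr (k - 1). v \<in> R \<and> R \<subseteq> Y"
proof -
  have "pt v \<subseteq> Y" using v Y by (intro vec.span_minimal) (auto simp: mem_Gr)
  moreover have "vec.dim (pt v) \<le> k - 1" using k by (cases "v = 0") auto
  ultimately obtain R where "R \<in> Gr (k - 1)" "pt v \<subseteq> R" "R \<subseteq> Y"
    using exists_intermediate_subspace[OF vec.subspace_span subspace_Gr[OF Y], of "{v}" "k - 1"] dim_Gr[OF Y] k by auto
  then show ?thesis using vec.span_base[of v "{v}"] by blast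
qed

lemma adjacent_exchange:
  assumes Y: "Y \<in> Gr k" and k: "2 \<le> k" and R: "R \<in> Gr (k - 1)" "R \<subseteq> Y" and z: "z \<notin> Y"
  shows "adjoin z R \<in> Gr k" "adjacent k Y (adjoin z R)"
proof -
  have sk: "Suc (k - 1) = k" using k by simp
  have "z \<notin> R" using R(2) z by blast
  then show Z: "adjoin z R \<in> Gr k" using span_insert_Gr[OF R(1)] sk by metis
  have "Y \<noteq> adjoin z R" using z mem_span_insert1 by blast
  then show "adjacent k Y (adjoin z R)"
    using adjacentI_inf(1)[of Y "k - 1" "adjoin z R" R] Y Z R subset_span_insert sk by metis
qed

context star_embedding_large
begin

text \<open>The lines joining a degenerate point to full points are nondegenerate, so their images
  form a clique. Full points are too spread out for a common 3-dimensional subspace, so the images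
  share a point \<open>T\<close>, the candidate for the value.\<close>

lemma lower_point_Gr:
  assumes v: "v \<noteq> 0"
  shows "lower (pt v) \<in> Gr 1"
proof (cases "full v")
  case True
  then show ?thesis using lower_Gr[of 1] full_point_NC k2 by simp
next
  case False
  let ?P = "pt v"
  define L where "L p = adjoin p ?P" for p
  have P: "?P \<in> Gr 1" using point_Gr[OF v] .
  have nP: "p \<notin> ?P" if "full p" for p
    using that False by (auto simp: full_def mem_span_singleton)
  have L: "L p \<in> NC 2" "L p \<in> Gr 2" if "full p" for p
    using NC_full[OF that mem_span_insert1] line_Gr[OF v nP[OF that]] by (auto simp: L_def)
  have LG: "lower (L p) \<in> Gr 2" if "full p" for p using lower_Gr[of 2] L[OF that] k2 by simp
  have pL: "lower (pt p) \<subseteq> lower (L p)" for p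
    unfolding L_def by (intro lower_mono vec.span_mono) auto
  have adj: "adjacent 2 (lower (L p)) (lower (L p'))" if "full p" "full p'" "L p \<noteq> L p'" for p p'
    using lines_meet(1)[OF L(2) L(2) that(3) P] that L k2
    by (intro lower_adjacent) (auto simp: L_def intro: subsetD[OF subset_span_insert])
  obtain p' where p': "full p'" "\<not> lower (pt p') \<subseteq> lower (L 1)"
    using full_points_spread[of "lower (L 1)"] LG[OF full_1] k2 by (auto simp: mem_Gr)
  have ne: "lower (L 1) \<noteq> lower (L p')" using p' pL by blast
  let ?K = "(\<lambda>p. lower (L p)) ` Collect full"
  have "(\<exists>T\<in>Gr 1. \<forall>X\<in>?K. T \<subseteq> X) \<or> (\<exists>W\<in>Gr (Suc (Suc 1)). \<forall>X\<in>?K. X \<subseteq> W)"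
  proof (rule clique_star_or_top[of ?K 1 "lower (L 1)" "lower (L p')"])
    show "?K \<subseteq> Gr (Suc 1)" using LG by (auto simp: numeral_2_eq_2)
    show "adjacent (Suc 1) X Y" if XY: "X \<in> ?K" "Y \<in> ?K" "X \<noteq> Y" for X Y
    proof -
      obtain p p' where "full p" "full p'" "X = lower (L p)" "Y = lower (L p')" using XY(1,2) by blast
      moreover from this have "L p \<noteq> L p'" using XY(3) by metis
      ultimately show ?thesis using adj[of p p'] by (simp add: numeral_2_eq_2)
    qed
    show "lower (L 1) \<in> ?K" "lower (L p') \<in> ?K" using p'(1) full_1 by blast+
  qed (rule ne)
  moreover have False if W: "W \<in> Gr (Suc (Suc 1))" "\<forall>X\<in>?K. X \<subseteq> W" for W
  proof -
    obtain p where "full p" "\<not> lower (pt p) \<subseteq> W"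
      using full_points_spread[of W] W(1) k2 by (auto simp: mem_Gr)
    then show False using W(2) pL[of p] by blast
  qed
  ultimately obtain T where T: "T \<in> Gr 1" "\<And>p. full p \<Longrightarrow> T \<subseteq> lower (L p)" by blast
  have "T \<subseteq> lower ?P"
  \<comment> \<open>A code \<open>Y\<close> with \<open>T\<close> outside \<open>f Y\<close> is
    compared with a neighbour \<open>?Z\<close> through the point and a full \<open>p\<close>. Then
    \<open>f ?Z\<close> is spanned by \<open>f Y \<inter> f ?Z\<close> and \<open>T\<close>, so it
    lies in \<open>?W\<close>, while \<open>p\<close> is chosen with image outside
    \<open>?W\<close>.\<close>
  proof (rule lower_greatest, rule ccontr)
    fix Y assume Y: "Y \<in> NC k" "?P \<subseteq> Y" "\<not> T \<subseteq> f Y"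
    have fY: "f Y \<in> Gr k" using f_Gr Y by blast
    let ?W = "join (f Y) T"
    have "vec.dim ?W \<le> Suc k" using dim_join[of "f Y" T] fY T by (simp add: mem_Gr)
    then obtain p where p: "full p" "\<not> lower (pt p) \<subseteq> ?W" using full_points_spread[of ?W] by auto
    have fYW: "f Y \<subseteq> ?W" using join_upper1 by blast
    have pY: "p \<notin> Y"
    proof
      assume "p \<in> Y"
      then have "pt p \<subseteq> Y" using NC_Gr[OF Y(1)] by (intro vec.span_minimal) (auto simp: mem_Gr)
      then show False using lower_le[OF Y(1)] p(2) fYW by blast
    qed
    have "v \<in> Y" using Y(2) vec.span_base[of v "{v}"] by blast
    then obtain R where R: "R \<in> Gr (k - 1)" "v \<in> R" "R \<subseteq> Y"
      using exists_hyperplane_through[OF NC_Gr[OF Y(1)] k2] by blast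
    then have "?P \<subseteq> R" by (intro vec.span_minimal) (auto simp: mem_Gr)
    note R = R(1) this R(3)
    let ?Z = "adjoin p R"
    note Z = adjacent_exchange[OF NC_Gr[OF Y(1)] k2 R(1,3) pY]
    have ZN: "?Z \<in> NC k" using NC_full[OF p(1) mem_span_insert1 Z(1)] .
    have adjf: "adjacent k (f Y) (f ?Z)" using f_adj[OF Y(1) ZN Z(2)] .
    have "L p \<subseteq> ?Z" unfolding L_def using R by (intro vec.span_minimal) (auto intro: vec.span_base mem_span_insert1)
    then have TZ: "T \<subseteq> f ?Z" using T(2)[OF p(1)] lower_le[OF ZN] by blast
    obtain t where t: "t \<in> T" "t \<notin> f Y" using Y(3) by blast
    have "f Y \<inter> f ?Z \<in> Gr (k - 1)" using Int_Gr_adjacent[of "k - 1"] adjf Suc_k1 by metis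
    then have "adjoin t (f Y \<inter> f ?Z) = f ?Z"
      using f_Gr[OF ZN] t TZ Suc_k1 by (intro span_insert_eq[of _ "k - 1"]) auto
    moreover have "adjoin t (f Y \<inter> f ?Z) \<subseteq> ?W"
      using t join_upper1[of "f Y" T] join_upper2[of T "f Y"] by (intro span_insert_least) auto
    ultimately have "f ?Z \<subseteq> ?W" by simp
    moreover have "pt p \<subseteq> ?Z" by (intro vec.span_mono) auto
    ultimately show False using lower_le[OF ZN] p(2) by blast
  qed
  moreover have "lower ?P \<subseteq> lower (L 1) \<inter> lower (L p')"
    unfolding L_def using lower_mono[OF subset_span_insert] by blast
  moreover have "lower (L 1) \<inter> lower (L p') = T"
    using T p' full_1 LG ne by (intro lines_meet(2)) auto
  ultimately show ?thesis using T(1) by auto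
qed

lemma lower_line_join:
  assumes L: "L \<in> NC 2" "P \<in> Gr 1" "P' \<in> Gr 1" "P \<subseteq> L" "P' \<subseteq> L" "lower P \<noteq> lower P'"
  shows "lower L = join (lower P) (lower P')"
proof -
  have "lower P \<in> Gr 1" "lower P' \<in> Gr 1" using L lower_point_Gr by (metis Gr1_obtain)+
  moreover have "lower L \<in> Gr 2" using lower_Gr[of 2] L k2 by simp
  ultimately show ?thesis using points_join[OF _ _ L(6)] lower_mono L by metis
qed

text \<open>Joining both points to a suitable full \<open>p\<close> gives two lines with the same
  image, hence one line; it contains the line through the two points, so \<open>p\<close> would lie
  on that line.\<close>

lemma lower_point_inj:
  assumes v: "v \<noteq> 0" "v' \<noteq> 0" and eq: "lower (pt v) = lower (pt v')"
  shows "pt v = pt v'"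
proof (rule ccontr)
  assume ne: "pt v \<noteq> pt v'"
  let ?P = "pt v" and ?P' = "pt v'" and ?T = "lower (pt v)"
  have PG: "?P \<in> Gr 1" "?P' \<in> Gr 1" using v point_Gr by blast+
  have v': "v' \<notin> ?P" using Gr1_span[OF PG(1)] v ne by blast
  let ?M = "adjoin v' ?P"
  have M: "?M \<in> Gr 2" using line_Gr[OF v(1) v'] .
  have TG: "?T \<in> Gr 1" using lower_point_Gr[OF v(1)] .
  \<comment> \<open>The choice ensures both that \<open>p\<close> is not on \<open>?M\<close> and
    that \<open>p\<close> is not sent to \<open>?T\<close>.\<close>
  define W where "W = (if ?M \<in> NC 2 then lower ?M else ?T)"
  have "vec.dim W \<le> Suc k" using lower_Gr[of 2 ?M] TG k2 by (auto simp: W_def mem_Gr)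
  moreover have "vec.subspace W" by (simp add: W_def subspace_lower)
  ultimately obtain p where p: "full p" "\<not> lower (pt p) \<subseteq> W" using full_points_spread by blast
  have TW: "?T \<subseteq> W" unfolding W_def using lower_mono[OF subset_span_insert[of ?P v']] by auto
  have pM: "p \<notin> ?M"
  proof
    assume pM: "p \<in> ?M"
    then have "pt p \<subseteq> ?M" by (intro vec.span_minimal) auto
    moreover have "W = lower ?M" using NC_full[OF p(1) pM M] by (simp add: W_def)
    ultimately show False using p(2) lower_mono by blast
  qed
  have neT: "lower (pt p) \<noteq> ?T" using p(2) TW by blast
  have P'M: "?P' \<subseteq> ?M" using mem_span_insert1[of v' ?P] by (intro vec.span_minimal) auto
  have pP: "p \<notin> ?P" "p \<notin> ?P'" using pM subset_span_insert P'M by blast+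
  let ?A = "adjoin p ?P" and ?B = "adjoin p ?P'"
  have AB: "?A \<in> Gr 2" "?B \<in> Gr 2" using line_Gr v pP by blast+
  then have ABN: "?A \<in> NC 2" "?B \<in> NC 2" using NC_full[OF p(1) mem_span_insert1] by blast+
  have pG: "pt p \<in> Gr 1" using point_Gr full_nonzero p by blast
  have sp: "pt p \<subseteq> adjoin p X" for X by (intro vec.span_mono) auto
  have "lower ?A = join (lower (pt p)) (lower ?P)"
    by (rule lower_line_join[OF ABN(1) pG PG(1) sp subset_span_insert neT])
  moreover have "lower ?B = join (lower (pt p)) (lower ?P')"
    by (rule lower_line_join[OF ABN(2) pG PG(2) sp subset_span_insert neT[unfolded eq]])
  ultimately have "?A = ?B" using eq lower_eq_iff[of 2 ?A ?B] ABN k2 by simp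
  moreover have "v' \<in> ?B" using subset_span_insert[of ?P' p] vec.span_base[of v' "{v'}"] by blast
  ultimately have "?M \<subseteq> ?A" by (intro span_insert_least subset_span_insert vec.subspace_span) simp
  then have "?M = ?A" using Gr_eqI M AB by blast
  then show False using pM mem_span_insert1[of p ?P] by simp
qed

text \<open>For k = 2 there is no induced map on 3-dimensional subspaces, so \<open>W\<close> is
  built by hand from the images of \<open>p\<close> and of a nondegenerate line \<open>?L\<close>
  avoiding \<open>p\<close>. Every line of \<open>adjoin p M\<close> through \<open>p\<close> is
  nondegenerate and meets \<open>?L\<close>, so its image lies in \<open>W\<close>.\<close>

lemma degenerate_plane_image:
  assumes M: "M \<in> Gr 2" "\<forall>m\<in>M. m $ i = 0" and q1: "q1 \<in> M" "q1 \<noteq> 0"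
    and p: "full p" "full (p + q1)"
  shows "\<exists>W\<in>Gr 3. \<forall>u\<in>adjoin p M. u \<noteq> 0 \<longrightarrow> lower (pt u) \<subseteq> W"
proof -
  have pi: "p $ i \<noteq> 0" using p by (simp add: full_def)
  have pM: "p \<notin> M" using pi M(2) by blast
  have Ms: "vec.subspace M" using subspace_Gr[OF M(1)] .
  let ?U = "adjoin p M"
  have U: "?U \<in> Gr 3" using plane_Gr[OF M(1) pM] .
  have "\<not> M \<subseteq> pt q1" using M(1) vec.dim_subset[of M "pt q1"] q1(2) by (auto simp: mem_Gr)
  then obtain q2 where q2: "q2 \<in> M" "q2 \<notin> pt q1" by blast
  then have q20: "q2 \<noteq> 0" using vec.span_zero by blast
  have notin: "p + q1 \<notin> pt q2" 
  proof
    assume "p + q1 \<in> pt q2"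
    then have "p + q1 \<in> M" using q2 Ms vec.span_minimal[of "{q2}" M] by blast
    then have "(p + q1) $ i = 0" "q1 $ i = 0" using M(2) q1(1) by blast+
    then show False using pi by simp
  qed
  let ?L = "adjoin (p + q1) (pt q2)"
  have L: "?L \<in> Gr 2" using line_Gr[OF q20 notin] .
  have LN: "?L \<in> NC 2" using NC_full[OF p(2) mem_span_insert1 L] .
  have LG: "lower ?L \<in> Gr 2" using lower_Gr[of 2] LN k2 by simp
  have pL: "p \<notin> ?L"
  proof
    assume "p \<in> ?L"
    then obtain a b where ab: "p = a *s (p + q1) + b *s q2"
      unfolding span_insert_iff[OF vec.subspace_span] using mem_span_singleton by metis
    have "p $ i = a * p $ i" using arg_cong[OF ab, of "\<lambda>v. v $ i"] M(2) q1 q2 by simp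
    then have a1: "a = 1" using pi by simp
    have b0: "b \<noteq> 0"
    proof
      assume "b = 0"
      then show False using ab a1 q1 by simp
    qed
    have "q1 = - (b *s q2)" using ab a1 by (simp add: add_eq_0_iff)
    then have "q2 = (- inverse b) *s q1" using b0 by simp
    then show False using q2(2) mem_span_singleton by blast
  qed
  let ?P = "pt p"
  have P: "?P \<in> Gr 1" "?P \<in> NC 1" using point_Gr full_nonzero full_point_NC p by blast+
  have "\<not> lower ?P \<subseteq> lower ?L"
  proof
    assume "lower ?P \<subseteq> lower ?L"
    then have "?P \<subseteq> ?L" using lower_reflects[of 1 2] P LN k2 by auto
    then show False using pL vec.span_base by blast
  qed
  then obtain w where w: "w \<in> lower ?P" "w \<notin> lower ?L" by blast
  let ?W = "adjoin w (lower ?L)"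
  have W: "?W \<in> Gr 3" using plane_Gr[OF LG w(2)] .
  have w0: "w \<noteq> 0" using w subspace_lower vec.subspace_0 by blast
  have PG: "lower ?P \<in> Gr 1" using lower_point_Gr full_nonzero p by blast
  have PW: "lower ?P \<subseteq> ?W" using Gr1_span[OF PG w(1) w0] vec.span_mono[of "{w}" "insert w (lower ?L)"] by auto
  have LW: "lower ?L \<subseteq> ?W" by (rule subset_span_insert)
  have LU: "?L \<subseteq> ?U"
  proof -
    have "p + q1 \<in> ?U" "q2 \<in> ?U" using q1 q2 by (auto intro: vec.span_add vec.span_base)
    then show ?thesis by (intro span_insert_least vec.span_minimal vec.subspace_span) auto
  qed
  have "lower (pt u) \<subseteq> ?W" if u: "u \<in> ?U" "u \<noteq> 0" for u
  proof -
    obtain a m where am: "m \<in> M" "u = a *s p + m" using u(1) span_insert_iff[OF Ms] by blast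
    show ?thesis
    proof (cases "m = 0")
      case True
      then have "u \<in> ?P" using am mem_span_singleton by auto
      then show ?thesis using Gr1_span[OF P(1) _ u(2)] PW by auto
    next
      case False
      have "p \<notin> pt m" using am(1) Ms pM vec.span_minimal[of "{m}" M] by blast
      let ?H = "adjoin p (pt m)"
      have H: "?H \<in> Gr 2" using line_Gr[OF False \<open>p \<notin> pt m\<close>] .
      have HN: "?H \<in> NC 2" using NC_full[OF p(1) mem_span_insert1 H] .
      have HU: "?H \<subseteq> ?U" using am by (intro span_insert_least vec.span_minimal) (auto intro: vec.span_base)
      have "vec.dim ?L + vec.dim ?H \<le> vec.dim ?U + vec.dim (?L \<inter> ?H)"
        using LU HU by (intro meet_in_hyperplane) auto
      then have "0 < vec.dim (?L \<inter> ?H)" using dim_Gr[OF L] dim_Gr[OF H] dim_Gr[OF U] by linarith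
      then obtain g where g: "g \<in> ?L" "g \<in> ?H" "g \<noteq> 0" using exists_nonzero by blast
      have gP: "pt g \<noteq> ?P" using pL g(1) vec.span_minimal[of "{g}" ?L] vec.span_base[of p "{p}"] by auto
      then have "lower (pt g) \<noteq> lower ?P" using lower_point_inj[OF g(3) full_nonzero[OF p(1)]] by blast
      moreover have "pt g \<subseteq> ?H" using g by (intro vec.span_minimal) auto
      moreover have "?P \<subseteq> ?H" by (intro vec.span_mono) auto
      ultimately have "lower ?H = join (lower (pt g)) (lower ?P)"
        using HN P point_Gr[OF g(3)] by (intro lower_line_join) auto
      moreover have "lower (pt g) \<subseteq> lower ?L" using g by (intro lower_mono vec.span_minimal) auto
      ultimately have "lower ?H \<subseteq> ?W" using PW LW join_least[of ?W "lower (pt g)" "lower ?P"] by auto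
      moreover have "u \<in> ?H" unfolding am(2) 
        by (intro vec.span_add vec.span_scale) (auto intro: vec.span_base)
      then have "lower (pt u) \<subseteq> lower ?H" by (intro lower_mono vec.span_minimal) auto
      ultimately show ?thesis by blast
    qed
  qed
  then show ?thesis using W by blast
qed

lemma exists_axis_notin:
  assumes M: "(M :: ('a^'n) set) \<in> Gr 2"
  shows "\<exists>m. m \<noteq> i \<and> axis m 1 \<notin> M"
proof (rule ccontr)
  assume "\<not> ?thesis"
  then have ax: "axis m 1 \<in> M" if "m \<noteq> i" for m using that by blast
  let ?d = "UNIV - {i}"
  have "{x. \<forall>j. j \<notin> ?d \<longrightarrow> x $ j = 0} \<subseteq> M"
  proof
    fix x :: "'a^'n" assume x: "x \<in> {x. \<forall>j. j \<notin> ?d \<longrightarrow> x $ j = 0}"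
    have "x $ j *s axis j 1 \<in> M" for j
      using ax[of j] x M vec.subspace_scale[of M] vec.subspace_0[of M] by (cases "j = i") (auto simp: mem_Gr)
    then have "(\<Sum>j\<in>UNIV. x $ j *s axis j 1) \<in> M" using M by (intro vec.subspace_sum) (auto simp: mem_Gr)
    then show "x \<in> M" by (simp add: basis_expansion)
  qed
  then have "vec.dim {x :: 'a^'n. \<forall>j. j \<notin> ?d \<longrightarrow> x $ j = 0} \<le> vec.dim M" by (rule vec.dim_subset)
  then have "card ?d \<le> 2" by (simp only: dim_substandard_cart dim_Gr[OF M])
  then show False using kn k2 by (simp add: card_Diff_subset)
qed

lemma exists_zero_coordinate:
  assumes M: "(M :: ('a^'n) set) \<in> Gr 2"
  shows "\<exists>u\<in>M. u \<noteq> 0 \<and> u $ m = 0"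
proof -
  have Ms: "vec.subspace M" using subspace_Gr[OF M] .
  obtain w where w: "w \<in> M" "w \<noteq> 0" using exists_nonzero[of M] M by (auto simp: mem_Gr)
  have "\<not> M \<subseteq> pt w" using M vec.dim_subset[of M "pt w"] w by (auto simp: mem_Gr)
  then obtain w' where w': "w' \<in> M" "w' \<notin> pt w" by blast
  show ?thesis
  proof (cases "w $ m = 0")
    case False
    let ?u = "w' - (w' $ m / w $ m) *s w"
    have "?u \<noteq> 0" using w'(2) mem_span_singleton[of w' w] by auto
    moreover have "?u \<in> M" using w w' Ms by (intro vec.subspace_diff vec.subspace_scale)
    ultimately show ?thesis using False by (intro bexI[of _ ?u]) auto
  qed (use w in blast)
qed

text \<open>Only a degenerate \<open>?M\<close> needs work. If the three images spanned a
  3-dimensional \<open>?W\<close>, then both \<open>adjoin p ?M\<close> and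
  \<open>adjoin ?p' ?M\<close> would be sent into \<open>?W\<close>. By counting, the points of the
  first already fill \<open>?W\<close>, so injectivity puts \<open>?p'\<close> into the first as
  well.\<close>

lemma lower_points_collinear:
  assumes y: "y \<noteq> 0" and x: "x \<notin> pt y" and z: "z \<in> adjoin x (pt y)" "z \<noteq> 0"
  shows "lower (pt z) \<subseteq> join (lower (pt x)) (lower (pt y))"
proof -
  let ?M = "adjoin x (pt y)"
  let ?A = "lower (pt x)" and ?B = "lower (pt y)" and ?C = "lower (pt z)"
  have M: "?M \<in> Gr 2" using line_Gr[OF y x] .
  have x0: "x \<noteq> 0" using x vec.span_zero by blast
  have ABC: "?A \<in> Gr 1" "?B \<in> Gr 1" "?C \<in> Gr 1" using lower_point_Gr x0 y z by blast+
  have "pt x \<noteq> pt y" using x vec.span_base[of x "{x}"] by auto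
  then have ne: "?A \<noteq> ?B" using lower_point_inj x0 y by blast
  have xyM: "pt x \<subseteq> ?M" "pt y \<subseteq> ?M" "pt z \<subseteq> ?M"
    by (rule vec.span_mono, simp) (rule subset_span_insert, rule vec.span_minimal, use z in simp_all)
  show ?thesis
  proof (cases "?M \<in> NC 2")
    case True
    then show ?thesis using lower_line_join[OF True point_Gr[OF x0] point_Gr[OF y] xyM(1,2) ne] lower_mono[OF xyM(3)] by simp
  next
    case False
    then obtain i where i: "\<forall>m\<in>?M. m $ i = 0" using M by (auto simp: mem_NC)
    show ?thesis
    proof (rule ccontr)
      assume nsub: "\<not> ?thesis"
      \<comment> \<open>The vectors \<open>p\<close> and \<open>?p'\<close> will differ by a
        multiple of \<open>axis m 1\<close>, which is outside \<open>?M\<close>. The condition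
        \<open>m \<noteq> i\<close> leaves coordinate \<open>i\<close> unchanged, and
        \<open>q1 $ m = 0\<close> keeps \<open>?p' + q1\<close> full.\<close>
      obtain m where m: "m \<noteq> i" "axis m 1 \<notin> ?M" using exists_axis_notin[OF M] by blast
      obtain q1 where q1: "q1 \<in> ?M" "q1 \<noteq> 0" "q1 $ m = 0" using exists_zero_coordinate[OF M] by blast
      define p :: "'a^'n" where "p = (\<chi> j. SOME c. c \<noteq> 0 \<and> c \<noteq> - q1 $ j)"
      have p: "p $ j \<noteq> 0" "p $ j \<noteq> - q1 $ j" for j
        using someI_ex[OF exists_avoiding2[OF q3, of 0 "- q1 $ j"]] by (auto simp: p_def)
      have fp: "full p" "full (p + q1)" using p by (auto simp: full_def add_eq_0_iff2)
      obtain c where c: "c \<noteq> 0" "c \<noteq> - p $ m" using exists_avoiding2[OF q3] by metis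
      let ?p' = "p + axis m c"
      have "p $ m + c \<noteq> 0" using c by (auto simp: add_eq_0_iff)
      then have fp': "full ?p'" "full (?p' + q1)" using fp q1 by (auto simp: full_def axis_def)
      obtain W1 where W1: "W1 \<in> Gr 3" "\<forall>u\<in>adjoin p ?M. u \<noteq> 0 \<longrightarrow> lower (pt u) \<subseteq> W1"
        using degenerate_plane_image[OF M i q1(1,2) fp] by blast
      obtain W2 where W2: "W2 \<in> Gr 3" "\<forall>u\<in>adjoin ?p' ?M. u \<noteq> 0 \<longrightarrow> lower (pt u) \<subseteq> W2"
        using degenerate_plane_image[OF M i q1(1,2) fp'] by blast
      have AB: "join ?A ?B \<in> Gr 2"
      proof -
        have "?A \<inter> ?B \<subseteq> {0}"
        proof (rule subsetI, rule ccontr)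
          fix u assume "u \<in> ?A \<inter> ?B" "u \<notin> {0}"
          then show False using ne Gr1_span[OF ABC(1), of u] Gr1_span[OF ABC(2), of u] by simp
        qed
        then have "vec.dim (?A \<inter> ?B) = 0" by (simp only: vec.dim_eq_0)
        then have "vec.dim (join ?A ?B) = 2"
          using dim_join[OF subspace_lower subspace_lower, of "pt x" "pt y"] dim_Gr[OF ABC(1)] dim_Gr[OF ABC(2)]
          by linarith
        then show ?thesis by (simp only: mem_Gr vec.subspace_span)
      qed
      obtain t where t: "t \<in> ?C" "t \<notin> join ?A ?B" using nsub by blast
      let ?W = "adjoin t (join ?A ?B)"
      have W: "?W \<in> Gr 3" using plane_Gr[OF AB t(2)] .
      have eqW: "?W = V" if V: "V \<in> Gr 3" "\<forall>u\<in>adjoin p0 ?M. u \<noteq> 0 \<longrightarrow> lower (pt u) \<subseteq> V" for V p0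
      proof (rule Gr_eqI[OF W V(1)])
        have "x \<in> adjoin p0 ?M" "y \<in> adjoin p0 ?M" "z \<in> adjoin p0 ?M"
          using xyM vec.span_base subset_span_insert[of ?M p0] by blast+
        then have "?A \<subseteq> V" "?B \<subseteq> V" "?C \<subseteq> V" using V(2) x0 y z by blast+
        then show "?W \<subseteq> V" using V(1) t by (intro span_insert_least join_least) (auto simp: mem_Gr)
      qed
      have W12: "W1 = ?W" "W2 = ?W" using eqW W1 W2 by blast+
      let ?U = "adjoin p ?M"
      have pM: "p \<notin> ?M" using i p by blast
      have U: "?U \<in> Gr 3" using plane_Gr[OF M pM] .
      have Z0: "{0 :: 'a^'n} \<in> Gr 0" by (simp add: mem_Gr)
      let ?PU = "{Y \<in> Gr (Suc 0). {0} \<subseteq> Y \<and> Y \<subseteq> ?U}" and ?PW = "{Y \<in> Gr (Suc 0). {0} \<subseteq> Y \<and> Y \<subseteq> ?W}"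
      have z: "{0} \<subseteq> vec.span X" for X :: "('a^'n) set" using vec.span_zero by blast
      have "card ?PU = card ?PW"
        by (rule trans[OF geometric_count[OF card_field_ge2 card_Gr_between[OF Z0 U z]]
          geometric_count[OF card_field_ge2 card_Gr_between[OF Z0 W z], symmetric]])
      moreover have injP: "inj_on lower (Gr 1)"
        by (rule inj_onI) (metis Gr1_obtain lower_point_inj)
      then have "inj_on lower ?PU" by (rule inj_on_subset) auto
      moreover have "lower ` ?PU \<subseteq> ?PW"
      proof (rule image_subsetI)
        fix Q assume Q: "Q \<in> ?PU"
        then obtain u where u: "u \<noteq> 0" "Q = pt u" using Gr1_obtain[of Q] by auto
        then have "u \<in> ?U" using Q vec.span_base[of u "{u}"] by auto
        then have "lower Q \<subseteq> ?W" using W1 W12 u by blast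
        then show "lower Q \<in> ?PW" using lower_point_Gr[OF u(1)] u subspace_lower[of Q] vec.subspace_0 by auto
      qed
      ultimately have onto: "lower ` ?PU = ?PW" by (intro card_subset_eq) (auto simp: card_image)
      have "lower (pt ?p') \<subseteq> W2"
        using W2(2) full_nonzero[OF fp'(1)] mem_span_insert1[of ?p' ?M] by blast
      then have "lower (pt ?p') \<in> ?PW"
        using W12(2) lower_point_Gr[OF full_nonzero[OF fp'(1)]] vec.subspace_0[OF subspace_lower] by simp
      then have "lower (pt ?p') \<in> lower ` ?PU" unfolding onto .
      then obtain Q where Q: "lower (pt ?p') = lower Q" "Q \<in> ?PU" by (rule imageE)
      then have "pt ?p' = Q" using inj_onD[OF injP Q(1) point_Gr[OF full_nonzero[OF fp'(1)]]] by simp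
      then have "?p' \<in> ?U" using Q(2) vec.span_base[of ?p' "{?p'}"] by blast
      then have "\<exists>a. \<exists>h\<in>?M. ?p' = a *s p + h" by (rule iffD1[OF span_insert_iff[OF vec.subspace_span]])
      then obtain a h where ah: "h \<in> ?M" "?p' = a *s p + h" by (elim exE bexE)
      have "p $ i = a * p $ i" using arg_cong[OF ah(2), of "\<lambda>v. v $ i"] i ah(1) m by (simp add: axis_def)
      then have "a = 1" using p by simp
      then have "axis m c = h" using ah(2) by simp
      then have "inverse c *s axis m c \<in> ?M" using ah(1) vec.span_scale by blast
      moreover have "inverse c *s axis m c = axis m 1" using c by (simp add: vec_eq_iff axis_def)
      ultimately show False using m by simp
    qed
  qed
qed

section \<open>From the map on points to a map on vectors\<close>

definition rep :: "('a ^ 'n) set \<Rightarrow> 'a ^ 'n" where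
  "rep P = (SOME v. v \<in> P \<and> v \<noteq> 0)"

definition coef :: "'a ^ 'n \<Rightarrow> 'a" where
  "coef x = (SOME c. x = c *s rep (pt x))"

text \<open>One vector is chosen on each point, and the coefficient with respect to it is copied to
  the image point. This makes the map homogeneous; additivity is not arranged, only collinearity of
  the images.\<close>

definition coll :: "'a ^ 'n \<Rightarrow> 'a ^ 'n" where
  "coll x = (if x = 0 then 0 else coef x *s rep (lower (pt x)))"

lemma rep: "P \<in> Gr 1 \<Longrightarrow> rep P \<in> P \<and> rep P \<noteq> 0"
proof -
  assume "P \<in> Gr 1"
  then have "\<exists>v. v \<in> P \<and> v \<noteq> 0" using exists_nonzero[of P] by (auto simp: mem_Gr)
  then show ?thesis unfolding rep_def by (rule someI_ex)
qed

lemma coef: "x \<noteq> 0 \<Longrightarrow> x = coef x *s rep (pt x)"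
proof -
  assume x: "x \<noteq> 0"
  then have "vec.span {rep (pt x)} = pt x"
    using rep[OF point_Gr] Gr1_span[OF point_Gr] by blast
  then have "x \<in> vec.span {rep (pt x)}" using vec.span_base by blast
  then show ?thesis unfolding coef_def mem_span_singleton by (rule someI_ex)
qed

lemma coef_nonzero: "x \<noteq> 0 \<Longrightarrow> coef x \<noteq> 0"
proof
  assume "x \<noteq> 0" "coef x = 0"
  then show False using coef[of x] by simp
qed

lemma coll_nonzero: "x \<noteq> 0 \<Longrightarrow> coll x \<noteq> 0"
  using coef_nonzero[of x] rep[OF lower_point_Gr, of x] by (simp add: coll_def)

lemma coll_mem: "x \<noteq> 0 \<Longrightarrow> coll x \<in> lower (pt x)"
  using rep[OF lower_point_Gr] subspace_lower by (simp add: coll_def vec.subspace_scale)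

lemma coll_scale: "coll (c *s x) = c *s coll x"
proof (cases "c = 0 \<or> x = 0")
  case False
  then have sp: "pt (c *s x) = pt x"
    by (intro Gr1_span point_Gr) (auto simp: mem_span_singleton)
  moreover have "coef (c *s x) *s rep (pt x) = (c * coef x) *s rep (pt x)"
  proof -
    have "coef (c *s x) *s rep (pt (c *s x)) = c *s x" using coef[of "c *s x"] False by simp
    also have "\<dots> = c *s (coef x *s rep (pt x))" using coef[of x] False by simp
    finally show ?thesis using sp by simp
  qed
  then have "coef (c *s x) = c * coef x" using rep[OF point_Gr] False by simp
  ultimately show ?thesis using False by (simp add: coll_def)
qed (auto simp: coll_def)

lemma coll_inj: "inj coll"
proof (rule injI)
  fix x y assume eq: "coll x = coll y"
  show "x = y"
  proof (cases "x = 0 \<or> y = 0")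
    case True
    then show ?thesis using eq coll_nonzero by (metis coll_def)
  next
    case False
    have "lower (pt x) = pt (coll x)" "lower (pt y) = pt (coll y)"
      using False Gr1_span[OF lower_point_Gr coll_mem coll_nonzero] by simp_all
    then have sp: "pt x = pt y" using False eq lower_point_inj by simp
    have "coef x = coef y" using eq False sp rep[OF lower_point_Gr] by (simp add: coll_def)
    then show ?thesis using coef[of x] coef[of y] False sp by simp
  qed
qed

lemma coll_collinear: "coll (x + y) \<in> vec.span {coll x, coll y}"
proof (cases "x \<in> pt y")
  case True
  then obtain c where "x = c *s y" using mem_span_singleton by blast
  then have "x + y = (c + 1) *s y" by (simp add: vec.scale_left_distrib)
  then have "coll (x + y) = (c + 1) *s coll y" using coll_scale by simp
  then show ?thesis by (simp add: vec.span_base vec.span_scale)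
next
  case False
  show ?thesis
  proof (cases "y = 0")
    case True
    then show ?thesis by (simp add: vec.span_base)
  next
    case y: False
    have x: "x \<noteq> 0" using False vec.span_zero by blast
    have s: "x + y \<noteq> 0"
    proof
      assume "x + y = 0"
      then have "x = (-1) *s y" by (simp add: eq_neg_iff_add_eq_0)
      then show False using False mem_span_singleton by blast
    qed
    have "x + y \<in> adjoin x (pt y)"
      by (intro vec.span_add) (auto intro: vec.span_base)
    then have "lower (pt (x + y)) \<subseteq> join (lower (pt x)) (lower (pt y))"
      using lower_points_collinear y False s by blast
    moreover have "lower (pt x) = pt (coll x)" "lower (pt y) = pt (coll y)"
      using x y Gr1_span[OF lower_point_Gr coll_mem coll_nonzero] by simp_all
    moreover have "join (pt (coll x)) (pt (coll y)) \<subseteq> vec.span {coll x, coll y}"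
      by (intro join_least vec.subspace_span vec.span_mono) auto
    ultimately show ?thesis using coll_mem[OF s] by auto
  qed
qed

lemma coll_extends:
  assumes Y: "Y \<in> NC k"
  shows "f Y = coll ` Y"
proof (rule card_subset_eq[symmetric])
  show "coll ` Y \<subseteq> f Y"
  proof (rule image_subsetI)
    fix x assume x: "x \<in> Y"
    show "coll x \<in> f Y"
    proof (cases "x = 0")
      case True
      then show ?thesis using f_Gr[OF Y] vec.subspace_0 by (auto simp: coll_def mem_Gr)
    next
      case False
      have "pt x \<subseteq> Y" using x NC_Gr[OF Y] by (intro vec.span_minimal) (auto simp: mem_Gr)
      then show ?thesis using lower_le[OF Y] coll_mem[OF False] by blast
    qed
  qed
  show "card (coll ` Y) = card (f Y)"
    using card_subspace[of Y] card_subspace[of "f Y"] f_Gr[OF Y] NC_Gr[OF Y] card_image[OF inj_on_subset[OF coll_inj subset_UNIV], of Y]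
    by (simp add: mem_Gr)
qed simp

end

section \<open>The two-element field\<close>

lemma binary_cases:
  assumes "CARD('a::{field,finite}) = 2" shows "(a :: 'a) = 0 \<or> a = 1"
proof -
  have "{0, 1 :: 'a} = UNIV" using assms by (intro card_subset_eq) auto
  then show ?thesis by blast
qed

lemma binary_two:
  assumes "CARD('a::{field,finite}) = 2" shows "(2 :: 'a) = 0"
proof -
  have "(1 :: 'a) + 1 \<noteq> 1" by (metis add_cancel_right_right zero_neq_one)
  then show ?thesis using binary_cases[OF assms, of "1 + 1"] by simp
qed

locale star_embedding_binary = star_embedding f k
  for f :: "('a::{field,finite} ^ 'n::finite) set \<Rightarrow> ('a ^ 'n) set" and k :: nat +
  assumes q2: "CARD('a) = 2" and k3: "3 \<le> k"
begin

lemmas field_cases = binary_cases[OF q2]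
lemmas two_zero [simp] = binary_two[OF q2]

lemma field_neq_0: "(a :: 'a) \<noteq> 0 \<longleftrightarrow> a = 1"
  using field_cases[of a] by auto

lemma field_add_self: "(a :: 'a) + a = 0"
  using field_cases[of a] by auto

lemma vec_add_self [simp]: "(x :: 'a^'n) + x = 0"
  by (simp add: vec_eq_iff field_add_self)

lemma two_vec_zero [simp]: "(2 :: 'a^'n) = 0"
proof -
  have "(2 :: 'a^'n) = 1 + 1" by (rule one_add_one[symmetric])
  then show ?thesis using vec_add_self[of 1] by (rule trans)
qed

lemma vec_add_self_left [simp]: "(x :: 'a^'n) + (x + y) = y"
  by (metis add.assoc add_0 vec_add_self)

lemma vec_add_eq_iff: "(x :: 'a^'n) + y = z \<longleftrightarrow> x = y + z"
  by (metis add.commute vec_add_self_left)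

lemma scale_cases: "c *s (x :: 'a^'n) = 0 \<or> c *s x = x"
  using field_cases[of c] by auto

lemma full_eq_1: "full (x :: 'a^'n) \<Longrightarrow> x = 1"
  by (auto simp: full_def vec_eq_iff field_neq_0)

definition line :: "'a ^ 'n \<Rightarrow> 'a ^ 'n \<Rightarrow> ('a ^ 'n) set" where
  "line x y = adjoin y (pt x)"

lemma mem_point: "z \<in> vec.span {x :: 'a^'n} \<longleftrightarrow> z = 0 \<or> z = x"
proof
  show "z \<in> pt x \<Longrightarrow> z = 0 \<or> z = x" using mem_span_singleton scale_cases by metis
qed (auto simp: vec.span_zero vec.span_base)

lemma mem_span_insert2: "vec.subspace X \<Longrightarrow> z \<in> adjoin x X \<longleftrightarrow> z \<in> X \<or> x + z \<in> (X :: ('a^'n) set)"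
proof
  assume X: "vec.subspace X"
  { assume "z \<in> adjoin x X"
    then obtain c y where cy: "y \<in> X" "z = c *s x + y" using span_insert_iff[OF X] by blast
    then show "z \<in> X \<or> x + z \<in> X" using field_cases[of c] by auto }
  assume "z \<in> X \<or> x + z \<in> X"
  then show "z \<in> adjoin x X"
  proof
    assume "x + z \<in> X"
    then have "x + z \<in> adjoin x X" by (intro vec.span_base) simp
    then have "x + (x + z) \<in> adjoin x X" by (rule vec.span_add[OF mem_span_insert1])
    then show ?thesis by (simp only: vec_add_self_left)
  qed (auto intro: vec.span_base)
qed

lemma mem_line: "z \<in> line x y \<longleftrightarrow> z = 0 \<or> z = x \<or> z = y \<or> z = x + y"
  unfolding line_def mem_span_insert2[OF vec.subspace_span] mem_point
  by (auto simp: vec_add_eq_iff add.commute)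

lemma line_commute: "line y x = line x y"
  by (auto simp: mem_line add.commute)

lemma line_add: "line (x + y) y = line x y"
  by (auto simp: mem_line add.commute add.left_commute add.assoc)

lemma subspace_line: "vec.subspace (line x y)"
  by (simp add: line_def)

lemma line_subset: "vec.subspace Z \<Longrightarrow> x \<in> Z \<Longrightarrow> y \<in> Z \<Longrightarrow> line x y \<subseteq> Z"
  unfolding line_def by (intro span_insert_least vec.span_minimal) auto

lemma line_Gr2: "x \<noteq> 0 \<Longrightarrow> y \<noteq> 0 \<Longrightarrow> x \<noteq> y \<Longrightarrow> line x y \<in> Gr 2"
  unfolding line_def by (intro line_Gr) (auto simp: mem_point)

lemma Gr2_eq_line:
  assumes "L \<in> Gr 2" "x \<in> L" "y \<in> L" "x \<noteq> 0" "y \<noteq> 0" "x \<noteq> y"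
  shows "L = line x y"
proof (rule Gr_eqI[OF line_Gr2 assms(1), symmetric])
  show "line x y \<subseteq> L" using assms vec.subspace_add[of L] vec.subspace_0[of L]
    by (auto simp: mem_line mem_Gr)
qed (use assms in auto)

section \<open>Nondegenerate lines over the two-element field\<close>

definition cov :: "'a ^ 'n \<Rightarrow> 'a ^ 'n \<Rightarrow> bool" where
  "cov x y \<longleftrightarrow> (\<forall>i. x $ i \<noteq> 0 \<or> y $ i \<noteq> 0)"

lemma cov_NC: "cov x y \<Longrightarrow> x \<in> Y \<Longrightarrow> y \<in> Y \<Longrightarrow> Y \<in> Gr j \<Longrightarrow> Y \<in> NC j"
  unfolding cov_def mem_NC by blast

lemma one_NC: "1 \<in> Y \<Longrightarrow> Y \<in> Gr j \<Longrightarrow> (Y :: ('a^'n) set) \<in> NC j"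
  by (rule NC_full[OF full_1])

lemma one_neq_0: "(1 :: 'a^'n) \<noteq> 0"
  by (simp add: vec_eq_iff)

lemma point1_NC: "vec.span {1 :: 'a^'n} \<in> NC 1"
  using one_NC[OF _ point_Gr[OF one_neq_0]] by (simp add: vec.span_base)

definition eps :: "'a ^ 'n" where
  "eps = (SOME v. v \<in> lower (pt 1) \<and> v \<noteq> 0)"

lemma eps: "eps \<in> lower (pt 1)" "eps \<noteq> 0"
proof -
  have "lower (pt 1) \<in> Gr 1" using lower_Gr[of 1, OF _ point1_NC] k2 by simp
  then have "\<exists>v. v \<in> lower (pt 1) \<and> v \<noteq> 0"
    using exists_nonzero[of "lower (pt 1)"] by (auto simp: mem_Gr)
  then have "eps \<in> lower (pt 1) \<and> eps \<noteq> 0" unfolding eps_def by (rule someI_ex)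
  then show "eps \<in> lower (pt 1)" "eps \<noteq> 0" by auto
qed

lemma lower_point1: "lower (pt 1) = pt eps"
  using Gr1_span[OF _ eps] lower_Gr[of 1, OF _ point1_NC] k2 by simp

lemma eps_mem: "1 \<in> Y \<Longrightarrow> vec.subspace Y \<Longrightarrow> eps \<in> lower Y"
  using eps(1) lower_mono[of "pt 1" Y] vec.span_minimal[of "{1}" Y] by blast

lemma eps_not_mem:
  assumes "Y \<in> NC j" "1 \<le> j" "j \<le> k" "1 \<notin> Y"
  shows "eps \<notin> lower Y"
proof
  assume "eps \<in> lower Y"
  then have "lower (pt 1) \<subseteq> lower Y"
    unfolding lower_point1 by (intro vec.span_minimal subspace_lower) auto
  then have "pt 1 \<subseteq> Y" using lower_reflects[of 1 j] point1_NC assms by blast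
  then show False using assms vec.span_base by blast
qed

text \<open>Encodes that the line through \<open>r\<close> and \<open>y\<close> is nondegenerate and
  avoids \<open>1\<close>.\<close>

definition good :: "'a ^ 'n \<Rightarrow> 'a ^ 'n \<Rightarrow> bool" where
  "good r y \<longleftrightarrow> cov r y \<and> r \<noteq> 1 \<and> y \<noteq> 1 \<and> y \<noteq> r + 1"

text \<open>These are the vectors that lie on a nondegenerate line avoiding \<open>1\<close>, by
  \<open>good_multi\<close> and \<open>multi_good\<close>. A vector of weight one is covered only
  together with \<open>1\<close> or its own complement, and both lines contain
  \<open>1\<close>.\<close>

definition multi :: "'a ^ 'n \<Rightarrow> bool" where
  "multi r \<longleftrightarrow> r \<noteq> 0 \<and> r \<noteq> 1 \<and> (\<forall>i. r \<noteq> axis i 1)"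

lemma good_neq: assumes "good r y" shows "r \<noteq> 0" "y \<noteq> 0" "r \<noteq> y"
  using assms full_eq_1[of y] full_eq_1[of r] by (auto simp: good_def cov_def full_def)

lemma good_commute: "good r y \<Longrightarrow> good y r"
  by (auto simp: good_def cov_def vec_add_eq_iff add.commute)

lemma good_add: "good x y \<Longrightarrow> good (x + y) x"
  using vec_add_eq_iff[of x y 1] vec_add_eq_iff[of x y "x + 1"]
  by (auto simp: good_def cov_def add.commute)

lemma good_line: assumes "good r y" shows "line r y \<in> NC 2" "1 \<notin> line r y"
proof -
  show "line r y \<in> NC 2" using assms good_neq[OF assms] line_Gr2
    by (intro cov_NC[of r y]) (auto simp: good_def mem_line)
  have "1 \<noteq> r + y"
  proof
    assume "1 = r + y"
    then have "y = r + 1" using vec_add_self_left[of r y] by simp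
    then show False using assms by (simp add: good_def)
  qed
  then show "1 \<notin> line r y" using assms one_neq_0 unfolding good_def mem_line by auto
qed

lemma one_line: "r \<noteq> 0 \<Longrightarrow> r \<noteq> 1 \<Longrightarrow> line r 1 \<in> NC 2"
  using line_Gr2 one_neq_0 by (intro one_NC) (auto simp: mem_line)

lemma good_multi: assumes "good r y" shows "multi r"
proof -
  have "r \<noteq> axis i 1" for i
  proof
    assume r: "r = axis i 1"
    then have y: "y $ j = 1" if "j \<noteq> i" for j
    proof -
      have "r $ j = 0" using r that by (simp add: axis_def)
      moreover have "r $ j \<noteq> 0 \<or> y $ j \<noteq> 0" using assms by (simp add: good_def cov_def)
      ultimately show ?thesis using field_neq_0 by auto
    qed
    have "y $ j = (if y $ i = 1 then 1 else 1 + axis i 1) $ j" for j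
      using y[of j] field_cases[of "y $ i"] by (cases "j = i") (auto simp: axis_def)
    then have "y = 1 \<or> y = 1 + axis i 1" unfolding vec_eq_iff by (cases "y $ i = 1") auto
    then show False using assms r by (auto simp: good_def add.commute)
  qed
  then show ?thesis using assms good_neq(1)[OF assms] by (simp add: good_def multi_def)
qed

lemma multi_good: assumes "multi r" "r $ i \<noteq> 0" shows "good r (1 + axis i 1)"
proof -
  have "(axis i 1 :: 'a^'n) \<noteq> 0" by simp
  then show ?thesis using assms by (auto simp: good_def multi_def cov_def axis_def add.commute)
qed

definition is_image :: "'a ^ 'n \<Rightarrow> 'a ^ 'n \<Rightarrow> bool" where
  "is_image r t \<longleftrightarrow> t \<noteq> 0 \<and> t \<noteq> eps \<and> t \<in> lower (line r 1) \<and> (\<forall>y. good r y \<longrightarrow> t \<in> lower (line r y))"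

lemma lower_Gr2: "L \<in> NC 2 \<Longrightarrow> lower L \<in> Gr 2" using lower_Gr[of 2] k2 by simp
lemma lower_Gr3: "L \<in> NC 3 \<Longrightarrow> lower L \<in> Gr 3" using lower_Gr[of 3] k3 by simp

lemma lines_through:
  assumes "L \<in> NC 2" "L' \<in> NC 2" "L \<noteq> L'" "r \<in> L" "r \<in> L'" "r \<noteq> 0"
  shows "lower L \<inter> lower L' \<in> Gr 1"
proof -
  have "pt r \<subseteq> L" "pt r \<subseteq> L'"
    using vec.span_minimal[of "{r}"] subspace_Gr[OF NC_Gr[OF assms(1)]] subspace_Gr[OF NC_Gr[OF assms(2)]] assms
    by simp_all
  then have "adjacent 2 L L'" using lines_meet(1)[OF NC_Gr NC_Gr] assms point_Gr by blast
  then have "adjacent 2 (lower L) (lower L')" using lower_adjacent[of 2] assms k2 by simp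
  then show ?thesis using Int_Gr_adjacent[of 1] by (simp add: numeral_2_eq_2)
qed

text \<open>The candidate is where the images of \<open>line r y\<close> and \<open>line r 1\<close>
  meet. Another line \<open>?L'\<close> spans with \<open>1\<close> a different 3-dimensional
  subspace; the two subspaces share \<open>line r 1\<close>, so the images of \<open>?L\<close> and
  \<open>?L'\<close> meet on \<open>lower (line r 1)\<close>, in the same point. Using level 3 is
  what requires k >= 3.\<close>

lemma is_image_exists:
  assumes "multi r" shows "\<exists>t. is_image r t"
proof -
  have r: "r \<noteq> 0" "r \<noteq> 1" using assms by (auto simp: multi_def)
  then obtain i0 where "r $ i0 \<noteq> 0" by (auto simp: vec_eq_iff)
  then obtain y where y: "good r y" using multi_good assms by blast
  let ?L = "line r y" and ?E = "line r 1"
  have E: "?E \<in> NC 2" using one_line r by blast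
  note L = good_line[OF y]
  have "1 \<in> ?E" by (simp add: mem_line)
  then have LE: "?L \<noteq> ?E" using L(2) by metis
  have int: "lower ?L \<inter> lower ?E \<in> Gr 1"
    using lines_through[OF L(1) E LE] r by (auto simp: mem_line)
  then obtain t where t: "t \<noteq> 0" "lower ?L \<inter> lower ?E = pt t" by (rule Gr1_obtain)
  have tLE: "t \<in> lower ?L" "t \<in> lower ?E" using t vec.span_base[of t "{t}"] by auto
  have teps: "t \<noteq> eps" using tLE eps_not_mem[OF L(1) _ _ L(2)] k2 by auto
  have "t \<in> lower (line r y')" if y': "good r y'" for y'
  proof (cases "line r y' = ?L")
    case False
    let ?L' = "line r y'"
    note L' = good_line[OF y']
    let ?U = "adjoin 1 ?L" and ?U' = "adjoin 1 ?L'"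
    have UG: "?U \<in> Gr 3" "?U' \<in> Gr 3" using plane_Gr NC_Gr L L' by blast+
    then have U: "?U \<in> NC 3" "?U' \<in> NC 3" using one_NC[OF mem_span_insert1] by blast+
    have EU: "?E \<subseteq> ?U" "?E \<subseteq> ?U'"
      by (intro line_subset; auto intro: vec.span_base simp: mem_line)+
    have "?U \<noteq> ?U'"
    proof
      assume "?U = ?U'"
      then have "y' \<in> ?U" using subset_span_insert[of ?L' 1] by (auto simp: mem_line)
      then have yL: "y' \<in> ?L \<or> 1 + y' \<in> ?L" using mem_span_insert2[OF subspace_line] by blast
      have "y' \<notin> ?L"
      proof
        assume "y' \<in> ?L"
        then have "?L' = ?L" using Gr2_eq_line[of ?L r y'] good_neq[OF y'] NC_Gr[OF L(1)] by (auto simp: mem_line)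
        then show False using False by blast
      qed
      moreover have "1 + y' \<noteq> 0" "1 + y' \<noteq> r" using y' by (auto simp: good_def vec_add_eq_iff add.commute)
      ultimately have yy: "1 + y' = y \<or> 1 + y' = r + y" using yL by (auto simp: mem_line)
      \<comment> \<open>Where \<open>r\<close> vanishes, both \<open>y\<close> and \<open>y'\<close>
        are 1, so \<open>1 + y'\<close> can be neither \<open>y\<close> nor
        \<open>r + y\<close>.\<close>
      have "\<not> full r" using full_eq_1[of r] r by blast
      then obtain i where i: "r $ i = 0" by (auto simp: full_def)
      moreover have "r $ i \<noteq> 0 \<or> y $ i \<noteq> 0" "r $ i \<noteq> 0 \<or> y' $ i \<noteq> 0"
        using y y' by (simp_all add: good_def cov_def)
      ultimately have yi: "y $ i = 1" "y' $ i = 1" using field_neq_0 by auto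
      have "(1 + y') $ i = y $ i" using yy i by (metis add_0 vector_add_component)
      then show False using yi by simp
    qed
    then have "lower ?U \<noteq> lower ?U'" using lower_eq_iff[of 3] U k3 by simp
    then have UU: "lower ?U \<inter> lower ?U' = lower ?E"
      using adjacentI_inf(2)[of "lower ?U" 2 "lower ?U'" "lower ?E"] lower_Gr3 U lower_Gr2[OF E] lower_mono EU by simp
    have "lower ?L \<inter> lower ?L' \<in> Gr 1"
      using lines_through[OF L(1) L'(1) False[symmetric]] r by (auto simp: mem_line)
    then obtain s where s: "s \<noteq> 0" "lower ?L \<inter> lower ?L' = pt s" by (rule Gr1_obtain)
    then have sL: "s \<in> lower ?L" "s \<in> lower ?L'" using vec.span_base[of s "{s}"] by auto
    then have "s \<in> lower ?E" using UU lower_mono[OF subset_span_insert] by blast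
    then have "s \<in> pt t" using sL t by blast
    then have "s = t" using s mem_point by blast
    then show ?thesis using sL by simp
  qed (use tLE in simp)
  then show ?thesis using t teps tLE unfolding is_image_def by blast
qed

definition F :: "'a ^ 'n \<Rightarrow> 'a ^ 'n" where
  "F r = (SOME t. is_image r t)"

lemma F: assumes "multi r"
  shows "F r \<noteq> 0" "F r \<noteq> eps" "F r \<in> lower (line r 1)" "good r y \<Longrightarrow> F r \<in> lower (line r y)"
proof -
  have "is_image r (F r)" unfolding F_def using is_image_exists[OF assms] by (rule someI_ex)
  then show "F r \<noteq> 0" "F r \<noteq> eps" "F r \<in> lower (line r 1)" "good r y \<Longrightarrow> F r \<in> lower (line r y)"
    by (auto simp: is_image_def)
qed

text \<open>The images of two different lines through \<open>1\<close> share only the point of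
  \<open>eps\<close>, a value that \<open>F\<close> avoids.\<close>

lemma F_neq:
  assumes "multi x" "multi y" "x \<noteq> y" "y \<noteq> x + 1"
  shows "F x \<noteq> F y"
proof
  assume eq: "F x = F y"
  have E: "line x 1 \<in> NC 2" "line y 1 \<in> NC 2" using assms one_line by (auto simp: multi_def)
  have "y \<notin> line x 1" using assms by (auto simp: mem_line multi_def)
  then have "line x 1 \<noteq> line y 1" by (auto simp: mem_line)
  then have ne: "lower (line x 1) \<noteq> lower (line y 1)" using lower_eq_iff[of 2] E k2 by simp
  have sub: "pt 1 \<subseteq> line z 1" for z by (intro vec.span_minimal subspace_line) (auto simp: mem_line)
  have "lower (line x 1) \<inter> lower (line y 1) = lower (pt 1)"
    using ne E sub lower_Gr[of 1, OF _ point1_NC] k2 by (intro lines_meet(2) lower_Gr2 lower_mono) auto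
  then have "F x \<in> pt eps" using F(3)[OF assms(1)] F(3)[OF assms(2)] eq lower_point1 by auto
  then show False using F(1,2)[OF assms(1)] mem_point by blast
qed

text \<open>A line has just three nonzero vectors, and any two of them add up to the third; it
  remains to see that the three images are distinct.\<close>

lemma F_add:
  assumes g: "good x y" shows "F (x + y) = F x + F y" "lower (line x y) = line (F x) (F y)"
proof -
  have g': "good y x" "good (x + y) x" using g good_commute good_add by blast+
  have m: "multi x" "multi y" "multi (x + y)" using g g' good_multi by blast+
  have sx: "x + y + 1 \<noteq> y" using g by (auto simp: good_def vec_add_eq_iff add.commute add.left_commute)
  have "F x \<in> lower (line x y)" using F(4) m g by blast
  moreover have "F y \<in> lower (line x y)" using F(4)[OF m(2) g'(1)] line_commute by simp
  moreover have "F (x + y) \<in> lower (line x y)" using F(4)[OF m(3) g'(2)] line_add[of y x] line_commute by (simp add: add.commute)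
  moreover have xy: "F x \<noteq> F y" using m good_neq[OF g] g by (intro F_neq) (auto simp: good_def)
  ultimately have L: "lower (line x y) = line (F x) (F y)" "F (x + y) \<in> line (F x) (F y)"
    using Gr2_eq_line[OF lower_Gr2[OF good_line(1)[OF g]], of "F x" "F y"] F(1) m by auto
  then show "lower (line x y) = line (F x) (F y)" by simp
  have "x + y \<noteq> x + 1" "x + y \<noteq> y + 1" "x \<noteq> x + y" "y \<noteq> x + y"
    using g good_neq[OF g] by (auto simp: good_def add.commute)
  then have "F x \<noteq> F (x + y)" "F y \<noteq> F (x + y)" using F_neq[OF m(1,3)] F_neq[OF m(2,3)] by blast+
  then show "F (x + y) = F x + F y" using L(2) F(1)[OF m(3)] by (auto simp: mem_line)
qed


lemmas char2 = add.assoc add.commute add.left_commute vec_add_self vec_add_self_left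

lemma goodI:
  assumes "x \<noteq> 0" "y \<noteq> 0" "x + y \<noteq> 1" "\<And>i. x $ i = 0 \<or> y $ i = 0"
  shows "good (1 + x) (1 + y)"
proof -
  have "cov (1 + x) (1 + y)" unfolding cov_def
  proof
    fix i show "(1 + x) $ i \<noteq> 0 \<or> (1 + y) $ i \<noteq> 0" using assms(4)[of i] by auto
  qed
  moreover have "1 + y \<noteq> 1 + x + 1"
  proof
    assume "1 + y = 1 + x + 1"
    then have "1 + y = x" by (simp add: char2)
    then show False using assms(3) vec_add_eq_iff[of 1 y x] by (simp add: char2)
  qed
  ultimately show ?thesis using assms by (simp add: good_def)
qed

text \<open>If the two values agreed, the planes spanned by three of the vectors \<open>1 + b\<^sub>i\<close> would have the
  same image.\<close>

lemma F_four_blocks: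
  assumes nz: "b1 \<noteq> 0" "b2 \<noteq> 0" "b3 \<noteq> 0" "b4 \<noteq> 0" and sum: "b4 = 1 + (b1 + (b2 + b3))"
    and disj: "\<And>i. b1 $ i = 0 \<or> b2 $ i = 0" "\<And>i. b1 $ i = 0 \<or> b3 $ i = 0"
      "\<And>i. b1 $ i = 0 \<or> b4 $ i = 0" "\<And>i. b2 $ i = 0 \<or> b3 $ i = 0"
      "\<And>i. b2 $ i = 0 \<or> b4 $ i = 0" "\<And>i. b3 $ i = 0 \<or> b4 $ i = 0"
  shows "F (b1 + b2) \<noteq> F (b3 + b4)"
proof
  assume eq: "F (b1 + b2) = F (b3 + b4)"
  have neqI: "x \<noteq> y" if xy: "x \<noteq> 0" "\<And>i. x $ i = 0 \<or> y $ i = 0" for x y :: "'a^'n"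
  proof
    assume "x = y"
    then have "x $ i = 0" for i using xy(2)[of i] by simp
    then show False using xy(1) by (simp add: vec_eq_iff)
  qed
  have ne: "b1 \<noteq> b2" "b1 \<noteq> b3" "b1 \<noteq> b4" "b2 \<noteq> b3" "b2 \<noteq> b4" "b3 \<noteq> b4"
    using neqI[OF nz(1) disj(1)] neqI[OF nz(1) disj(2)] neqI[OF nz(1) disj(3)] neqI[OF nz(2) disj(4)]
      neqI[OF nz(2) disj(5)] neqI[OF nz(3) disj(6)] by blast+
  have p34: "b3 + b4 = 1 + (b1 + b2)" and p24: "b2 + b4 = 1 + (b1 + b3)"
    and p23: "b2 + b3 = 1 + (b1 + b4)" and p12: "b1 + b2 = 1 + (b3 + b4)" and p14: "b1 + b4 = 1 + (b2 + b3)"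
    by (simp_all add: sum char2)
  have add0: "x = y" if "x + y = 0" for x y :: "'a^'n" using that vec_add_eq_iff[of x y 0] by simp
  have sne: "b1 + b2 \<noteq> 1" "b3 + b4 \<noteq> 1" "b1 + b3 \<noteq> 1" "b1 + b4 \<noteq> 1" "b2 + b3 \<noteq> 1"
    using ne add0 p34 p12 p24 p23 p14 by (metis vec_add_self)+
  \<comment> \<open>Complements of disjoint blocks cover all coordinates, and the complement of two
    summands cancels: \<open>?c1 + ?c2\<close> is again \<open>b1 + b2\<close>.\<close>
  let ?c1 = "1 + b1" and ?c2 = "1 + b2" and ?c3 = "1 + b3" and ?c4 = "1 + b4"
  have g: "good ?c1 ?c2" "good ?c3 ?c4" "good ?c1 ?c3" "good ?c1 ?c4"
    using goodI[OF nz(1,2) sne(1) disj(1)] goodI[OF nz(3,4) sne(2) disj(6)]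
      goodI[OF nz(1,3) sne(3) disj(2)] goodI[OF nz(1,4) sne(4) disj(3)] by blast+
  have c12: "?c1 + ?c2 = b1 + b2" and c34: "?c3 + ?c4 = b3 + b4" by (simp_all add: char2)
  have m: "multi ?c1" "multi ?c2" "multi ?c3" "multi (b1 + b2)"
    using g good_multi good_commute good_add c12 by metis+
  let ?L = "line ?c1 ?c2"
  note L = good_line[OF g(1)]
  have c3': "?c3 \<noteq> b1 + b2" "?c4 \<noteq> b1 + b2" using nz p12 by auto
  have c3L: "?c3 \<notin> ?L" "?c4 \<notin> ?L"
    using ne good_neq[OF g(2)] c3' unfolding mem_line c12 by auto
  have b3': "b1 + b2 \<noteq> ?c3 + 1"
  proof
    assume "b1 + b2 = ?c3 + 1"
    then have b: "b1 + b2 = b3" by (simp add: char2)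
    have "b3 $ i = 0" for i using arg_cong[OF b, of "\<lambda>v. v $ i"] disj(2)[of i] disj(4)[of i] by auto
    then show False using nz(3) by (simp add: vec_eq_iff)
  qed
  have lowL: "lower ?L = line (F ?c1) (F ?c2)" and F12: "F (b1 + b2) = F ?c1 + F ?c2"
    using F_add[OF g(1)] c12 by simp_all
  have F34: "F (b3 + b4) = F ?c3 + F ?c4" using F_add(1)[OF g(2)] c34 by simp
  have "F ?c3 \<noteq> F ?c1" "F ?c3 \<noteq> F ?c2" "F ?c3 \<noteq> F (b1 + b2)"
  proof -
    have "?c1 \<noteq> ?c3 + 1" "?c2 \<noteq> ?c3 + 1"
      using sne(3,5) vec_add_eq_iff[of 1 b1 b3] vec_add_eq_iff[of 1 b2 b3] by (auto simp: char2)
    moreover have "?c3 \<noteq> ?c1" "?c3 \<noteq> ?c2" using ne by auto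
    ultimately show "F ?c3 \<noteq> F ?c1" "F ?c3 \<noteq> F ?c2" "F ?c3 \<noteq> F (b1 + b2)"
      using F_neq[OF m(3,1)] F_neq[OF m(3,2)] F_neq[OF m(3,4)] c3' b3' by blast+
  qed
  then have F3L: "F ?c3 \<notin> lower ?L" unfolding lowL mem_line F12[symmetric] using F(1)[OF m(3)] by simp
  have F4: "F ?c4 = F ?c3 + (F ?c1 + F ?c2)" using vec_add_self_left[of "F ?c3" "F ?c4"] eq F12 F34 by simp
  have F4L: "F ?c4 \<notin> lower ?L"
  proof
    assume "F ?c4 \<in> lower ?L"
    moreover have "F ?c1 + F ?c2 \<in> lower ?L" by (simp add: lowL mem_line)
    ultimately have "F ?c4 + (F ?c1 + F ?c2) \<in> lower ?L" using subspace_lower vec.subspace_add by blast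
    then show False using F3L F4 by (simp add: char2)
  qed
  have plane: "lower (adjoin c ?L) = adjoin (F c) (lower ?L)" "adjoin c ?L \<in> NC 3"
    if c: "c \<notin> ?L" "good ?c1 c" "F c \<notin> lower ?L" for c
  proof -
    let ?U = "adjoin c ?L"
    have cU: "?c1 \<in> ?U" "?c2 \<in> ?U" "c \<in> ?U" by (auto intro!: vec.span_base simp: mem_line)
    have "?U \<in> Gr 3" using plane_Gr[OF NC_Gr[OF L(1)] c(1)] .
    then show U: "?U \<in> NC 3" using g(1) cU by (intro cov_NC[of ?c1 ?c2]) (auto simp: good_def)
    have "line ?c1 c \<subseteq> ?U" using cU by (intro line_subset) auto
    then have "F c \<in> lower ?U"
      using F(4)[OF good_multi[OF good_commute[OF c(2)]] good_commute[OF c(2)]] line_commute lower_mono by blast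
    then show "lower ?U = adjoin (F c) (lower ?L)"
      using lower_Gr3[OF U] lower_Gr2[OF L(1)] lower_mono[OF subset_span_insert] c(3)
      by (intro span_insert_eq[of _ 2, symmetric]) auto
  qed
  let ?U = "adjoin ?c3 ?L" and ?U' = "adjoin ?c4 ?L"
  note pl = plane[OF c3L(1) g(3) F3L] plane[OF c3L(2) g(4) F4L]
  \<comment> \<open>Here the assumed equality acts: it expresses \<open>F ?c4\<close> through the
    images of \<open>?c1\<close>, \<open>?c2\<close> and \<open>?c3\<close>.\<close>
  have "F ?c4 \<in> adjoin (F ?c3) (lower ?L)"
    unfolding F4 by (intro vec.span_add vec.span_base) (auto simp: lowL mem_line)
  then have "lower ?U' \<subseteq> lower ?U" unfolding pl(1,3)
    by (intro span_insert_least subset_span_insert) auto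
  then have "lower ?U' = lower ?U" using Gr_eqI lower_Gr3 pl(2,4) by blast
  then have "?U' = ?U" using lower_eq_iff[of 3] pl(2,4) k3 by blast
  then have "?c4 \<in> ?U" using mem_span_insert1[of ?c4 ?L] by simp
  then have "?c4 \<in> ?L \<or> ?c3 + ?c4 \<in> ?L" using mem_span_insert2[OF subspace_line] by blast
  then have "1 + (b1 + b2) \<in> ?L" using c3L c34 p34 by simp
  moreover have "b1 + b2 \<in> ?L" by (simp add: mem_line c12)
  ultimately have "1 + (b1 + b2) + (b1 + b2) \<in> ?L" using subspace_line vec.subspace_add by blast
  then have "1 \<in> ?L" by (simp add: char2)
  then show False using L by blast
qed

text \<open>Both values lie on the image of \<open>line a 1\<close> and are neither 0 nor
  \<open>eps\<close>, so they agree or differ by \<open>eps\<close>. Splitting one coordinate off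
  \<open>a\<close> and one off its complement gives four blocks, nonzero because both vectors are
  \<open>multi\<close>, and excludes agreement.\<close>

lemma F_complement:
  assumes m: "multi a" "multi (a + 1)" shows "F (a + 1) = F a + eps"
proof -
  obtain i where i: "a $ i \<noteq> 0" using m by (auto simp: multi_def vec_eq_iff)
  have "\<not> full a" using full_eq_1[of a] m by (auto simp: multi_def)
  then obtain l where l: "a $ l = 0" by (auto simp: full_def)
  let ?b1 = "axis i 1 :: 'a^'n" and ?b2 = "a + axis i 1" and ?b3 = "axis l 1 :: 'a^'n" and ?b4 = "a + 1 + axis l 1"
  have s: "?b1 + ?b2 = a" "?b3 + ?b4 = a + 1" by (simp_all add: char2)
  have "F (?b1 + ?b2) \<noteq> F (?b3 + ?b4)"
  proof (rule F_four_blocks)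
    show "?b1 \<noteq> 0" "?b3 \<noteq> 0" by (simp_all)
    show "?b2 \<noteq> 0" "?b4 \<noteq> 0" using m vec_add_eq_iff[of a "axis i 1" 0] vec_add_eq_iff[of "a + 1" "axis l 1" 0]
      by (auto simp: multi_def)
    show "?b4 = 1 + (?b1 + (?b2 + ?b3))" by (simp add: char2)
    show "?b1 $ j = 0 \<or> ?b2 $ j = 0" "?b1 $ j = 0 \<or> ?b3 $ j = 0" "?b1 $ j = 0 \<or> ?b4 $ j = 0"
      "?b2 $ j = 0 \<or> ?b3 $ j = 0" "?b2 $ j = 0 \<or> ?b4 $ j = 0" "?b3 $ j = 0 \<or> ?b4 $ j = 0" for j
      using i l field_neq_0[of "a $ i"] field_cases[of "a $ j"] by (auto simp: axis_def)
  qed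
  then have ne: "F a \<noteq> F (a + 1)" using s by simp
  have a: "a \<noteq> 0" "a \<noteq> 1" using m by (auto simp: multi_def)
  have "lower (line a 1) \<in> Gr 2" using lower_Gr2 one_line a by blast
  moreover have "F a \<in> lower (line a 1)" "F (a + 1) \<in> lower (line a 1)"
    using F(3)[OF m(1)] F(3)[OF m(2)] line_add[of a 1] by auto
  moreover have "eps \<in> lower (line a 1)" by (intro eps_mem subspace_line) (simp add: mem_line)
  ultimately have "F (a + 1) \<in> line (F a) eps"
    using Gr2_eq_line[of _ "F a" eps] F(1,2)[OF m(1)] eps by auto
  then show ?thesis using F(1,2)[OF m(2)] ne by (auto simp: mem_line)
qed

section \<open>The linear map that induces \<open>f\<close> over the two-element field\<close>

definition G :: "'a ^ 'n \<Rightarrow> 'a ^ 'n" where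
  "G x = (if x = 0 then 0 else if x = 1 then eps else if multi x then F x else F (x + 1) + eps)"

lemma not_multi: "x \<noteq> 0 \<Longrightarrow> x \<noteq> 1 \<Longrightarrow> \<not> multi x \<longleftrightarrow> (\<exists>i. x = axis i 1)"
  by (auto simp: multi_def)

lemma multi_complement_axis: "multi (axis i 1 + 1)"
proof -
  have "\<exists>l. l \<noteq> i \<and> l \<noteq> j" for j :: 'n
  proof (rule exists_avoiding2)
    show "3 \<le> CARD('n)" using kn k2 by linarith
  qed
  then show ?thesis using vec_add_eq_iff[of "axis i 1" 1]
    by (auto simp: multi_def vec_eq_iff axis_def) (metis zero_neq_one)+
qed

text \<open>For vectors of weight one the value of \<open>G\<close> was defined so as to satisfy
  this; for the others it is \<open>F_complement\<close>.\<close>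

lemma G_complement: "G (x + 1) = G x + eps"
proof -
  consider "x = 0" | "x = 1" | i where "x = axis i 1" | i where "x + 1 = axis i 1" | "multi x" "multi (x + 1)"
    by (metis multi_def vec_add_eq_iff add.right_neutral)
  then show ?thesis
  proof cases
    case 1
    then show ?thesis by (simp add: G_def one_neq_0)
  next
    case 2
    then show ?thesis by (simp add: G_def one_neq_0)
  next
    case 3
    then have m: "multi (x + 1)" "\<not> multi x" using multi_complement_axis by (auto simp: multi_def)
    then have "x \<noteq> 1" "x \<noteq> 0" by (auto simp: multi_def one_neq_0 3)
    then show ?thesis using m by (simp add: G_def char2) (auto simp: multi_def)
  next
    case 4
    then have x: "x = axis i 1 + 1" using vec_add_eq_iff[of x 1 "axis i 1"] by (simp add: add.commute)
    then have m: "multi x" "\<not> multi (x + 1)" using multi_complement_axis 4 by (auto simp: multi_def)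
    then have "x + 1 \<noteq> 1" "x + 1 \<noteq> 0" using 4 by (auto simp: multi_def)
    then show ?thesis using m by (simp add: G_def char2) (auto simp: multi_def)
  next
    case 5
    then show ?thesis using F_complement by (simp add: G_def) (auto simp: multi_def)
  qed
qed

lemma G_multi: "multi x \<Longrightarrow> G x = F x"
  by (simp add: G_def) (auto simp: multi_def)

text \<open>Complements of vectors with disjoint supports form a \<open>good\<close> pair, to which
  \<open>F_add\<close> applies. Additivity for disjoint supports suffices to expand \<open>G\<close>
  along the standard basis, and so gives full additivity.\<close>

lemma G_disjoint:
  assumes disj: "\<And>i. x $ i = 0 \<or> y $ i = 0"
  shows "G (x + y) = G x + G y"
proof -
  consider "x = 0" | "y = 0" | "x + y = 1" | "x \<noteq> 0" "y \<noteq> 0" "x + y \<noteq> 1" by blast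
  then show ?thesis
  proof cases
    case 3
    then have "y = x + 1" using vec_add_eq_iff[of y x 1] by (simp add: add.commute)
    then show ?thesis using 3 G_complement[of x] by (simp add: G_def[of 1] one_neq_0 char2)
  next
    case 4
    have g: "good (1 + x) (1 + y)" using goodI[OF 4 disj] .
    then have m: "multi (1 + x)" "multi (1 + y)" "multi (x + y)"
      using good_multi[OF g] good_multi[OF good_commute[OF g]] good_multi[OF good_add[OF g]] by (auto simp: char2)
    have "F (x + y) = F (1 + x) + F (1 + y)" using F_add(1)[OF g] by (simp add: char2)
    then have "G (x + y) = G (1 + x) + G (1 + y)" using m G_multi by simp
    then show ?thesis using G_complement[of x] G_complement[of y] by (simp add: char2)
  qed (simp_all add: G_def[of 0])
qed

lemma G_sum: "finite A \<Longrightarrow> G (\<Sum>i\<in>A. x $ i *s axis i 1) = (\<Sum>i\<in>A. x $ i *s G (axis i 1))"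
proof (induction A rule: finite_induct)
  case empty
  then show ?case by (simp add: G_def)
next
  case (insert j A)
  have "G (x $ j *s axis j 1 + (\<Sum>i\<in>A. x $ i *s axis i 1)) = G (x $ j *s axis j 1) + G (\<Sum>i\<in>A. x $ i *s axis i 1)"
  proof (rule G_disjoint)
    fix l
    show "(x $ j *s axis j 1 :: 'a^'n) $ l = 0 \<or> (\<Sum>i\<in>A. x $ i *s axis i 1) $ l = 0"
      using insert by (auto simp: axis_def sum.neutral)
  qed
  moreover have "G (x $ j *s axis j 1) = x $ j *s G (axis j 1)"
    using field_cases[of "x $ j"] by (auto simp: G_def[of 0])
  ultimately show ?case using insert by simp
qed

lemma G_eq: "G x = (\<Sum>i\<in>UNIV. x $ i *s G (axis i 1))"
  using G_sum[of UNIV x] by (simp add: basis_expansion)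

lemma G_add: "G (x + y) = G x + G y"
  unfolding G_eq[of "x + y"] G_eq[of x] G_eq[of y] by (simp add: vec.scale_left_distrib sum.distrib)

lemma G_0: "G 0 = 0" by (simp add: G_def)

lemma G_1: "G 1 = eps" by (simp add: G_def one_neq_0)

lemma G_scale: "G (c *s x) = c *s G x"
  using field_cases[of c] G_0 by auto

lemma G_nonzero: assumes "x \<noteq> 0" shows "G x \<noteq> 0"
proof (cases "x = 1 \<or> multi x")
  case True
  then show ?thesis using G_1 eps G_multi F(1) by auto
next
  case False
  then obtain i where x: "x = axis i 1" using not_multi assms by blast
  then have "F (x + 1) \<noteq> eps" using F(2) multi_complement_axis by blast
  then show ?thesis using False assms vec_add_eq_iff[of "F (x + 1)" eps 0] by (auto simp: G_def)
qed

lemma G_inj: "inj G"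
proof (rule injI)
  fix x y assume "G x = G y"
  then have "G (x + y) = 0" by (simp add: G_add)
  then have "x + y = 0" using G_nonzero by blast
  then show "x = y" using vec_add_eq_iff[of x y 0] by simp
qed

lemma G_mem_line: assumes "x \<noteq> 0" "x \<noteq> 1" shows "G x \<in> lower (line x 1)"
proof (cases "multi x")
  case True
  then show ?thesis using F(3) G_multi by simp
next
  case False
  then obtain i where x: "x = axis i 1" using not_multi assms by blast
  have "F (x + 1) \<in> lower (line x 1)" using F(3)[OF multi_complement_axis[of i]] x line_add[of x 1] by simp
  moreover have "eps \<in> lower (line x 1)" by (intro eps_mem subspace_line) (simp add: mem_line)
  ultimately show ?thesis using False assms vec.subspace_add[OF subspace_lower] by (simp add: G_def)
qed

text \<open>By dimension \<open>f Y\<close> contains a nonzero vector of the image of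
  \<open>line x 1\<close>, and it avoids \<open>eps\<close>. Which of the two remaining vectors it
  contains is left open here.\<close>

lemma G_mem_cases:
  assumes Y: "Y \<in> NC k" "1 \<notin> Y" and x: "x \<in> Y"
  shows "G x \<in> f Y \<or> G x + eps \<in> f Y"
proof (cases "x = 0")
  case True
  then show ?thesis using f_Gr[OF Y(1)] vec.subspace_0 by (auto simp: G_0 mem_Gr)
next
  case False
  have x1: "x \<noteq> 1" using x Y by blast
  obtain R where R: "R \<in> Gr (k - 1)" "x \<in> R" "R \<subseteq> Y"
    using exists_hyperplane_through[OF NC_Gr[OF Y(1)] k2 x] by blast
  let ?Z = "adjoin 1 R"
  note Z = adjacent_exchange[OF NC_Gr[OF Y(1)] k2 R(1,3) Y(2)]
  have ZN: "?Z \<in> NC k" using one_NC[OF mem_span_insert1 Z(1)] .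
  have adj: "adjacent k (f Y) (f ?Z)" using f_adj[OF Y(1) ZN Z(2)] .
  have "line x 1 \<subseteq> ?Z" using R by (intro line_subset) (auto intro: vec.span_base)
  then have sub: "lower (line x 1) \<subseteq> f ?Z" using lower_le[OF ZN] by blast
  have l2: "lower (line x 1) \<in> Gr 2" using lower_Gr2[OF one_line[OF False x1]] .
  let ?I = "f Y \<inter> f ?Z"
  have I: "?I \<in> Gr (k - 1)" using Int_Gr_adjacent[of "k - 1"] adj Suc_k1 by metis
  have "vec.dim ?I + vec.dim (lower (line x 1)) \<le> vec.dim (f ?Z) + vec.dim (?I \<inter> lower (line x 1))"
    using sub subspace_Gr[OF I] subspace_lower subspace_Gr[OF f_Gr[OF ZN]] by (intro meet_in_hyperplane) auto
  then have "0 < vec.dim (?I \<inter> lower (line x 1))"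
    using dim_Gr[OF I] dim_Gr[OF l2] dim_Gr[OF f_Gr[OF ZN]] k2 by linarith
  then obtain u where u: "u \<in> f Y" "u \<in> lower (line x 1)" "u \<noteq> 0" using exists_nonzero by blast
  have "G x \<noteq> eps"
  proof
    assume "G x = eps"
    then show False using G_1 G_inj x1 by (metis injD)
  qed
  then have "lower (line x 1) = line (G x) eps"
    using Gr2_eq_line[OF l2 G_mem_line[OF False x1] eps_mem] G_nonzero[OF False] eps subspace_line
    by (simp add: mem_line)
  moreover have "u \<noteq> eps" using u eps_not_mem[OF Y(1) _ _ Y(2)] lower_k[OF Y(1)] k2 by auto
  ultimately show ?thesis using u by (auto simp: mem_line)
qed

text \<open>If \<open>r \<in> Y\<close> and \<open>G r \<notin> f Y\<close>, replace \<open>Y\<close> by an adjacent \<open>Z\<close> containing \<open>r\<close> and \<open>1 + axis i 1\<close>. On the one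
  hand the nondegenerate line through these two vectors forces \<open>G r \<in> f Z\<close>, on the other hand
  \<open>f Y\<close> and \<open>f Z\<close> agree above \<open>Y \<inter> Z\<close>.\<close>

lemma G_extends:
  assumes Y: "Y \<in> NC k"
  shows "f Y = G ` Y"
proof -
  have fYs: "vec.subspace (f Y)" using subspace_Gr[OF f_Gr[OF Y]] .
  have cardG: "card (G ` A) = card A" for A using card_image[OF inj_on_subset[OF G_inj subset_UNIV]] .
  have cardf: "card (f Z) = card Z" if "Z \<in> NC k" for Z
    using card_subspace[of Z] card_subspace[of "f Z"] f_Gr[OF that] NC_Gr[OF that] by (simp add: mem_Gr)
  have "G ` Y \<subseteq> f Y"
  proof (cases "1 \<in> Y")
    case True
    show ?thesis
    proof (rule image_subsetI)
      fix x assume x: "x \<in> Y"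
      show "G x \<in> f Y"
      proof (cases "x = 0 \<or> x = 1")
        case True
        moreover have "eps \<in> f Y"
          using eps_mem[OF \<open>1 \<in> Y\<close> subspace_Gr[OF NC_Gr[OF Y]]] unfolding lower_k[OF Y] .
        ultimately show ?thesis using vec.subspace_0[OF fYs] G_0 G_1 by auto
      next
        case *: False
        have "line x 1 \<subseteq> Y" using x True subspace_Gr[OF NC_Gr[OF Y]] by (intro line_subset)
        then show ?thesis using G_mem_line[of x] * lower_le[OF Y] by blast
      qed
    qed
  next
    case False
    have sY: "vec.subspace Y" using subspace_Gr[OF NC_Gr[OF Y]] .
    show ?thesis
    proof (rule ccontr)
      assume "\<not> ?thesis"
      then obtain d where d: "d \<in> Y" "G d \<notin> f Y" by blast
      let ?V = "adjoin 1 Y"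
      \<comment> \<open>The subspace \<open>?V\<close> has dimension k + 1 < n, so it misses some
        axis vector. If \<open>d\<close> vanishes at that coordinate, a vector of \<open>Y\<close>
        that does not vanish there is added or used instead.\<close>
      have "\<exists>r i. r \<in> Y \<and> G r \<notin> f Y \<and> r $ i \<noteq> 0 \<and> axis i 1 \<notin> ?V"
      proof (rule ccontr)
        assume contra: "\<not> ?thesis"
        have ax: "axis i 1 \<in> ?V" for i
        proof -
          obtain y where y: "y \<in> Y" "y $ i \<noteq> 0" using Y unfolding mem_NC by blast
          have "\<exists>r\<in>Y. G r \<notin> f Y \<and> r $ i \<noteq> 0"
          proof (cases "d $ i \<noteq> 0 \<or> G y \<notin> f Y")
            case True
            then show ?thesis using d y by blast
          next
            case False
            have "G (d + y) \<notin> f Y"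
            proof
              assume "G (d + y) \<in> f Y"
              then have "G (d + y) + G y \<in> f Y" using False fYs vec.subspace_add by blast
              then show False using d by (simp add: G_add char2)
            qed
            moreover have "(d + y) $ i \<noteq> 0" using False y by simp
            moreover have "d + y \<in> Y" using d y sY vec.subspace_add by blast
            ultimately show ?thesis by blast
          qed
          then show ?thesis using contra by blast
        qed
        have "x \<in> ?V" for x
        proof -
          have "(\<Sum>j\<in>UNIV. x $ j *s axis j 1) \<in> ?V" by (intro vec.span_sum vec.span_scale ax)
          then show ?thesis by (simp add: basis_expansion)
        qed
        then have "?V = UNIV" by blast
        then have "vec.dim ?V = CARD('n)" by (simp only: vec_dim_card)
        moreover have "vec.dim ?V = k + 1" using dim_span_insert[OF sY False] dim_Gr[OF NC_Gr[OF Y]] by simp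
        ultimately show False using kn by linarith
      qed
      then obtain r i where r: "r \<in> Y" "G r \<notin> f Y" "r $ i \<noteq> 0" "axis i 1 \<notin> ?V" by blast
      have Gr': "G r + eps \<in> f Y" using G_mem_cases[OF Y False r(1)] r(2) by blast
      let ?z = "1 + axis i 1 :: 'a^'n"
      have zV: "?z \<notin> ?V"
      proof
        assume "?z \<in> ?V"
        then have "1 + ?z \<in> ?V" by (rule vec.span_add[OF mem_span_insert1])
        then show False using r(4) by (simp add: char2)
      qed
      have YV: "Y \<subseteq> ?V" by (rule subset_span_insert)
      obtain R where R: "R \<in> Gr (k - 1)" "r \<in> R" "R \<subseteq> Y"
        using exists_hyperplane_through[OF NC_Gr[OF Y] k2 r(1)] by blast
      have Rs: "vec.subspace R" using subspace_Gr[OF R(1)] .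
      let ?Z = "adjoin ?z R"
      have "?z \<notin> Y" using zV YV by blast
      note Z = adjacent_exchange[OF NC_Gr[OF Y] k2 R(1,3) this]
      have rZ: "r \<in> ?Z" "?z \<in> ?Z" using R(2) by (auto intro: vec.span_base)
      have mr: "good r ?z"
      proof -
        have "r \<noteq> 1" using r False by blast
        moreover have "r \<noteq> axis i 1" using r YV by blast
        moreover have "cov r ?z" using r(3) by (auto simp: cov_def axis_def)
        moreover have "?z \<noteq> 1" by simp
        ultimately show ?thesis by (simp add: good_def add.commute)
      qed
      have ZN: "?Z \<in> NC k" using cov_NC[of r ?z] mr rZ Z(1) by (auto simp: good_def)
      have ZV: "?Z \<inter> ?V \<subseteq> R"
      proof
        fix x assume x: "x \<in> ?Z \<inter> ?V"
        then have "x \<in> R \<or> ?z + x \<in> R" using mem_span_insert2[OF Rs] by blast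
        moreover have "?z + x \<notin> R"
        proof
          assume "?z + x \<in> R"
          then have "?z + x \<in> ?V" using R YV by blast
          moreover have "x \<in> ?V" using x by blast
          ultimately have "?z + x + x \<in> ?V" by (rule vec.span_add)
          then show False using zV by (simp add: add.assoc)
        qed
        ultimately show "x \<in> R" by blast
      qed
      have Z1: "1 \<notin> ?Z" using ZV R False mem_span_insert1[of 1 Y] by blast
      have "adjacent k (f Y) (f ?Z)" using f_adj[OF Y ZN Z(2)] .
      then have I: "f Y \<inter> f ?Z \<in> Gr (k - 1)" using Int_Gr_adjacent[of "k - 1"] Suc_k1 by metis
      \<comment> \<open>Choosing for each vector the candidate that lies in \<open>f W\<close> is
        injective because \<open>1 \<notin> W\<close>, hence bijective by cardinality.\<close>
      have onto: "\<exists>x\<in>W. u = G x \<or> u = G x + eps" if W: "W \<in> NC k" "1 \<notin> W" and u: "u \<in> f W" for W u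
      proof -
        define h where "h x = (if G x \<in> f W then G x else G x + eps)" for x
        have "inj_on h W"
        proof (rule inj_onI)
          fix x y assume xy: "x \<in> W" "y \<in> W" "h x = h y"
          then have "G (x + y) = G 0 \<or> G (x + y) = G 1"
            by (auto simp: h_def G_add G_0 G_1 char2 vec_add_eq_iff split: if_splits)
          then have "x + y = 0 \<or> x + y = 1" using G_inj by (auto dest: injD)
          moreover have "x + y \<in> W" using xy NC_Gr[OF W(1)] vec.subspace_add by (auto simp: mem_Gr)
          ultimately have "x + y = 0" using W by auto
          then show "x = y" using vec_add_eq_iff[of x y 0] by simp
        qed
        moreover have "h ` W \<subseteq> f W" using G_mem_cases[OF W] by (auto simp: h_def)
        ultimately have "h ` W = f W" using cardf[OF W(1)] by (intro card_subset_eq) (auto simp: card_image)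
        then obtain x where "x \<in> W" "u = h x" using u by blast
        then show ?thesis by (auto simp: h_def split: if_splits)
      qed
      define h where "h x = (if G x \<in> f Y then G x else G x + eps)" for x
      have eY: "eps \<notin> f Y" using eps_not_mem[OF Y _ _ False] lower_k[OF Y] k2 by simp
      \<comment> \<open>The preimages of \<open>u\<close> in \<open>Y\<close> and in
        \<open>?Z\<close> differ by 0 or \<open>1\<close>, so both lie in \<open>?V\<close>, and
        \<open>?Z\<close> meets \<open>?V\<close> only inside \<open>R\<close>.\<close>
      have "f Y \<inter> f ?Z \<subseteq> h ` R"
      proof
        fix u assume u: "u \<in> f Y \<inter> f ?Z"
        obtain x where x: "x \<in> Y" "u = G x \<or> u = G x + eps" using onto[OF Y False] u by blast
        obtain x' where x': "x' \<in> ?Z" "u = G x' \<or> u = G x' + eps" using onto[OF ZN Z1] u by blast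
        have "G (x + x') = G 0 \<or> G (x + x') = G 1"
          using x x' by (auto simp: G_add G_0 G_1 char2 vec_add_eq_iff)
        then have xx: "x + x' = 0 \<or> x + x' = 1" using G_inj by (auto dest: injD)
        then have "x' = x \<or> x' = x + 1" using vec_add_eq_iff[of x' x] by (auto simp: add.commute)
        moreover have "x \<in> ?V" "x + 1 \<in> ?V" using x YV mem_span_insert1[of 1 Y] by (auto intro: vec.span_add)
        ultimately have "x' \<in> ?V" by auto
        then have "x' \<in> R" using ZV x' by blast
        then have "x + x' \<in> Y" using R x sY vec.subspace_add by blast
        then have "x + x' = 0" using xx False by auto
        then have "x = x'" using vec_add_eq_iff[of x x' 0] by simp
        then have "x \<in> R" using \<open>x' \<in> R\<close> by simp
        moreover have "u = h x"
        proof (cases "G x \<in> f Y")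
          case True
          have "u \<noteq> G x + eps"
          proof
            assume "u = G x + eps"
            then have "u + G x = eps" by (simp add: char2)
            moreover have "u + G x \<in> f Y" using u True vec.subspace_add[OF fYs] by blast
            ultimately show False using eY by simp
          qed
          then show ?thesis using x True by (simp add: h_def)
        next
          case False
          then show ?thesis using x u by (auto simp: h_def)
        qed
        ultimately show "u \<in> h ` R" by blast
      qed
      moreover have "card (h ` R) \<le> card R" by (rule card_image_le) simp
      moreover have "card R = card (f Y \<inter> f ?Z)"
        using card_subspace[of R] card_subspace[of "f Y \<inter> f ?Z"] R(1) I by (simp add: mem_Gr)
      ultimately have "f Y \<inter> f ?Z = h ` R" by (intro card_seteq) auto
      moreover have "h r = G r + eps" using r by (simp add: h_def)
      ultimately have "G r + eps \<in> f ?Z" using R(2) by (metis IntD2 imageI)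
      moreover have "G r \<in> f ?Z"
      proof -
        have "line r ?z \<subseteq> ?Z" using rZ by (intro line_subset) auto
        then show ?thesis using F(4)[OF good_multi[OF mr] mr] G_multi[OF good_multi[OF mr]] lower_le[OF ZN] by auto
      qed
      ultimately have "G r + (G r + eps) \<in> f ?Z" using subspace_Gr[OF f_Gr[OF ZN]] vec.subspace_add by blast
      then show False using eps_not_mem[OF ZN _ _ Z1] lower_k[OF ZN] k2 by simp
    qed
  qed
  then show ?thesis using cardG[of Y] cardf[OF Y] by (intro card_subset_eq[symmetric]) auto
qed

end

section \<open>Extension and uniqueness\<close>

locale collineation =
  fixes b :: "'a::{field,finite} ^ 'n::finite \<Rightarrow> 'a ^ 'n"
  assumes b_inj: "inj b" and b_scale: "\<And>c x. b (c *s x) = c *s b x"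
    and b_collinear: "\<And>x y. b (x + y) \<in> vec.span {b x, b y}"
begin

lemma b_0: "b 0 = 0"
  using b_scale[of 0 0] by simp

text \<open>The span of \<open>x\<close> and \<open>y\<close> is sent injectively into the span of
  the images, and equal cardinality makes this onto. So \<open>b x + b y\<close> has a preimage,
  although it need not be \<open>x + y\<close>.\<close>

lemma b_add_image:
  assumes X: "vec.subspace X" and xy: "x \<in> X" "y \<in> X"
  shows "b x + b y \<in> b ` X"
proof (cases "x \<in> pt y")
  case True
  then obtain c where "x = c *s y" using mem_span_singleton by blast
  then have "b x + b y = b ((c + 1) *s y)" unfolding b_scale[of "c + 1"] by (simp add: b_scale vec.scale_left_distrib)
  then show ?thesis using X xy by (simp add: vec.subspace_scale)
next
  case False
  show ?thesis
  proof (cases "y = 0")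
    case True
    then show ?thesis using xy b_0 by simp
  next
    case y: False
    let ?M = "adjoin x (pt y)" and ?N = "adjoin (b x) (pt (b y))"
    have M: "?M \<in> Gr 2" using line_Gr[OF y False] .
    have "b x \<notin> pt (b y)"
    proof
      assume "b x \<in> pt (b y)"
      then obtain c where "b x = b (c *s y)" using mem_span_singleton b_scale by metis
      then have "x = c *s y" using b_inj by (auto dest: injD)
      then show False using False mem_span_singleton by blast
    qed
    moreover have "b y \<noteq> 0" using b_0 b_inj y by (metis injD)
    ultimately have N: "?N \<in> Gr 2" using line_Gr by blast
    have bN: "b x \<in> ?N" "b y \<in> ?N" by (auto intro: vec.span_base)
    have "b ` ?M \<subseteq> ?N"
    proof (rule image_subsetI)
      fix m assume "m \<in> ?M"
      then have "\<exists>c. \<exists>z\<in>pt y. m = c *s x + z" by (rule iffD1[OF span_insert_iff[OF vec.subspace_span]])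
      then obtain c d where m: "m = c *s x + d *s y" using mem_span_singleton by metis
      have "vec.span {c *s b x, d *s b y} \<subseteq> ?N" using bN by (intro vec.span_minimal) (auto intro: vec.span_scale)
      then show "b m \<in> ?N" using b_collinear[of "c *s x" "d *s y"] unfolding m b_scale by blast
    qed
    moreover have "card (b ` ?M) = card ?N"
      using card_image[OF inj_on_subset[OF b_inj subset_UNIV], of ?M]
        card_subspace[OF subspace_Gr[OF M]] card_subspace[OF subspace_Gr[OF N]] dim_Gr[OF M] dim_Gr[OF N] by simp
    ultimately have "b ` ?M = ?N" by (intro card_subset_eq) auto
    moreover have "b x + b y \<in> ?N" using bN by (rule vec.span_add)
    moreover have "?M \<subseteq> X" using X xy by (intro span_insert_least vec.span_minimal) auto
    ultimately show ?thesis by blast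
  qed
qed

lemma subspace_image:
  assumes X: "vec.subspace X" shows "vec.subspace (b ` X)"
  unfolding vec.subspace_def
proof (intro conjI ballI allI)
  show "0 \<in> b ` X" using b_0 vec.subspace_0[OF X] by (metis imageI)
  show "u + v \<in> b ` X" if "u \<in> b ` X" "v \<in> b ` X" for u v
    using that b_add_image[OF X] by blast
  show "c *s u \<in> b ` X" if "u \<in> b ` X" for c u
    using that vec.subspace_scale[OF X] b_scale by (metis (no_types, lifting) image_iff)
qed

lemma dim_image:
  assumes X: "vec.subspace X" shows "vec.dim (b ` X) = vec.dim X"
proof -
  have "card (b ` X) = card X" using card_image[OF inj_on_subset[OF b_inj subset_UNIV]] .
  then show ?thesis using dim_le_iff_card[OF X subspace_image[OF X]] dim_le_iff_card[OF subspace_image[OF X] X] by simp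
qed

lemma image_Gr: "X \<in> Gr j \<Longrightarrow> b ` X \<in> Gr j"
  by (simp add: mem_Gr subspace_image dim_image)

lemma dim_image_Int:
  assumes "vec.subspace X" "vec.subspace Y"
  shows "vec.dim (b ` X \<inter> b ` Y) = vec.dim (X \<inter> Y)"
  using dim_image[OF vec.subspace_inter[OF assms]] image_Int[OF b_inj] by simp

end

section \<open>From graphs to the adjacency relation, and existence of the extension\<close>

lemma verts_grassmann [simp]: "verts (grassmann_graph k) = Gr k"
  by (simp add: grassmann_graph_def)

lemma edges_grassmann: "{X, Y} \<in> edges (grassmann_graph k) \<longleftrightarrow> adjacent k X Y"
proof
  assume "{X, Y} \<in> edges (grassmann_graph k)"
  then obtain S T where ST: "{X, Y} = {S, T}" "adjacent k S T"
    by (auto simp: grassmann_graph_def adjacent_def)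
  then show "adjacent k X Y" using adjacent_commute[of k S T] by (auto simp: doubleton_eq_iff)
qed (auto simp: grassmann_graph_def adjacent_def)

lemma verts_code [simp]: "verts (code_graph k) = NC k"
  by (auto simp: code_graph_def induced_subgraph_def NC_Gr)

lemma edges_code: "{X, Y} \<in> edges (code_graph k) \<longleftrightarrow> X \<in> NC k \<and> Y \<in> NC k \<and> adjacent k X Y"
  using edges_grassmann[of X Y k] by (auto simp: code_graph_def induced_subgraph_def)

lemma graph_autI:
  fixes g :: "('a::{field,finite} ^ 'n::finite) set \<Rightarrow> ('a ^ 'n) set"
  assumes Gr: "\<And>X. X \<in> Gr k \<Longrightarrow> g X \<in> Gr k" and inj: "inj_on g (Gr k)"
    and dim: "\<And>X Y. X \<in> Gr k \<Longrightarrow> Y \<in> Gr k \<Longrightarrow> vec.dim (g X \<inter> g Y) = vec.dim (X \<inter> Y)"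
  shows "graph_aut g (grassmann_graph k)"
proof -
  have "g ` Gr k \<subseteq> Gr k" using Gr by blast
  then have "bij_betw g (Gr k) (Gr k)" using endo_inj_surj[OF _ _ inj] inj by (simp add: bij_betw_def)
  then show ?thesis using Gr dim unfolding graph_aut_def graph_iso_def by (auto simp: edges_grassmann adjacent_def)
qed

lemma graph_aut_restrict:
  assumes "graph_aut g (grassmann_graph k)"
  shows "graph_aut (restrict g (Gr k)) (grassmann_graph k)"
  using assms unfolding graph_aut_def graph_iso_def by (simp add: bij_betw_restrict_eq)

lemma graph_aut_adjacent:
  assumes "graph_aut g (grassmann_graph k)" "X \<in> Gr k" "Y \<in> Gr k"
  shows "adjacent k (g X) (g Y) \<longleftrightarrow> adjacent k X Y"
  using assms by (simp add: graph_aut_def graph_iso_def edges_grassmann)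

lemma star_embedding_collineation:
  fixes f :: "('a::{field,finite} ^ 'n::finite) set \<Rightarrow> ('a ^ 'n) set"
  assumes f: "star_embedding f k" and qk: "CARD('a) \<ge> 3 \<or> k \<ge> 3"
  shows "\<exists>b. collineation b \<and> (\<forall>Y\<in>NC k. f Y = b ` Y)"
proof (cases "CARD('a) \<ge> 3")
  case True
  then interpret star_embedding_large f k
    using f by (simp add: star_embedding_large_def star_embedding_large_axioms_def)
  have "collineation coll" using coll_inj coll_scale coll_collinear by unfold_locales
  then show ?thesis using coll_extends by blast
next
  case False
  then have "CARD('a) = 2" "k \<ge> 3" using qk card_field_ge2[where 'a='a] by linarith+
  then interpret star_embedding_binary f k
    using f by (simp add: star_embedding_binary_def star_embedding_binary_axioms_def)
  have "G (x + y) \<in> vec.span {G x, G y}" for x y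
    unfolding G_add by (intro vec.span_add vec.span_base) auto
  then have "collineation G" using G_inj G_scale by unfold_locales
  then show ?thesis using G_extends by blast
qed

text \<open>When n = 2k, \<open>perp\<close> permutes the \<open>k\<close>-subspaces, preserves
  adjacency and exchanges stars and tops. In the dual case it is applied after \<open>f\<close> to
  reach the star case, and once more to return.\<close>

lemma code_embedding_extends:
  fixes f :: "('a::{field,finite} ^ 'n::finite) set \<Rightarrow> ('a ^ 'n) set"
  assumes f: "code_embedding f k" and qk: "CARD('a) \<ge> 3 \<or> k \<ge> 3"
  shows "\<exists>g. graph_aut g (grassmann_graph k) \<and> (\<forall>Y\<in>NC k. g Y = f Y)"
proof -
  interpret code_embedding f k by (rule f)
  from star_or_dual show ?thesis
  proof
    assume "\<forall>S\<in>NC (k - 1). star_type S"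
    then have "star_embedding f k" using f by (simp add: star_embedding_def star_embedding_axioms_def)
    then obtain b where b: "collineation b" "\<forall>Y\<in>NC k. f Y = b ` Y" using star_embedding_collineation qk by blast
    interpret collineation b by (rule b)
    have "graph_aut ((`) b) (grassmann_graph k)"
      using image_Gr dim_image_Int b_inj by (intro graph_autI) (auto simp: mem_Gr inj_on_def inj_image_eq_iff)
    then show ?thesis using b(2) by (intro exI[of _ "(`) b"]) auto
  next
    assume dual: "CARD('n) = 2 * k \<and> (\<forall>S\<in>NC (k - 1). top_type S)"
    then have n: "CARD('n) = 2 * k" by blast
    have perp_k: "perp X \<in> Gr k" if "X \<in> Gr k" for X :: "('a ^ 'n) set"
      using perp_Gr[OF that] n by simp
    have dim_perp_k: "vec.dim (perp X \<inter> perp Y) = vec.dim (X \<inter> Y)" if "X \<in> Gr k" "Y \<in> Gr k" for X Y :: "('a ^ 'n) set"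
      using dim_perp_Int_perp[of X Y] that n by (simp add: mem_Gr)
    let ?f = "\<lambda>Y. perp (f Y)"
    have ce: "code_embedding ?f k"
    proof
      show "2 \<le> k" "k + 2 \<le> CARD('n)" by (rule k2 kn)+
      show "perp (f Y) \<in> Gr k" if "Y \<in> NC k" for Y using perp_k f_Gr that by blast
      show "inj_on ?f (NC k)"
        using f_inj f_Gr by (auto simp: inj_on_def perp_eq_iff mem_Gr)
      show "adjacent k (perp (f Y)) (perp (f Z))" if "Y \<in> NC k" "Z \<in> NC k" "adjacent k Y Z" for Y Z
        using f_adj[OF that] perp_k dim_perp_k by (simp add: adjacent_def)
    qed
    then interpret d: code_embedding ?f k .
    have "d.star_type S" if S: "S \<in> NC (k - 1)" for S
    proof -
      obtain W where W: "W \<in> Gr (Suc k)" "f ` star k S \<subseteq> top_of k W" using dual S by (auto simp: top_type_def)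
      have "perp W \<in> Gr (k - 1)" using perp_Gr[OF W(1)] n by simp
      moreover have "?f ` star k S \<subseteq> star k (perp W)"
      proof (rule image_subsetI)
        fix Y assume "Y \<in> star k S"
        then have "f Y \<in> top_of k W" using W(2) by blast
        then show "perp (f Y) \<in> star k (perp W)"
          using perp_k[of "f Y"] perp_antimono[of "f Y" W] by (simp add: top_of_def star_def)
      qed
      ultimately show ?thesis unfolding d.star_type_def by blast
    qed
    then have "star_embedding ?f k" using ce by (simp add: star_embedding_def star_embedding_axioms_def)
    then obtain b where b: "collineation b" "\<forall>Y\<in>NC k. perp (f Y) = b ` Y"
      using star_embedding_collineation[of ?f k] qk by blast
    interpret collineation b by (rule b)
    let ?g = "\<lambda>X. perp (b ` X)"
    have "graph_aut ?g (grassmann_graph k)"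
    proof (rule graph_autI)
      show "perp (b ` X) \<in> Gr k" if "X \<in> Gr k" for X using perp_k image_Gr that by blast
      show "inj_on ?g (Gr k)"
        using b_inj by (auto simp: inj_on_def perp_eq_iff mem_Gr subspace_image inj_image_eq_iff)
      show "vec.dim (perp (b ` X) \<inter> perp (b ` Y)) = vec.dim (X \<inter> Y)" if "X \<in> Gr k" "Y \<in> Gr k" for X Y
        using dim_perp_k[OF image_Gr image_Gr] that dim_image_Int by (simp add: mem_Gr)
    qed
    moreover have "perp (b ` Y) = f Y" if "Y \<in> NC k" for Y
    proof -
      have "perp (b ` Y) = perp (perp (f Y))" using b(2) that by simp
      then show ?thesis using perp_perp[OF subspace_Gr[OF f_Gr[OF that]]] by simp
    qed
    ultimately show ?thesis by blast
  qed
qed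

section \<open>Degenerate codes are determined by their nondegenerate neighbours\<close>

definition coord_space :: "'n set \<Rightarrow> ('a::field ^ 'n::finite) set" where
  "coord_space I = {x. \<forall>i. i \<notin> I \<longrightarrow> x $ i = 0}"

lemma subspace_coord_space: "vec.subspace (coord_space I)"
  by (auto simp: coord_space_def vec.subspace_def)

lemma dim_coord_space: "vec.dim (coord_space I :: ('a::field ^ 'n::finite) set) = card I"
  unfolding coord_space_def by (rule dim_substandard_cart)

lemma coord_space_least:
  fixes V :: "('a::field ^ 'n::finite) set"
  assumes V: "vec.subspace V" and ax: "\<And>i. i \<in> I \<Longrightarrow> axis i 1 \<in> V"
  shows "coord_space I \<subseteq> V"
proof
  fix x :: "'a ^ 'n" assume x: "x \<in> coord_space I"
  have "x $ j *s axis j 1 \<in> V" for j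
    using ax[of j] x vec.subspace_scale[OF V] vec.subspace_0[OF V] by (cases "j \<in> I") (auto simp: coord_space_def)
  then have "(\<Sum>j\<in>UNIV. x $ j *s axis j 1) \<in> V" by (intro vec.subspace_sum V)
  then show "x \<in> V" by (simp add: basis_expansion)
qed

definition supp :: "('a::field ^ 'n::finite) set \<Rightarrow> 'n set" where
  "supp X = {i. \<exists>x\<in>X. x $ i \<noteq> 0}"

context
  fixes k :: nat and X X' :: "('a::{field,finite} ^ 'n::finite) set"
  assumes k2: "2 \<le> k" and X: "X \<in> Gr k" "X \<notin> NC k" and X': "X' \<in> Gr k" "X' \<notin> NC k"
    and nbr: "\<And>Z. Z \<in> NC k \<Longrightarrow> adjacent k Z X \<Longrightarrow> adjacent k Z X'"
begin

text \<open>For a hyperplane \<open>R\<close> of \<open>X\<close>, the code spanned by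
  \<open>R\<close> and \<open>1\<close> is a nondegenerate neighbour of \<open>X\<close>, hence of
  \<open>X'\<close>. As \<open>1 \<notin> X'\<close>, it is spanned by \<open>1\<close> and its part
  in \<open>X'\<close>.\<close>

lemma nbr_span_1: "X \<subseteq> adjoin 1 X'"
proof
  fix x assume "x \<in> X"
  then obtain R where R: "R \<in> Gr (k - 1)" "x \<in> R" "R \<subseteq> X" using exists_hyperplane_through[OF X(1) k2] by blast
  have sk: "Suc (k - 1) = k" using k2 by simp
  have n1: "1 \<notin> X" "1 \<notin> X'" using X X' NC_full[OF full_1] by blast+
  let ?Z = "adjoin 1 R"
  note Z = adjacent_exchange[OF X(1) k2 R(1,3) n1(1)]
  have ZN: "?Z \<in> NC k" using NC_full[OF full_1 mem_span_insert1 Z(1)] .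
  have "adjacent k ?Z X'" using nbr[OF ZN] Z(2) adjacent_commute[of k X] by blast
  then have I: "?Z \<inter> X' \<in> Gr (k - 1)" using Int_Gr_adjacent[of "k - 1"] sk by metis
  have "adjoin 1 (?Z \<inter> X') = ?Z"
    using I Z(1) n1 mem_span_insert1[of 1 R] sk by (intro span_insert_eq[of _ "k - 1"]) auto
  moreover have "adjoin 1 (?Z \<inter> X') \<subseteq> adjoin 1 X'" by (intro vec.span_mono) blast
  ultimately show "x \<in> adjoin 1 X'" using R(2) subset_span_insert[of R 1] by blast
qed

text \<open>Otherwise a vector \<open>r\<close> of \<open>X\<close> outside \<open>X'\<close> with
  \<open>r $ i \<noteq> 0\<close>, together with \<open>1 + axis i 1\<close>, makes
  \<open>?Z\<close> a nondegenerate neighbour of \<open>X\<close>. It meets \<open>X'\<close>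
  exactly in \<open>R\<close>, which contains \<open>r\<close>.\<close>

lemma nbr_axis:
  assumes sub: "X' \<subseteq> adjoin 1 X" and ne: "X \<noteq> X'" and i: "i \<in> supp X"
  shows "axis i 1 \<in> adjoin 1 X"
proof (rule ccontr)
  let ?V = "adjoin 1 X" and ?z = "1 + axis i 1 :: 'a ^ 'n"
  assume ax: "axis i 1 \<notin> ?V"
  have sk: "Suc (k - 1) = k" using k2 by simp
  have Xs: "vec.subspace X" "vec.subspace X'" using X X' subspace_Gr by blast+
  obtain d where d: "d \<in> X" "d \<notin> X'" using ne Gr_eqI X X' by blast
  obtain y where y: "y \<in> X" "y $ i \<noteq> 0" using i by (auto simp: supp_def)
  have "\<exists>r\<in>X. r \<notin> X' \<and> r $ i \<noteq> 0"
  proof (cases "d $ i \<noteq> 0 \<or> y \<notin> X'")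
    case True
    then show ?thesis using d y by blast
  next
    case False
    have "d + y \<notin> X'"
    proof
      assume "d + y \<in> X'"
      then have "d + y - y \<in> X'" using False Xs vec.subspace_diff by blast
      then show False using d by simp
    qed
    moreover have "(d + y) $ i \<noteq> 0" using False y by simp
    moreover have "d + y \<in> X" using d y Xs vec.subspace_add by blast
    ultimately show ?thesis by blast
  qed
  then obtain r where r: "r \<in> X" "r \<notin> X'" "r $ i \<noteq> 0" by blast
  have zV: "?z \<notin> ?V"
  proof
    assume "?z \<in> ?V"
    then have "?z - 1 \<in> ?V" by (rule vec.span_diff[OF _ mem_span_insert1])
    then show False using ax by simp
  qed
  obtain R where R: "R \<in> Gr (k - 1)" "r \<in> R" "R \<subseteq> X" using exists_hyperplane_through[OF X(1) k2 r(1)] by blast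
  have XV: "X \<subseteq> ?V" by (rule subset_span_insert)
  let ?Z = "adjoin ?z R"
  have "?z \<notin> X" using zV XV by blast
  note Z = adjacent_exchange[OF X(1) k2 R(1,3) this]
  have "\<exists>x\<in>?Z. x $ j \<noteq> 0" for j
  proof (cases "j = i")
    case True
    then show ?thesis using r R by (intro bexI[of _ r]) (auto intro: vec.span_base)
  next
    case False
    then show ?thesis by (intro bexI[of _ ?z] mem_span_insert1) (simp add: axis_def)
  qed
  then have ZN: "?Z \<in> NC k" using Z(1) by (simp add: mem_NC)
  have "adjacent k ?Z X'" using nbr[OF ZN] Z(2) adjacent_commute[of k X] by blast
  then have I: "?Z \<inter> X' \<in> Gr (k - 1)" using Int_Gr_adjacent[of "k - 1"] sk by metis
  have "?Z \<inter> X' \<subseteq> R"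
  proof
    fix x assume x: "x \<in> ?Z \<inter> X'"
    then have "x \<in> ?Z" by blast
    then have "\<exists>c. \<exists>w\<in>R. x = c *s ?z + w" by (rule iffD1[OF span_insert_iff[OF subspace_Gr[OF R(1)]]])
    then obtain c w where cw: "w \<in> R" "x = c *s ?z + w" by blast
    have "x \<in> ?V" "w \<in> ?V" using x sub cw R XV by blast+
    then have "x - w \<in> ?V" by (rule vec.span_diff)
    then have cz: "c *s ?z \<in> ?V" using cw by simp
    have "c = 0"
    proof (rule ccontr)
      assume "c \<noteq> 0"
      then have "inverse c *s (c *s ?z) = ?z" by simp
      then show False using vec.span_scale[OF cz, of "inverse c"] zV by metis
    qed
    then show "x \<in> R" using cw by simp
  qed
  then have "?Z \<inter> X' = R" using Gr_eqI[OF I R(1)] by blast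
  then show False using r R by blast
qed

text \<open>The coordinate subspace of the support lies between \<open>X\<close> and
  \<open>adjoin 1 X\<close>, and it omits \<open>1\<close> because \<open>X\<close> is
  degenerate.\<close>

lemma nbr_coord_space:
  assumes sub: "X' \<subseteq> adjoin 1 X" and ne: "X \<noteq> X'"
  shows "X = coord_space (supp X)"
proof (rule vec.subspace_dim_equal)
  let ?V = "adjoin 1 X" and ?A = "coord_space (supp X) :: ('a ^ 'n) set"
  show XA: "X \<subseteq> ?A" by (auto simp: coord_space_def supp_def)
  show "vec.subspace X" using subspace_Gr X by blast
  show "vec.subspace (?A)" by (rule subspace_coord_space)
  have AV: "?A \<subseteq> ?V" using nbr_axis[OF sub ne] by (intro coord_space_least) auto
  obtain j where j: "j \<notin> supp X" using X by (auto simp: mem_NC supp_def)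
  then have "1 \<notin> ?A" by (auto simp: coord_space_def)
  then have "?A \<noteq> ?V" using mem_span_insert1 by blast
  then have "vec.dim ?A < vec.dim ?V"
    using vec.subspace_dim_equal[OF subspace_coord_space vec.subspace_span AV] not_le_imp_less by metis
  moreover have "vec.dim ?V = k + 1"
    using dim_span_insert[OF subspace_Gr[OF X(1)]] dim_Gr[OF X(1)] NC_full[OF full_1 _ X(1)] X(2) by auto
  ultimately show "vec.dim (?A) \<le> vec.dim X" using dim_Gr[OF X(1)] by linarith
qed

end

lemma same_neighbours_eq:
  fixes X X' :: "('a::{field,finite} ^ 'n::finite) set"
  assumes k2: "2 \<le> k" and kn: "k + 2 \<le> CARD('n)"
    and X: "X \<in> Gr k" "X \<notin> NC k" and X': "X' \<in> Gr k" "X' \<notin> NC k"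
    and nbr: "\<And>Z. Z \<in> NC k \<Longrightarrow> adjacent k Z X \<longleftrightarrow> adjacent k Z X'"
  shows "X = X'"
proof (rule ccontr)
  assume ne: "X \<noteq> X'"
  have sub: "X \<subseteq> adjoin 1 X'" "X' \<subseteq> adjoin 1 X"
    using nbr_span_1[OF k2 X X'] nbr_span_1[OF k2 X' X] nbr by blast+
  have eq: "X = coord_space (supp X)" "X' = coord_space (supp X')"
    using nbr_coord_space[OF k2 X X' _ sub(2) ne] nbr_coord_space[OF k2 X' X _ sub(1) ne[symmetric]] nbr by blast+
  have card: "card (supp X') = k" using dim_coord_space[of "supp X'", where 'a='a] eq(2) dim_Gr[OF X'(1)] by metis
  have "coord_space (supp X) \<subseteq> X'"
  proof (rule coord_space_least[OF subspace_Gr[OF X'(1)]])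
    fix i assume "i \<in> supp X"
    then have "axis i 1 \<in> coord_space (supp X)" by (auto simp: coord_space_def axis_def)
    then have "axis i 1 \<in> adjoin 1 X'" using eq sub by blast
    then have "\<exists>c. \<exists>w\<in>X'. axis i 1 = c *s 1 + w" by (rule iffD1[OF span_insert_iff[OF subspace_Gr[OF X'(1)]]])
    then obtain c w where cw: "w \<in> X'" "axis i 1 = c *s 1 + w" by blast
    have "c = 0"
    \<comment> \<open>A nonzero \<open>c\<close> would force n - 1 coordinates into the support of
      \<open>X'\<close>, which has only k < n - 1.\<close>
    proof (rule ccontr)
      assume c: "c \<noteq> 0"
      have "UNIV - {i} \<subseteq> supp X'"
      proof
        fix j assume "j \<in> UNIV - {i}"
        then have "c + w $ j = 0" using arg_cong[OF cw(2), of "\<lambda>v. v $ j"] by (simp add: axis_def)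
        then have "w $ j \<noteq> 0" using c by auto
        then show "j \<in> supp X'" using cw(1) by (auto simp: supp_def)
      qed
      then have "card (UNIV - {i}) \<le> card (supp X')" by (intro card_mono) auto
      then show False using card kn by (simp add: card_Diff_subset)
    qed
    then show "axis i 1 \<in> X'" using cw by simp
  qed
  then show False using eq ne Gr_eqI X X' by metis
qed

text \<open>If \<open>X'\<close> is the vertex with \<open>g' X' = g X\<close>, then
  \<open>X\<close> and \<open>X'\<close> have the same nondegenerate neighbours, since the two
  automorphisms agree on those.\<close>

lemma extension_unique:
  fixes g g' :: "('a::{field,finite} ^ 'n::finite) set \<Rightarrow> ('a ^ 'n) set"
  assumes k2: "2 \<le> k" and kn: "k + 2 \<le> CARD('n)"
    and g: "graph_aut g (grassmann_graph k)" and g': "graph_aut g' (grassmann_graph k)"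
    and eq: "\<And>Y. Y \<in> NC k \<Longrightarrow> g Y = g' Y" and X: "X \<in> Gr k"
  shows "g X = g' X"
proof (cases "X \<in> NC k")
  case False
  have bij: "bij_betw g (Gr k) (Gr k)" "bij_betw g' (Gr k) (Gr k)"
    using g g' by (simp_all add: graph_aut_def graph_iso_def)
  then have "g X \<in> g' ` Gr k" using X by (auto simp: bij_betw_def)
  then obtain X' where X': "X' \<in> Gr k" "g X = g' X'" by blast
  have "X' \<notin> NC k"
  proof
    assume "X' \<in> NC k"
    then have "g X = g X'" using X' eq by simp
    then have "X = X'" using bij(1) X X' by (auto simp: bij_betw_def dest: inj_onD)
    then show False using False \<open>X' \<in> NC k\<close> by simp
  qed
  moreover have "adjacent k Z X \<longleftrightarrow> adjacent k Z X'" if Z: "Z \<in> NC k" for Z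
    using graph_aut_adjacent[OF g NC_Gr[OF Z] X] graph_aut_adjacent[OF g' NC_Gr[OF Z] X'(1)] eq[OF Z] X' by simp
  ultimately have "X = X'" using same_neighbours_eq[OF k2 kn X False X'(1)] by blast
  then show ?thesis using X' by simp
qed (use eq in simp)

section \<open>Non-extendable embeddings for lines over the two-element field\<close>

context
  fixes i0 :: "'n::finite"
  assumes q2: "CARD('a::{field,finite}) = 2" and n4: "4 \<le> CARD('n)"
begin

text \<open>Projection from the point \<open>1\<close> onto a fixed coordinate hyperplane; lines
  through the centre are left unchanged.\<close>

definition project :: "('a ^ 'n) set \<Rightarrow> ('a ^ 'n) set" where
  "project L = (if 1 \<in> L then L else adjoin 1 L \<inter> coord_hyperplane i0)"

lemma hyperplane_coord_space: "coord_hyperplane i0 = (coord_space (- {i0}) :: ('a ^ 'n) set)"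
  by (auto simp: coord_hyperplane_def coord_space_def)

lemma project_Gr:
  assumes L: "L \<in> Gr 2" shows "project L \<in> Gr 2"
proof (cases "1 \<in> L")
  case False
  let ?M = "adjoin 1 L" and ?C = "coord_hyperplane i0 :: ('a ^ 'n) set"
  have M: "?M \<in> Gr 3" using plane_Gr[OF L False] .
  have C: "vec.subspace ?C" "vec.dim ?C = CARD('n) - 1"
    unfolding hyperplane_coord_space by (simp_all add: subspace_coord_space dim_coord_space Compl_eq_Diff_UNIV card_Diff_subset)
  have "vec.dim ?M + vec.dim ?C \<le> vec.dim (UNIV :: ('a ^ 'n) set) + vec.dim (?M \<inter> ?C)"
    using C by (intro meet_in_hyperplane) auto
  then have ge: "2 \<le> vec.dim (?M \<inter> ?C)" using C(2) dim_Gr[OF M] n4 by (simp only: vec_dim_card)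
  have "1 \<notin> ?C" by (simp add: coord_hyperplane_def)
  then have "?M \<inter> ?C \<noteq> ?M" using mem_span_insert1[of 1 L] by blast
  then have "vec.dim (?M \<inter> ?C) < 3"
    using vec.subspace_dim_equal[OF vec.subspace_inter[OF vec.subspace_span C(1)] vec.subspace_span Int_lower1, of "insert 1 L"] dim_Gr[OF M]
      not_le_imp_less by metis
  then show ?thesis using ge False C by (simp add: project_def mem_Gr vec.subspace_inter)
qed (use L in \<open>simp add: project_def\<close>)

lemma one_mem_project: "1 \<in> project L \<longleftrightarrow> 1 \<in> L"
  by (simp add: project_def coord_hyperplane_def)

lemma span_project:
  assumes L: "L \<in> Gr 2" "1 \<notin> L" shows "adjoin 1 (project L) = adjoin 1 L"
proof (rule span_insert_eq[of _ 2])
  show "project L \<in> Gr 2" using project_Gr L by blast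
  show "adjoin 1 L \<in> Gr (Suc 2)" using plane_Gr[OF L] by simp
  show "1 \<notin> project L" using one_mem_project L by blast
qed (use L mem_span_insert1 in \<open>auto simp: project_def\<close>)

text \<open>Two such lines meet in some \<open>r\<close>, which vanishes at a coordinate
  \<open>i\<close> as it is not \<open>1\<close>. A vector \<open>x'\<close> of \<open>L'\<close>
  with nonzero entry there is \<open>1 + z\<close> with \<open>z\<close> in \<open>L\<close>; then
  \<open>z\<close> vanishes at \<open>i\<close>, so it is a multiple of \<open>r\<close>, and
  \<open>1 = x' - z\<close> falls into \<open>L'\<close>.\<close>

lemma nondegenerate_line_unique:
  assumes L: "L \<in> NC 2" "1 \<notin> L" and L': "L' \<in> NC 2" "1 \<notin> L'"
    and eq: "adjoin 1 L = adjoin 1 L'"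
  shows "L = (L' :: ('a ^ 'n) set)"
proof (rule ccontr)
  assume ne: "L \<noteq> L'"
  let ?M = "adjoin 1 L"
  have LG: "L \<in> Gr 2" "L' \<in> Gr 2" using L L' NC_Gr by blast+
  have s: "vec.subspace L" "vec.subspace L'" using LG subspace_Gr by blast+
  have "adjacent 2 L L'"
  proof (rule adjacentI_sup(1)[OF LG ne])
    show "?M \<in> Gr (Suc 2)" using plane_Gr[OF LG(1) L(2)] by simp
    show "L \<subseteq> ?M" by (rule subset_span_insert)
    show "L' \<subseteq> ?M" unfolding eq by (rule subset_span_insert)
  qed
  then have "L \<inter> L' \<in> Gr 1" using Int_Gr_adjacent[of 1 L L'] by (simp add: numeral_2_eq_2)
  then obtain r where r: "r \<noteq> 0" "L \<inter> L' = pt r" by (rule Gr1_obtain)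
  have rL: "r \<in> L" "r \<in> L'" using r vec.span_base[of r "{r}"] by blast+
  have "\<exists>i. r $ i = 0"
  proof (rule ccontr)
    assume "\<nexists>i. r $ i = 0"
    then have "r $ i = 1" for i using binary_cases[OF q2, of "r $ i"] by auto
    then have "r = 1" by (simp add: vec_eq_iff)
    then show False using L rL by simp
  qed
  then obtain i where i: "r $ i = 0" by blast
  obtain x where x: "x \<in> L" "x $ i \<noteq> 0" using L(1) unfolding mem_NC by blast
  obtain x' where x': "x' \<in> L'" "x' $ i \<noteq> 0" using L'(1) unfolding mem_NC by blast
  have "x' \<in> ?M" using x' subset_span_insert[of L' 1] eq by blast
  then have "\<exists>c. \<exists>z\<in>L. x' = c *s 1 + z" by (rule iffD1[OF span_insert_iff[OF s(1)]])
  then obtain c z where z: "z \<in> L" "x' = c *s 1 + z" by blast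
  have "c \<noteq> 0"
  proof
    assume "c = 0"
    then have "x' \<in> L \<inter> L'" using z x' by simp
    then show False using r(2) x' i mem_span_singleton[of x' r] by auto
  qed
  then have c: "c = 1" using binary_cases[OF q2, of c] by blast
  then have "1 + z $ i = 1" using z x' binary_cases[OF q2, of "x' $ i"] by simp
  then have zi: "z $ i = 0" by simp
  have "x \<notin> pt r" using x i mem_span_singleton[of x r] by auto
  then have "adjoin x (pt r) = L"
    using span_insert_eq[OF point_Gr[OF r(1)], of L x] LG r x by (auto simp: numeral_2_eq_2)
  then have "z \<in> adjoin x (pt r)" using z by simp
  then have "\<exists>a. \<exists>w\<in>pt r. z = a *s x + w" by (rule iffD1[OF span_insert_iff[OF vec.subspace_span]])
  then obtain a d where "z = a *s x + d *s r" using mem_span_singleton by metis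
  then have zr: "z = d *s r" using zi i x by simp
  have "x' - d *s r \<in> L'" using x' rL s by (intro vec.subspace_diff vec.subspace_scale)
  then have "1 \<in> L'" using z(2) c zr by simp
  then show False using L' by blast
qed

lemma inj_project: "inj_on project (NC 2)"
proof (rule inj_onI)
  fix L L' :: "('a ^ 'n) set" assume L: "L \<in> NC 2" "L' \<in> NC 2" and eq: "project L = project L'"
  show "L = L'"
  proof (cases "1 \<in> L")
    case True
    then have "1 \<in> L'" using eq one_mem_project by blast
    then show ?thesis using True eq by (simp add: project_def)
  next
    case False
    then have "1 \<notin> L'" using eq one_mem_project by blast
    then show ?thesis using nondegenerate_line_unique[OF L(1) False L(2)] span_project[OF NC_Gr[OF L(1)] False]
        span_project[OF NC_Gr[OF L(2)]] eq by simp
  qed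
qed

lemma project_mem:
  assumes L: "vec.subspace L" and r: "r \<in> adjoin 1 L"
  shows "r - r $ i0 *s 1 \<in> project L"
proof (cases "1 \<in> L")
  case True
  then have "adjoin 1 L = L" using L by (simp add: insert_absorb span_subspace)
  then have "r - r $ i0 *s 1 \<in> L" using True r L by (intro vec.subspace_diff vec.subspace_scale) auto
  then show ?thesis using True by (simp add: project_def)
next
  case False
  have "r - r $ i0 *s 1 \<in> adjoin 1 L" using r by (intro vec.span_diff vec.span_scale mem_span_insert1)
  then show ?thesis using False by (simp add: project_def coord_hyperplane_def)
qed

text \<open>The spans with \<open>1\<close> need only share a vector outside the point of
  \<open>1\<close>. This is weaker than adjacency of the lines and is the source of new
  edges.\<close>

lemma project_adjacentI:
  assumes L: "L \<in> NC 2" "L' \<in> NC 2" "L \<noteq> L'"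
    and r: "r \<in> adjoin 1 L" "r \<in> adjoin 1 L'" "r \<notin> pt 1"
  shows "adjacent 2 (project L) (project L')"
proof (rule lines_meet(1)[where P = "pt (r - r $ i0 *s 1)"])
  let ?t = "r - r $ i0 *s 1"
  show G: "project L \<in> Gr 2" "project L' \<in> Gr 2" using project_Gr NC_Gr L by blast+
  show "project L \<noteq> project L'" using inj_project L by (auto dest: inj_onD)
  have "?t \<noteq> 0" using r(3) mem_span_singleton[of r 1] by auto
  then show "pt ?t \<in> Gr 1" by (rule point_Gr)
  have "?t \<in> project L" "?t \<in> project L'" using project_mem subspace_Gr NC_Gr L r by blast+
  then show "pt ?t \<subseteq> project L" "pt ?t \<subseteq> project L'"
    using vec.span_minimal[of "{?t}"] subspace_Gr[OF G(1)] subspace_Gr[OF G(2)] by simp_all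
qed

lemma project_adjacent:
  assumes L: "L \<in> NC 2" "L' \<in> NC 2" "adjacent 2 L L'"
  shows "adjacent 2 (project L) (project L')"
proof (cases "1 \<in> L \<and> 1 \<in> L'")
  case True
  then show ?thesis using L by (simp add: project_def)
next
  case False
  have I: "L \<inter> L' \<in> Gr 1" using Int_Gr_adjacent[of 1 L L'] L by (simp add: numeral_2_eq_2)
  then obtain r where r: "r \<noteq> 0" "L \<inter> L' = pt r" by (rule Gr1_obtain)
  then have rL: "r \<in> L" "r \<in> L'" using vec.span_base[of r "{r}"] by blast+
  have "r \<notin> pt 1"
  proof
    assume "r \<in> pt 1"
    then have "pt r = pt 1" using r(1) Gr1_span[of "pt 1" r] point_Gr[of 1] by (simp add: vec_eq_iff)
    then have "1 \<in> L \<inter> L'" using r(2) vec.span_base[of 1 "{1}"] by blast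
    then show False using False by blast
  qed
  moreover have "r \<in> adjoin 1 L" "r \<in> adjoin 1 L'" using rL by (auto intro: vec.span_base)
  ultimately show ?thesis using project_adjacentI[OF L(1,2) adjacent_neq[OF L(3)]] by blast
qed

lemma project_creates_edge:
  obtains L L' where "L \<in> NC 2" "L' \<in> NC 2" "\<not> adjacent 2 L L'" "adjacent 2 (project L) (project L')"
proof -
  obtain A :: "'n set" where A: "card A = 4" using obtain_subset_with_card_n[OF n4] by blast
  then obtain xs where xs: "set xs = A" "length xs = 4" "distinct xs" using finite_distinct_list[of A] distinct_card by fastforce
  then obtain i1 i2 i3 i4 where "xs = [i1, i2, i3, i4]" by (auto simp: length_Suc_conv numeral_eq_Suc)
  then have ne: "i1 \<noteq> i2" "i1 \<noteq> i3" "i1 \<noteq> i4" "i2 \<noteq> i3" "i2 \<noteq> i4" "i3 \<noteq> i4" using xs(3) by auto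
  \<comment> \<open>The two lines meet only in 0, but \<open>a + b\<close> is
    \<open>axis i1 1 + axis i2 1\<close> and \<open>c + d\<close> is \<open>1\<close> plus that
    vector: they differ by the centre of projection.\<close>
  define a b c d where "a = (1 + axis i1 1 :: 'a ^ 'n)" and "b = (1 + axis i2 1 :: 'a ^ 'n)"
    and "c = (1 + axis i3 1 :: 'a ^ 'n)" and "d = (axis i1 1 + axis i2 1 + axis i3 1 :: 'a ^ 'n)"
  note defs = a_def b_def c_def d_def
  have at: "a $ i1 = 0" "a $ i2 = 1" "a $ i3 = 1" "a $ i4 = 1" "b $ i1 = 1" "b $ i2 = 0" "b $ i3 = 1" "b $ i4 = 1"
    "c $ i1 = 1" "c $ i2 = 1" "c $ i3 = 0" "c $ i4 = 1" "d $ i1 = 1" "d $ i2 = 1" "d $ i3 = 1" "d $ i4 = 0"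
    using ne by (simp_all add: defs axis_def binary_two[OF q2])
  define L L' where "L = adjoin b (pt a)" and "L' = adjoin d (pt c)"
  have nz: "a \<noteq> 0" "c \<noteq> 0" using at(2,9) by (metis zero_index zero_neq_one)+
  have ba: "b \<notin> pt a"
  proof
    assume "b \<in> pt a"
    then obtain t where "b = t *s a" using mem_span_singleton by blast
    then show False using arg_cong[of b "t *s a" "\<lambda>v. v $ i1"] at by simp
  qed
  have dc: "d \<notin> pt c"
  proof
    assume "d \<in> pt c"
    then obtain t where "d = t *s c" using mem_span_singleton by blast
    then show False using arg_cong[of d "t *s c" "\<lambda>v. v $ i3"] at by simp
  qed
  have G: "L \<in> Gr 2" "L' \<in> Gr 2" using line_Gr nz ba dc by (auto simp: L_def L'_def)
  have mem: "a \<in> L" "b \<in> L" "c \<in> L'" "d \<in> L'" by (auto simp: L_def L'_def intro: vec.span_base)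
  have "\<exists>x\<in>L. x $ j \<noteq> 0" for j
  proof (cases "j = i1")
    case True
    then show ?thesis using mem at by (intro bexI[of _ b]) auto
  next
    case False
    then show ?thesis using mem by (intro bexI[of _ a]) (auto simp: a_def axis_def)
  qed
  moreover have "\<exists>x\<in>L'. x $ j \<noteq> 0" for j
  proof (cases "j = i3")
    case True
    then show ?thesis using mem at by (intro bexI[of _ d]) auto
  next
    case False
    then show ?thesis using mem by (intro bexI[of _ c]) (auto simp: c_def axis_def)
  qed
  ultimately have N: "L \<in> NC 2" "L' \<in> NC 2" using G by (simp_all add: mem_NC)
  have "L \<inter> L' \<subseteq> {0}"
  proof
    fix v assume v: "v \<in> L \<inter> L'"
    have "v \<in> L" "v \<in> L'" using v by blast+
    have "\<exists>s. \<exists>w\<in>pt a. v = s *s b + w" using \<open>v \<in> L\<close> unfolding L_def by (rule iffD1[OF span_insert_iff[OF vec.subspace_span]])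
    then obtain s t where st: "v = s *s b + t *s a" using mem_span_singleton by metis
    have "\<exists>s. \<exists>w\<in>pt c. v = s *s d + w" using \<open>v \<in> L'\<close> unfolding L'_def by (rule iffD1[OF span_insert_iff[OF vec.subspace_span]])
    then obtain s' t' where st': "v = s' *s d + t' *s c" using mem_span_singleton by metis
    have e: "s * b $ j + t * a $ j = s' * d $ j + t' * c $ j" for j
      using arg_cong[OF st, of "\<lambda>v. v $ j"] arg_cong[OF st', of "\<lambda>v. v $ j"] by simp
    have "s = s' + t'" "t = s' + t'" "s + t = s'" "s + t = t'" using e[of i1] e[of i2] e[of i3] e[of i4] at by simp_all
    moreover have "x + x = 0" for x :: 'a using binary_two[OF q2] mult_2[of x] by simp
    ultimately have "s' = 0" "t' = 0" by metis+
    then show "v \<in> {0}" using st' by simp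
  qed
  then have "vec.dim (L \<inter> L') = 0" by (simp only: vec.dim_eq_0)
  then have nadj: "\<not> adjacent 2 L L'" unfolding adjacent_def by linarith
  have "L \<noteq> L'" using \<open>L \<inter> L' \<subseteq> {0}\<close> mem nz by blast
  moreover have "a + b \<in> adjoin 1 L"
    using mem by (intro vec.span_add) (auto intro: vec.span_base)
  moreover have "a + b = c + d - 1"
  proof -
    have "(2 :: 'a ^ 'n) = 0" using binary_two[OF q2] by (simp add: vec_eq_iff)
    moreover have "x + x = 0" for x :: "'a ^ 'n" using \<open>2 = (0 :: 'a ^ 'n)\<close> mult_2[of x] by simp
    ultimately show ?thesis by (simp add: defs algebra_simps)
  qed
  then have "a + b \<in> adjoin 1 L'"
    using mem by (auto intro!: vec.span_diff[OF vec.span_add] intro: vec.span_base)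
  moreover have "a + b \<notin> pt 1"
  proof
    assume "a + b \<in> pt 1"
    then obtain t where t: "a + b = t *s 1" using mem_span_singleton by blast
    have "t = 1" "t = 2" using arg_cong[OF t, of "\<lambda>v. v $ i1"] arg_cong[OF t, of "\<lambda>v. v $ i3"] at by auto
    then show False using binary_two[OF q2] by simp
  qed
  ultimately have "adjacent 2 (project L) (project L')" using project_adjacentI[OF N] by blast
  then show ?thesis using that N nadj by blast
qed

text \<open>The graph \<open>H\<close> keeps only the edges inherited from the code graph, so it
  lacks the Grassmann edge created by \<open>project\<close>. An automorphism preserves and reflects
  adjacency, so any extension would make that edge an edge of \<open>H\<close>; this excludes every
  isomorphism in either direction, not just \<open>project\<close>.\<close>

lemma binary_lines_not_extendable:
  "\<exists>H :: ('a ^ 'n) set ugraph.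
      is_subgraph H (grassmann_graph 2) \<and>
      (\<exists>f. graph_iso f (code_graph 2 :: ('a ^ 'n) set ugraph) H) \<and>
      (\<forall>f. graph_iso f (code_graph 2) H \<longrightarrow>
         \<not> (\<exists>g. graph_aut g (grassmann_graph 2) \<and> (\<forall>C\<in>verts (code_graph 2). g C = f C))) \<and>
      (\<forall>f. graph_iso f H (code_graph 2) \<longrightarrow>
         \<not> (\<exists>g. graph_aut g (grassmann_graph 2) \<and> (\<forall>C\<in>verts H. g C = f C)))"
proof -
  define H :: "('a ^ 'n) set ugraph" where
    "H = \<lparr>verts = project ` NC 2, edges = {{project X, project Y} | X Y. X \<in> NC 2 \<and> Y \<in> NC 2 \<and> adjacent 2 X Y}\<rparr>"
  have vH: "verts H = project ` NC 2" by (simp add: H_def)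
  have eH: "{project X, project Y} \<in> edges H \<longleftrightarrow> adjacent 2 X Y" if "X \<in> NC 2" "Y \<in> NC 2" for X Y
  proof
    assume "{project X, project Y} \<in> edges H"
    then obtain S T where ST: "{project X, project Y} = {project S, project T}" "S \<in> NC 2" "T \<in> NC 2" "adjacent 2 S T"
      by (auto simp: H_def)
    then have "X = S \<and> Y = T \<or> X = T \<and> Y = S"
      using that inj_project unfolding doubleton_eq_iff by (meson inj_onD)
    then show "adjacent 2 X Y" using ST(4) adjacent_commute[of 2 S T] by blast
  qed (use that in \<open>auto simp: H_def\<close>)
  have "is_subgraph H (grassmann_graph 2)"
    unfolding is_subgraph_def
  proof (intro conjI)
    show "wf_ugraph H" unfolding wf_ugraph_def
    proof
      fix e assume "e \<in> edges H"
      then obtain X Y where XY: "e = {project X, project Y}" "X \<in> NC 2" "Y \<in> NC 2" "adjacent 2 X Y" by (auto simp: H_def)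
      moreover have "project X \<noteq> project Y" using adjacent_neq project_adjacent XY by blast
      ultimately show "e \<in> {{x, y} |x y. x \<in> verts H \<and> y \<in> verts H \<and> x \<noteq> y}" unfolding vH by blast
    qed
    show "verts H \<subseteq> verts (grassmann_graph 2)" using project_Gr NC_Gr by (auto simp: vH)
    show "edges H \<subseteq> edges (grassmann_graph 2)"
    proof
      fix e assume "e \<in> edges H"
      then obtain X Y where "e = {project X, project Y}" "X \<in> NC 2" "Y \<in> NC 2" "adjacent 2 X Y" by (auto simp: H_def)
      then show "e \<in> edges (grassmann_graph 2)" using edges_grassmann project_adjacent by blast
    qed
  qed
  moreover have "graph_iso project (code_graph 2) H"
    unfolding graph_iso_def using inj_project by (auto simp: bij_betw_def vH edges_code eH)
  moreover obtain L L' where L: "L \<in> NC 2" "L' \<in> NC 2" "\<not> adjacent 2 L L'" "adjacent 2 (project L) (project L')"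
    by (rule project_creates_edge)
  have PG: "project L \<in> Gr 2" "project L' \<in> Gr 2" using L project_Gr NC_Gr by blast+
  have "\<not> (\<exists>g. graph_aut g (grassmann_graph 2) \<and> (\<forall>C\<in>verts (code_graph 2). g C = f C))"
    if f: "graph_iso f (code_graph 2) H" for f
  proof
    assume "\<exists>g. graph_aut g (grassmann_graph 2) \<and> (\<forall>C\<in>verts (code_graph 2). g C = f C)"
    then obtain g where g: "graph_aut g (grassmann_graph 2)" "\<And>C. C \<in> NC 2 \<Longrightarrow> g C = f C" by auto
    have "f ` NC 2 = project ` NC 2" using f by (auto simp: graph_iso_def bij_betw_def vH)
    then have "project L \<in> f ` NC 2" "project L' \<in> f ` NC 2" using L by blast+
    then obtain M M' where M: "M \<in> NC 2" "M' \<in> NC 2" "project L = f M" "project L' = f M'" by blast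
    have "adjacent 2 (g M) (g M')" using L(4) M g(2) by simp
    then have "adjacent 2 M M'" using graph_aut_adjacent[OF g(1)] M NC_Gr by blast
    then have "{f M, f M'} \<in> edges H" using f M edges_code unfolding graph_iso_def verts_code by blast
    then show False using eH[OF L(1,2)] M(3,4) L(3) by simp
  qed
  moreover have "\<not> (\<exists>g. graph_aut g (grassmann_graph 2) \<and> (\<forall>C\<in>verts H. g C = f C))"
    if f: "graph_iso f H (code_graph 2)" for f
  proof
    assume "\<exists>g. graph_aut g (grassmann_graph 2) \<and> (\<forall>C\<in>verts H. g C = f C)"
    then obtain g where g: "graph_aut g (grassmann_graph 2)" "\<And>C. C \<in> verts H \<Longrightarrow> g C = f C" by auto
    have PH: "project L \<in> verts H" "project L' \<in> verts H" using L by (auto simp: vH)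
    have fN: "f (project L) \<in> NC 2" "f (project L') \<in> NC 2"
      using f PH by (auto simp: graph_iso_def bij_betw_def)
    have "adjacent 2 (f (project L)) (f (project L'))"
      using graph_aut_adjacent[OF g(1) PG] L(4) g(2)[OF PH(1)] g(2)[OF PH(2)] by simp
    then have "{f (project L), f (project L')} \<in> edges (code_graph 2)" using fN edges_code by blast
    then have "{project L, project L'} \<in> edges H" using f PH unfolding graph_iso_def by blast
    then show False using eH L by blast
  qed
  ultimately show ?thesis by blast
qed

end

lemma graph_iso_code_embedding:
  fixes H :: "('a::{field,finite} ^ 'n::finite) set ugraph"
  assumes k: "1 < k" "k < CARD('n) - 1"
    and H: "is_subgraph H (grassmann_graph k)" and f: "graph_iso f (code_graph k) H"
  shows "code_embedding f k"
proof
  show "2 \<le> k" "k + 2 \<le> CARD('n)" using k by linarith+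
  have bij: "bij_betw f (NC k) (verts H)" using f by (simp add: graph_iso_def)
  show "f Y \<in> Gr k" if "Y \<in> NC k" for Y
    using bij_betwE[OF bij] that H by (auto simp: is_subgraph_def)
  show "inj_on f (NC k)" using bij by (rule bij_betw_imp_inj_on)
  show "adjacent k (f Y) (f Z)" if YZ: "Y \<in> NC k" "Z \<in> NC k" "adjacent k Y Z" for Y Z
  proof -
    have "{f Y, f Z} \<in> edges H" using f YZ edges_code unfolding graph_iso_def verts_code by blast
    then show ?thesis using H edges_grassmann unfolding is_subgraph_def by blast
  qed
qed

theorem theorem1:
  fixes k :: nat
  assumes "1 < k" and "k < CARD('n::finite) - 1"
  shows "(CARD('a::{field,finite}) \<ge> 3 \<or> k \<ge> 3 \<longrightarrow>
           (\<forall>(H :: ('a ^ 'n) set ugraph) f.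
              is_subgraph H (grassmann_graph k) \<and> graph_iso f (code_graph k) H \<longrightarrow>
              (\<exists>!g. g \<in> extensional (verts (grassmann_graph k)) \<and>
                    graph_aut g (grassmann_graph k) \<and>
                    (\<forall>C\<in>verts (code_graph k). g C = f C))))
       \<and> (CARD('a) = 2 \<and> k = 2 \<longrightarrow>
           (\<exists>H :: ('a ^ 'n) set ugraph.
              is_subgraph H (grassmann_graph k) \<and>
              (\<exists>f. graph_iso f (code_graph k :: ('a ^ 'n) set ugraph) H) \<and>
              (\<forall>f. graph_iso f (code_graph k) H \<longrightarrow>
                 \<not> (\<exists>g. graph_aut g (grassmann_graph k) \<and> (\<forall>C\<in>verts (code_graph k). g C = f C))) \<and>
              (\<forall>f. graph_iso f H (code_graph k) \<longrightarrow>
                 \<not> (\<exists>g. graph_aut g (grassmann_graph k) \<and> (\<forall>C\<in>verts H. g C = f C)))))"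
proof (intro conjI impI allI)
  fix H :: "('a ^ 'n) set ugraph" and f :: "('a ^ 'n) set \<Rightarrow> ('a ^ 'n) set"
  assume qk: "CARD('a) \<ge> 3 \<or> k \<ge> 3"
    and Hf: "is_subgraph H (grassmann_graph k) \<and> graph_iso f (code_graph k) H"
  have k: "2 \<le> k" "k + 2 \<le> CARD('n)" using assms by linarith+
  obtain g where g: "graph_aut g (grassmann_graph k)" "\<forall>Y\<in>NC k. g Y = f Y"
    using code_embedding_extends[OF graph_iso_code_embedding[OF assms] qk, of H f] Hf by blast
  show "\<exists>!g. g \<in> extensional (verts (grassmann_graph k)) \<and> graph_aut g (grassmann_graph k) \<and>
    (\<forall>C\<in>verts (code_graph k). g C = f C)"
  \<comment> \<open>Functions are total, so the automorphism is cut down to the vertices; its values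
    elsewhere would spoil uniqueness.\<close>
  proof (rule ex1I[of _ "restrict g (Gr k)"])
    show "restrict g (Gr k) \<in> extensional (verts (grassmann_graph k)) \<and>
      graph_aut (restrict g (Gr k)) (grassmann_graph k) \<and> (\<forall>C\<in>verts (code_graph k). restrict g (Gr k) C = f C)"
      using graph_aut_restrict[OF g(1)] g(2) NC_Gr by auto
    fix g' assume g': "g' \<in> extensional (verts (grassmann_graph k)) \<and> graph_aut g' (grassmann_graph k) \<and>
      (\<forall>C\<in>verts (code_graph k). g' C = f C)"
    show "g' = restrict g (Gr k)"
    proof (rule extensionalityI[of _ "Gr k"])
      fix X :: "('a ^ 'n) set" assume X: "X \<in> Gr k"
      have "g' X = g X" using extension_unique[OF k _ g(1) _ X] g' g(2) by simp
      then show "g' X = restrict g (Gr k) X" using X by simp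
    qed (use g' in auto)
  qed
next
  assume "CARD('a) = 2 \<and> k = 2"
  then have q: "CARD('a) = 2" and k: "k = 2" by auto
  have n: "4 \<le> CARD('n)" using assms k by linarith
  show "\<exists>H :: ('a ^ 'n) set ugraph.
      is_subgraph H (grassmann_graph k) \<and>
      (\<exists>f. graph_iso f (code_graph k :: ('a ^ 'n) set ugraph) H) \<and>
      (\<forall>f. graph_iso f (code_graph k) H \<longrightarrow>
         \<not> (\<exists>g. graph_aut g (grassmann_graph k) \<and> (\<forall>C\<in>verts (code_graph k). g C = f C))) \<and>
      (\<forall>f. graph_iso f H (code_graph k) \<longrightarrow>
         \<not> (\<exists>g. graph_aut g (grassmann_graph k) \<and> (\<forall>C\<in>verts H. g C = f C)))"
    unfolding k by (rule binary_lines_not_extendable[OF q n])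
qed

end
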